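(* Let $m\in\mathbb Z$ and let $B_m$ be the commutative differential graded algebra (CDGA) over $\mathbb Q$ whose underlying graded commutative algebra is freely generated by symbols $x_n$, $n\ge2$, of degree $|x_n|=n-2+mn-m$, with differential of degree $-1$ given on generators by $$d(x_n)=\sum_{\substack{p+q-1=n\\ 1\le i\le p}}(-1)^{(q-1)i+(p+m(i-1))(q+1)m}\,x_qx_p,\qquad n\ge2,$$ where $p,q\geq 2$. If $m\le-2$, then the CDGA $B_m$ is not homotopically finitely presented.
   Context: CDGAs are $\mathbb Z$-graded, unital, over $\mathbb Q$, with homological grading (differentials have degree $-1$). The category of CDGAs over $\mathbb Q$ carries the model structure in which weak equivalences are quasi-isomorphisms and fibrations are degreewise surjections. An object $X$ of a model category $\mathscr M$ is homotopically finitely presented if the derived mapping space functor $\operatorname{Map}_{\mathscr M}(X,-)$ preserves filtered homotopy colimits (i.e. the canonical map $\operatorname{hocolim}_i\operatorname{Map}_{\mathscr M}(X,Z_i)\to\operatorname{Map}_{\mathscr M}(X,\operatorname{hocolim}_iZ_i)$ is a weak equivalence for every filtered diagram). *)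

theory Defs
  imports
    "HOL-Algebra.Module"
    "HOL-Algebra.Coset"
    "HOL-Homology.Simplices"
    "HOL-Library.Multiset"
    "HOL-Library.Infinite_Typeclass"
begin

section \<open>Commutative differential graded algebras over the rationals\<close>

definition RAT :: "rat ring" where
  "RAT = \<lparr>carrier = UNIV, monoid.mult = (*), one = 1, ring.zero = 0, ring.add = (+)\<rparr>"

text \<open>
  A \<open>\<int>\<close>-graded algebra is a family of \<open>\<rat>\<close>-modules indexed by the degree; all elements are
  homogeneous, and every operation carries the degrees of its arguments.  Thus
  \<open>cmult A k l : A\<^sub>k \<times> A\<^sub>l \<rightarrow> A\<^sub>k\<^sub>+\<^sub>l\<close> and \<open>cdiff A k : A\<^sub>k \<rightarrow> A\<^sub>k\<^sub>-\<^sub>1\<close>.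
  (The ring fields \<open>mult\<close> and \<open>one\<close> of the module records \<open>grade A k\<close> are never used.)
\<close>

record 'a cdga =
  grade :: "int \<Rightarrow> (rat, 'a) module"
  cunit :: 'a
  cmult :: "int \<Rightarrow> int \<Rightarrow> 'a \<Rightarrow> 'a \<Rightarrow> 'a"
  cdiff :: "int \<Rightarrow> 'a \<Rightarrow> 'a"

abbreviation elts :: "'a cdga \<Rightarrow> int \<Rightarrow> 'a set" where
  "elts A k \<equiv> carrier (grade A k)"

definition linear_between :: "(rat, 'a) module \<Rightarrow> (rat, 'b) module \<Rightarrow> ('a \<Rightarrow> 'b) \<Rightarrow> bool" where
  "linear_between M N f \<longleftrightarrow>
     f \<in> carrier M \<rightarrow> carrier N \<and>
     (\<forall>x\<in>carrier M. \<forall>y\<in>carrier M. f (x \<oplus>\<^bsub>M\<^esub> y) = f x \<oplus>\<^bsub>N\<^esub> f y) \<and>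
     (\<forall>c. \<forall>x\<in>carrier M. f (c \<odot>\<^bsub>M\<^esub> x) = c \<odot>\<^bsub>N\<^esub> f x)"

definition is_cdga :: "'a cdga \<Rightarrow> bool" where
  "is_cdga A \<longleftrightarrow>
     (\<forall>k. Module.module RAT (grade A k)) \<and>
     \<comment> \<open>unital associative graded commutative algebra\<close>
     cunit A \<in> elts A 0 \<and>
     (\<forall>k l. \<forall>x\<in>elts A k. linear_between (grade A l) (grade A (k + l)) (\<lambda>y. cmult A k l x y)) \<and>
     (\<forall>k l. \<forall>y\<in>elts A l. linear_between (grade A k) (grade A (k + l)) (\<lambda>x. cmult A k l x y)) \<and>
     (\<forall>k. \<forall>x\<in>elts A k. cmult A 0 k (cunit A) x = x) \<and>
     (\<forall>j k l. \<forall>x\<in>elts A j. \<forall>y\<in>elts A k. \<forall>z\<in>elts A l.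
        cmult A (j + k) l (cmult A j k x y) z = cmult A j (k + l) x (cmult A k l y z)) \<and>
     (\<forall>k l. \<forall>x\<in>elts A k. \<forall>y\<in>elts A l.
        cmult A k l x y = ((-1) powi (k * l)) \<odot>\<^bsub>grade A (k + l)\<^esub> cmult A l k y x) \<and>
     \<comment> \<open>differential of degree \<open>-1\<close>, a graded derivation\<close>
     (\<forall>k. linear_between (grade A k) (grade A (k - 1)) (cdiff A k)) \<and>
     (\<forall>k. \<forall>x\<in>elts A k. cdiff A (k - 1) (cdiff A k x) = \<zero>\<^bsub>grade A (k - 2)\<^esub>) \<and>
     (\<forall>k l. \<forall>x\<in>elts A k. \<forall>y\<in>elts A l.
        cdiff A (k + l) (cmult A k l x y) =
          cmult A (k - 1) l (cdiff A k x) y \<oplus>\<^bsub>grade A (k + l - 1)\<^esub>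
          ((-1) powi k) \<odot>\<^bsub>grade A (k + l - 1)\<^esub> cmult A k (l - 1) x (cdiff A l y))"

text \<open>Morphisms are extensional, so that two of them are equal iff they agree on all elements.\<close>

definition cdga_hom :: "'a cdga \<Rightarrow> 'b cdga \<Rightarrow> (int \<Rightarrow> 'a \<Rightarrow> 'b) set" where
  "cdga_hom A B = {f.
     (\<forall>k. f k \<in> extensional (elts A k) \<and> linear_between (grade A k) (grade B k) (f k)) \<and>
     f 0 (cunit A) = cunit B \<and>
     (\<forall>k l. \<forall>x\<in>elts A k. \<forall>y\<in>elts A l.
        f (k + l) (cmult A k l x y) = cmult B k l (f k x) (f l y)) \<and>
     (\<forall>k. \<forall>x\<in>elts A k. f (k - 1) (cdiff A k x) = cdiff B k (f k x))}"

subsection \<open>The model structure\<close>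

definition cycles :: "'a cdga \<Rightarrow> int \<Rightarrow> 'a set" where
  "cycles A k = {z \<in> elts A k. cdiff A k z = \<zero>\<^bsub>grade A (k - 1)\<^esub>}"

definition boundaries :: "'a cdga \<Rightarrow> int \<Rightarrow> 'a set" where
  "boundaries A k = cdiff A (k + 1) ` elts A (k + 1)"

definition homology :: "'a cdga \<Rightarrow> int \<Rightarrow> 'a set monoid" where
  "homology A k = (add_monoid (grade A k)\<lparr>carrier := cycles A k\<rparr>) Mod boundaries A k"

definition homology_map ::
  "'b cdga \<Rightarrow> (int \<Rightarrow> 'a \<Rightarrow> 'b) \<Rightarrow> int \<Rightarrow> 'a set \<Rightarrow> 'b set" where
  "homology_map B f k C = (\<Union>z\<in>C. boundaries B k #>\<^bsub>add_monoid (grade B k)\<^esub> f k z)"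

definition quasi_iso :: "'a cdga \<Rightarrow> 'b cdga \<Rightarrow> (int \<Rightarrow> 'a \<Rightarrow> 'b) \<Rightarrow> bool" where
  "quasi_iso A B f \<longleftrightarrow> f \<in> cdga_hom A B \<and>
     (\<forall>k. bij_betw (homology_map B f k) (carrier (homology A k)) (carrier (homology B k)))"

definition fibration :: "'a cdga \<Rightarrow> 'b cdga \<Rightarrow> (int \<Rightarrow> 'a \<Rightarrow> 'b) \<Rightarrow> bool" where
  "fibration A B f \<longleftrightarrow> f \<in> cdga_hom A B \<and> (\<forall>k. f k ` elts A k = elts B k)"

text \<open>
  In the definitions below a type \<open>'u\<close> plays the role of a universe: the model category consists
  of the CDGAs whose elements are drawn from \<open>'u\<close>, and small index categories have their objects
  and arrows in \<open>'u\<close>.  An object is cofibrant if the map from the initial object has the left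
  lifting property with respect to trivial fibrations.
\<close>

definition cofibrant :: "'u cdga \<Rightarrow> bool" where
  "cofibrant Q \<longleftrightarrow> is_cdga Q \<and>
     (\<forall>(E :: 'u cdga) (F :: 'u cdga) p g.
        is_cdga E \<and> is_cdga F \<and> fibration E F p \<and> quasi_iso E F p \<and> g \<in> cdga_hom Q F \<longrightarrow>
        (\<exists>h\<in>cdga_hom Q E. \<forall>k. \<forall>x\<in>elts Q k. p k (h k x) = g k x))"


section \<open>Free graded commutative algebras with a derivation\<close>

text \<open>
  A monomial in a set \<open>G\<close> of linearly ordered generators is a multiset of generators in which
  generators of odd degree occur at most once; the multiset \<open>{#g\<^sub>1, \<dots>, g\<^sub>r#}\<close> with
  \<open>g\<^sub>1 \<le> \<dots> \<le> g\<^sub>r\<close> stands for the ordered product \<open>g\<^sub>1 \<cdots> g\<^sub>r\<close>.  These monomials form a basis of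
  the free graded commutative algebra, whose elements are finitely supported coefficient
  functions.  \<open>mon_sign\<close> is the Koszul sign for sorting a product of two ordered monomials.
\<close>

definition monomials :: "('g \<Rightarrow> int) \<Rightarrow> 'g set \<Rightarrow> 'g multiset set" where
  "monomials deg G = {K. set_mset K \<subseteq> G \<and> (\<forall>g. odd (deg g) \<longrightarrow> count K g \<le> 1)}"

definition mdeg :: "('g \<Rightarrow> int) \<Rightarrow> 'g multiset \<Rightarrow> int" where
  "mdeg deg K = (\<Sum>g\<in>#K. deg g)"

definition mon_sign :: "('g::linorder \<Rightarrow> int) \<Rightarrow> 'g multiset \<Rightarrow> 'g multiset \<Rightarrow> rat" where
  "mon_sign deg M N =
     (-1) ^ (\<Sum>g\<in>#M. \<Sum>h\<in>#N. if h < g \<and> odd (deg g) \<and> odd (deg h) then 1 else 0)"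

definition pmono :: "'g multiset \<Rightarrow> 'g multiset \<Rightarrow> rat" where
  "pmono M = (\<lambda>K. if K = M then 1 else 0)"

abbreviation pvar :: "'g \<Rightarrow> 'g multiset \<Rightarrow> rat" where
  "pvar g \<equiv> pmono {#g#}"

definition pmul ::
  "('g::linorder \<Rightarrow> int) \<Rightarrow> 'g set \<Rightarrow> ('g multiset \<Rightarrow> rat) \<Rightarrow> ('g multiset \<Rightarrow> rat) \<Rightarrow>
   'g multiset \<Rightarrow> rat" where
  "pmul deg G f g = (\<lambda>K. if K \<in> monomials deg G
     then \<Sum>M | M \<subseteq># K. mon_sign deg M (K - M) * f M * g (K - M) else 0)"

text \<open>The derivation of degree \<open>-1\<close> with prescribed values \<open>\<delta>\<close> on the generators.\<close>

fun dword ::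
  "('g::linorder \<Rightarrow> int) \<Rightarrow> 'g set \<Rightarrow> ('g \<Rightarrow> 'g multiset \<Rightarrow> rat) \<Rightarrow> 'g list \<Rightarrow>
   'g multiset \<Rightarrow> rat" where
  "dword deg G \<delta> [] = (\<lambda>L. 0)"
| "dword deg G \<delta> (g # w) = (\<lambda>L.
     pmul deg G (\<delta> g) (pmono (mset w)) L +
     (-1) powi (deg g) * pmul deg G (pvar g) (dword deg G \<delta> w) L)"

definition dmono ::
  "('g::linorder \<Rightarrow> int) \<Rightarrow> 'g set \<Rightarrow> ('g \<Rightarrow> 'g multiset \<Rightarrow> rat) \<Rightarrow> 'g multiset \<Rightarrow>
   'g multiset \<Rightarrow> rat" where
  "dmono deg G \<delta> K = dword deg G \<delta> (sorted_list_of_multiset K)"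

definition free_cdga ::
  "('g::linorder \<Rightarrow> int) \<Rightarrow> 'g set \<Rightarrow> ('g \<Rightarrow> 'g multiset \<Rightarrow> rat) \<Rightarrow>
   ('g multiset \<Rightarrow> rat) cdga" where
  "free_cdga deg G \<delta> = \<lparr>
     grade = (\<lambda>k. \<lparr>
       carrier = {f. finite {K. f K \<noteq> 0} \<and>
                     (\<forall>K. f K \<noteq> 0 \<longrightarrow> K \<in> monomials deg G \<and> mdeg deg K = k)},
       monoid.mult = undefined, one = undefined,
       ring.zero = (\<lambda>K. 0),
       ring.add = (\<lambda>f g K. f K + g K),
       smult = (\<lambda>c f K. c * f K)\<rparr>),
     cunit = pmono {#},
     cmult = (\<lambda>k l. pmul deg G),
     cdiff = (\<lambda>k f L. \<Sum>K | f K \<noteq> 0. f K * dmono deg G \<delta> K L)\<rparr>"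

subsection \<open>The algebra \<open>B\<^sub>m\<close>\<close>

definition degB :: "int \<Rightarrow> nat \<Rightarrow> int" where
  "degB m n = int n - 2 + m * int n - m"

definition dB :: "int \<Rightarrow> nat \<Rightarrow> nat multiset \<Rightarrow> rat" where
  "dB m n = (\<lambda>K. \<Sum>(p, q, i) | 2 \<le> p \<and> 2 \<le> q \<and> p + q - 1 = n \<and> 1 \<le> i \<and> i \<le> p.
     (-1) powi ((int q - 1) * int i + (int p + m * (int i - 1)) * (int q + 1) * m)
       * pmul (degB m) {2..} (pvar q) (pvar p) K)"

definition cdga_B :: "int \<Rightarrow> (nat multiset \<Rightarrow> rat) cdga" where
  "cdga_B m = free_cdga (degB m) {2..} (dB m)"


section \<open>Simplicial sets and weak equivalences\<close>

text \<open>\<open>act X k n \<theta>\<close> is the operator \<open>X\<^sub>n \<rightarrow> X\<^sub>k\<close> of a monotone map \<open>\<theta> : [k] \<rightarrow> [n]\<close>.\<close>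

record 's sset =
  simp :: "nat \<Rightarrow> 's set"
  act :: "nat \<Rightarrow> nat \<Rightarrow> (nat \<Rightarrow> nat) \<Rightarrow> 's \<Rightarrow> 's"

definition monotone_maps :: "nat \<Rightarrow> nat \<Rightarrow> (nat \<Rightarrow> nat) set" where
  "monotone_maps k n = {\<theta> \<in> {..k} \<rightarrow>\<^sub>E {..n}. mono_on {..k} \<theta>}"

definition simplex_push :: "nat \<Rightarrow> (nat \<Rightarrow> nat) \<Rightarrow> (nat \<Rightarrow> real) \<Rightarrow> nat \<Rightarrow> real" where
  "simplex_push k \<theta> t = (\<lambda>i. \<Sum>j | j \<le> k \<and> \<theta> j = i. t j)"

text \<open>
  The geometric realization is the quotient of the disjoint union of the spaces
  \<open>X\<^sub>n \<times> \<Delta>\<^sup>n\<close> (with \<open>X\<^sub>n\<close> discrete) by the relation generated by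
  \<open>(\<theta>\<^sup>*x, t) \<sim> (x, \<theta>\<^sub>*t)\<close>.
\<close>

definition points :: "'s sset \<Rightarrow> (nat \<times> 's \<times> (nat \<Rightarrow> real)) set" where
  "points X = {(n, x, t). x \<in> simp X n \<and> t \<in> standard_simplex n}"

definition glue :: "'s sset \<Rightarrow> (nat \<times> 's \<times> (nat \<Rightarrow> real)) rel" where
  "glue X = {((k, act X k n \<theta> x, t), (n, x, simplex_push k \<theta> t)) | k n \<theta> x t.
     \<theta> \<in> monotone_maps k n \<and> x \<in> simp X n \<and> t \<in> standard_simplex k}"

definition point_eq :: "'s sset \<Rightarrow> (nat \<times> 's \<times> (nat \<Rightarrow> real)) rel" where
  "point_eq X = (glue X \<union> (glue X)\<inverse>)\<^sup>* \<inter> (points X \<times> points X)"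

definition realization :: "'s sset \<Rightarrow> (nat \<times> 's \<times> (nat \<Rightarrow> real)) set topology" where
  "realization X = topology (\<lambda>U. U \<subseteq> points X // point_eq X \<and>
     (\<forall>n. \<forall>x\<in>simp X n.
        openin (subtopology (powertop_real UNIV) (standard_simplex n))
          {t \<in> standard_simplex n. point_eq X `` {(n, x, t)} \<in> U}))"

lemma openin_realization:
  "openin (realization X) U \<longleftrightarrow> U \<subseteq> points X // point_eq X \<and>
     (\<forall>n. \<forall>x\<in>simp X n.
        openin (subtopology (powertop_real UNIV) (standard_simplex n))
          {t \<in> standard_simplex n. point_eq X `` {(n, x, t)} \<in> U})"
proof -
  have "istopology (\<lambda>U. U \<subseteq> points X // point_eq X \<and>
     (\<forall>n. \<forall>x\<in>simp X n.
        openin (subtopology (powertop_real UNIV) (standard_simplex n))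
          {t \<in> standard_simplex n. point_eq X `` {(n, x, t)} \<in> U}))"
    (is "istopology ?L")
    unfolding istopology_def
  proof (rule conjI; intro allI impI)
    fix S T assume S: "?L S" and T: "?L T"
    have "openin (subtopology (powertop_real UNIV) (standard_simplex n))
          {t \<in> standard_simplex n. point_eq X `` {(n, x, t)} \<in> S \<inter> T}"
      if "x \<in> simp X n" for n x
    proof -
      have "{t \<in> standard_simplex n. point_eq X `` {(n, x, t)} \<in> S \<inter> T} =
            {t \<in> standard_simplex n. point_eq X `` {(n, x, t)} \<in> S} \<inter>
            {t \<in> standard_simplex n. point_eq X `` {(n, x, t)} \<in> T}" by auto
      then show ?thesis using S T that by (metis (no_types, lifting) openin_Int)
    qed
    then show "?L (S \<inter> T)" using S by blast
  next
    fix \<K> assume K: "\<forall>S\<in>\<K>. ?L S"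
    have "openin (subtopology (powertop_real UNIV) (standard_simplex n))
          {t \<in> standard_simplex n. point_eq X `` {(n, x, t)} \<in> \<Union>\<K>}"
      if "x \<in> simp X n" for n x
    proof -
      have "{t \<in> standard_simplex n. point_eq X `` {(n, x, t)} \<in> \<Union>\<K>} =
            (\<Union>S\<in>\<K>. {t \<in> standard_simplex n. point_eq X `` {(n, x, t)} \<in> S})" by auto
      moreover have "openin (subtopology (powertop_real UNIV) (standard_simplex n)) \<dots>"
        using K that by (intro openin_Union) auto
      ultimately show ?thesis by simp
    qed
    then show "?L (\<Union>\<K>)" using K by blast
  qed
  then show ?thesis unfolding realization_def by (simp only: topology_inverse')
qed

definition realize_map ::
  "'t sset \<Rightarrow> (nat \<Rightarrow> 's \<Rightarrow> 't) \<Rightarrow> (nat \<times> 's \<times> (nat \<Rightarrow> real)) set \<Rightarrow>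
   (nat \<times> 't \<times> (nat \<Rightarrow> real)) set" where
  "realize_map Y g C = point_eq Y `` ((\<lambda>(n, x, t). (n, g n x, t)) ` C)"

definition cube :: "nat \<Rightarrow> (nat \<Rightarrow> real) topology" where
  "cube n = product_topology (\<lambda>_. top_of_set {0..1}) {..<n}"

definition cube_boundary :: "nat \<Rightarrow> (nat \<Rightarrow> real) set" where
  "cube_boundary n = {t \<in> topspace (cube n). \<exists>i<n. t i = 0 \<or> t i = 1}"

definition spheroids :: "nat \<Rightarrow> 'a topology \<Rightarrow> 'a \<Rightarrow> ((nat \<Rightarrow> real) \<Rightarrow> 'a) set" where
  "spheroids n X x = {\<gamma>. continuous_map (cube n) X \<gamma> \<and> (\<forall>t\<in>cube_boundary n. \<gamma> t = x)}"

definition spheroid_homotopic ::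
  "nat \<Rightarrow> 'a topology \<Rightarrow> 'a \<Rightarrow> ((nat \<Rightarrow> real) \<Rightarrow> 'a) \<Rightarrow> ((nat \<Rightarrow> real) \<Rightarrow> 'a) \<Rightarrow> bool" where
  "spheroid_homotopic n X x =
     homotopic_with (\<lambda>h. \<forall>t\<in>cube_boundary n. h t = x) (cube n) X"

text \<open>
  \<open>f\<close> is continuous and bijective on path components, and on \<open>\<pi>\<^sub>n\<close> for all \<open>n \<ge> 1\<close> and all base points.
\<close>

definition weak_homotopy_equivalence ::
  "'a topology \<Rightarrow> 'b topology \<Rightarrow> ('a \<Rightarrow> 'b) \<Rightarrow> bool" where
  "weak_homotopy_equivalence X Y f \<longleftrightarrow> continuous_map X Y f \<and>
     (\<forall>y\<in>topspace Y. \<exists>x\<in>topspace X. path_component_of Y (f x) y) \<and>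
     (\<forall>x\<in>topspace X. \<forall>x'\<in>topspace X.
        path_component_of Y (f x) (f x') \<longrightarrow> path_component_of X x x') \<and>
     (\<forall>n\<ge>1. \<forall>x\<in>topspace X.
        (\<forall>\<epsilon>\<in>spheroids n Y (f x). \<exists>\<gamma>\<in>spheroids n X x. spheroid_homotopic n Y (f x) (f \<circ> \<gamma>) \<epsilon>) \<and>
        (\<forall>\<gamma>\<in>spheroids n X x. \<forall>\<gamma>'\<in>spheroids n X x.
           spheroid_homotopic n Y (f x) (f \<circ> \<gamma>) (f \<circ> \<gamma>') \<longrightarrow> spheroid_homotopic n X x \<gamma> \<gamma>'))"

definition weak_equivalence :: "'s sset \<Rightarrow> 't sset \<Rightarrow> (nat \<Rightarrow> 's \<Rightarrow> 't) \<Rightarrow> bool" where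
  "weak_equivalence X Y g \<longleftrightarrow>
     weak_homotopy_equivalence (realization X) (realization Y) (realize_map Y g)"


section \<open>Derived mapping spaces\<close>

text \<open>
  \<open>\<Omega>\<^sub>n = \<rat>[t\<^sub>0, \<dots>, t\<^sub>n, dt\<^sub>0, \<dots>, dt\<^sub>n] / (\<Sum>t\<^sub>i = 1, \<Sum>dt\<^sub>i = 0)\<close>, the polynomial differential forms
  on the \<open>n\<close>-simplex, is free on \<open>t\<^sub>i\<close> (degree \<open>0\<close>, encoded as the integer \<open>i\<close>) and \<open>dt\<^sub>i\<close>
  (homological degree \<open>-1\<close>, encoded as \<open>-i\<close>) for \<open>1 \<le> i \<le> n\<close>; \<open>t\<^sub>0\<close> and \<open>dt\<^sub>0\<close> are
  eliminated.
\<close>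

definition form_gens :: "nat \<Rightarrow> int set" where
  "form_gens n = {g. g \<noteq> 0 \<and> \<bar>g\<bar> \<le> int n}"

definition form_deg :: "int \<Rightarrow> int" where
  "form_deg g = (if g > 0 then 0 else -1)"

definition form_d :: "int \<Rightarrow> int multiset \<Rightarrow> rat" where
  "form_d g = (if g > 0 then pvar (- g) else (\<lambda>K. 0))"

abbreviation form_monos :: "nat \<Rightarrow> int multiset set" where
  "form_monos n \<equiv> monomials form_deg (form_gens n)"

abbreviation fdeg :: "int multiset \<Rightarrow> int" where
  "fdeg \<equiv> mdeg form_deg"

abbreviation form_dmono :: "nat \<Rightarrow> int multiset \<Rightarrow> int multiset \<Rightarrow> rat" where
  "form_dmono n \<equiv> dmono form_deg (form_gens n) form_d"

definition bary :: "nat \<Rightarrow> nat \<Rightarrow> int multiset \<Rightarrow> rat" where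
  "bary k j = (if j = 0 then (\<lambda>K. pmono {#} K - (\<Sum>r = 1..k. pvar (int r) K)) else pvar (int j))"

definition dbary :: "nat \<Rightarrow> nat \<Rightarrow> int multiset \<Rightarrow> rat" where
  "dbary k j = (if j = 0 then (\<lambda>K. - (\<Sum>r = 1..k. pvar (- int r) K)) else pvar (- int j))"

text \<open>
  For \<open>\<theta> : [k] \<rightarrow> [n]\<close>, the operator \<open>\<theta>\<^sup>* : \<Omega>\<^sub>n \<rightarrow> \<Omega>\<^sub>k\<close> is the algebra map sending \<open>t\<^sub>i\<close> to the sum
  of the \<open>t\<^sub>j\<close> with \<open>\<theta> j = i\<close>, and similarly for \<open>dt\<^sub>i\<close>.
\<close>

definition form_pull_gen :: "nat \<Rightarrow> (nat \<Rightarrow> nat) \<Rightarrow> int \<Rightarrow> int multiset \<Rightarrow> rat" where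
  "form_pull_gen k \<theta> g = (\<lambda>K. \<Sum>j | j \<le> k \<and> \<theta> j = nat \<bar>g\<bar>.
     if g > 0 then bary k j K else dbary k j K)"

definition form_pull :: "nat \<Rightarrow> (nat \<Rightarrow> nat) \<Rightarrow> int multiset \<Rightarrow> int multiset \<Rightarrow> rat" where
  "form_pull k \<theta> K =
     foldr (\<lambda>g. pmul form_deg (form_gens k) (form_pull_gen k \<theta> g))
       (sorted_list_of_multiset K) (pmono {#})"

text \<open>
  The CDGA \<open>A \<otimes> \<Omega>\<^sub>n\<close>: its elements of degree \<open>k\<close> are the finite sums \<open>\<Sum>\<^sub>K u\<^sub>K \<otimes> K\<close> over the
  monomials \<open>K\<close> of \<open>\<Omega>\<^sub>n\<close>, with \<open>u\<^sub>K \<in> A\<close> of degree \<open>k - |K|\<close>.  Product and differential are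
  \<open>(x \<otimes> M)(y \<otimes> N) = (-1)\<^bsup>|M||y|\<^esup> xy \<otimes> MN\<close> and
  \<open>d(x \<otimes> K) = dx \<otimes> K + (-1)\<^bsup>|x|\<^esup> x \<otimes> dK\<close>.
\<close>

definition tensor_forms :: "'a cdga \<Rightarrow> nat \<Rightarrow> (int multiset \<Rightarrow> 'a) cdga" where
  "tensor_forms A n = \<lparr>
     grade = (\<lambda>k. \<lparr>
       carrier = {u \<in> (\<Pi>\<^sub>E K\<in>form_monos n. elts A (k - fdeg K)).
                    finite {K \<in> form_monos n. u K \<noteq> \<zero>\<^bsub>grade A (k - fdeg K)\<^esub>}},
       monoid.mult = undefined, one = undefined,
       ring.zero = (\<lambda>K\<in>form_monos n. \<zero>\<^bsub>grade A (k - fdeg K)\<^esub>),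
       ring.add = (\<lambda>u v. \<lambda>K\<in>form_monos n. u K \<oplus>\<^bsub>grade A (k - fdeg K)\<^esub> v K),
       smult = (\<lambda>c u. \<lambda>K\<in>form_monos n. c \<odot>\<^bsub>grade A (k - fdeg K)\<^esub> u K)\<rparr>),
     cunit = (\<lambda>K\<in>form_monos n. if K = {#} then cunit A else \<zero>\<^bsub>grade A (- fdeg K)\<^esub>),
     cmult = (\<lambda>k l u v. \<lambda>K\<in>form_monos n.
       \<Oplus>\<^bsub>grade A (k + l - fdeg K)\<^esub>M\<in>{M. M \<subseteq># K}.
         ((-1) powi (fdeg M * (l - fdeg (K - M))) * mon_sign form_deg M (K - M))
           \<odot>\<^bsub>grade A (k + l - fdeg K)\<^esub>
         cmult A (k - fdeg M) (l - fdeg (K - M)) (u M) (v (K - M))),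
     cdiff = (\<lambda>k u. \<lambda>L\<in>form_monos n.
       cdiff A (k - fdeg L) (u L) \<oplus>\<^bsub>grade A (k - 1 - fdeg L)\<^esub>
       (\<Oplus>\<^bsub>grade A (k - 1 - fdeg L)\<^esub>K\<in>{K \<in> form_monos n.
            u K \<noteq> \<zero>\<^bsub>grade A (k - fdeg K)\<^esub> \<and> form_dmono n K L \<noteq> 0}.
         ((-1) powi (k - fdeg K) * form_dmono n K L)
           \<odot>\<^bsub>grade A (k - 1 - fdeg L)\<^esub> u K))\<rparr>"

text \<open>The maps \<open>id \<otimes> \<theta>\<^sup>* : A \<otimes> \<Omega>\<^sub>n \<rightarrow> A \<otimes> \<Omega>\<^sub>k\<close> and \<open>\<phi> \<otimes> id : A \<otimes> \<Omega>\<^sub>n \<rightarrow> B \<otimes> \<Omega>\<^sub>n\<close> in degree \<open>j\<close>.\<close>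

definition tensor_pull ::
  "'a cdga \<Rightarrow> nat \<Rightarrow> nat \<Rightarrow> (nat \<Rightarrow> nat) \<Rightarrow> int \<Rightarrow> (int multiset \<Rightarrow> 'a) \<Rightarrow> int multiset \<Rightarrow> 'a" where
  "tensor_pull A k n \<theta> j u = (\<lambda>L\<in>form_monos k.
     \<Oplus>\<^bsub>grade A (j - fdeg L)\<^esub>K\<in>{K \<in> form_monos n.
          u K \<noteq> \<zero>\<^bsub>grade A (j - fdeg K)\<^esub> \<and> form_pull k \<theta> K L \<noteq> 0}.
       form_pull k \<theta> K L \<odot>\<^bsub>grade A (j - fdeg L)\<^esub> u K)"

definition tensor_push ::
  "nat \<Rightarrow> (int \<Rightarrow> 'a \<Rightarrow> 'b) \<Rightarrow> int \<Rightarrow> (int multiset \<Rightarrow> 'a) \<Rightarrow> int multiset \<Rightarrow> 'b" where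
  "tensor_push n \<phi> j u = (\<lambda>K\<in>form_monos n. \<phi> (j - fdeg K) (u K))"

text \<open>
  For cofibrant \<open>Q\<close>, the simplicial set \<open>Hom(Q, Z \<otimes> \<Omega>\<^sub>\<bullet>)\<close> is the derived mapping space: every
  CDGA is fibrant and \<open>Z \<otimes> \<Omega>\<^sub>\<bullet>\<close> is a simplicial resolution of \<open>Z\<close>, functorial in \<open>Z\<close>.
  \<open>mapping_push\<close> is this functoriality.
\<close>

definition mapping_space ::
  "'a cdga \<Rightarrow> 'b cdga \<Rightarrow> (int \<Rightarrow> 'a \<Rightarrow> int multiset \<Rightarrow> 'b) sset" where
  "mapping_space Q Z = \<lparr>
     simp = (\<lambda>n. cdga_hom Q (tensor_forms Z n)),
     act = (\<lambda>k n \<theta> f j. \<lambda>x\<in>elts Q j. tensor_pull Z k n \<theta> j (f j x))\<rparr>"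

definition mapping_push ::
  "'a cdga \<Rightarrow> (int \<Rightarrow> 'b \<Rightarrow> 'c) \<Rightarrow> nat \<Rightarrow> (int \<Rightarrow> 'a \<Rightarrow> int multiset \<Rightarrow> 'b) \<Rightarrow>
   int \<Rightarrow> 'a \<Rightarrow> int multiset \<Rightarrow> 'c" where
  "mapping_push Q \<phi> n f = (\<lambda>j. \<lambda>x\<in>elts Q j. tensor_push n \<phi> j (f j x))"


section \<open>Filtered diagrams and homotopy colimits\<close>

record 'u cat =
  Obj :: "'u set"
  Arr :: "'u set"
  Dom :: "'u \<Rightarrow> 'u"
  Cod :: "'u \<Rightarrow> 'u"
  Idn :: "'u \<Rightarrow> 'u"
  Cmp :: "'u \<Rightarrow> 'u \<Rightarrow> 'u"  \<comment> \<open>\<open>Cmp I b a\<close> is \<open>b \<circ> a\<close>\<close>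

definition is_category :: "'u cat \<Rightarrow> bool" where
  "is_category I \<longleftrightarrow>
     (\<forall>a\<in>Arr I. Dom I a \<in> Obj I \<and> Cod I a \<in> Obj I) \<and>
     (\<forall>i\<in>Obj I. Idn I i \<in> Arr I \<and> Dom I (Idn I i) = i \<and> Cod I (Idn I i) = i) \<and>
     (\<forall>a\<in>Arr I. \<forall>b\<in>Arr I. Cod I a = Dom I b \<longrightarrow>
        Cmp I b a \<in> Arr I \<and> Dom I (Cmp I b a) = Dom I a \<and> Cod I (Cmp I b a) = Cod I b) \<and>
     (\<forall>a\<in>Arr I. Cmp I a (Idn I (Dom I a)) = a \<and> Cmp I (Idn I (Cod I a)) a = a) \<and>
     (\<forall>a\<in>Arr I. \<forall>b\<in>Arr I. \<forall>c\<in>Arr I. Cod I a = Dom I b \<and> Cod I b = Dom I c \<longrightarrow>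
        Cmp I c (Cmp I b a) = Cmp I (Cmp I c b) a)"

definition filtered_category :: "'u cat \<Rightarrow> bool" where
  "filtered_category I \<longleftrightarrow> is_category I \<and> Obj I \<noteq> {} \<and>
     (\<forall>i\<in>Obj I. \<forall>j\<in>Obj I. \<exists>a\<in>Arr I. \<exists>b\<in>Arr I.
        Dom I a = i \<and> Dom I b = j \<and> Cod I a = Cod I b) \<and>
     (\<forall>a\<in>Arr I. \<forall>b\<in>Arr I. Dom I a = Dom I b \<and> Cod I a = Cod I b \<longrightarrow>
        (\<exists>c\<in>Arr I. Dom I c = Cod I a \<and> Cmp I c a = Cmp I c b))"

record 'u diagram =
  dobj :: "'u \<Rightarrow> 'u cdga"
  darr :: "'u \<Rightarrow> int \<Rightarrow> 'u \<Rightarrow> 'u"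

definition is_diagram :: "'u cat \<Rightarrow> 'u diagram \<Rightarrow> bool" where
  "is_diagram I Z \<longleftrightarrow>
     (\<forall>i\<in>Obj I. is_cdga (dobj Z i)) \<and>
     (\<forall>a\<in>Arr I. darr Z a \<in> cdga_hom (dobj Z (Dom I a)) (dobj Z (Cod I a))) \<and>
     (\<forall>i\<in>Obj I. \<forall>k. \<forall>x\<in>elts (dobj Z i) k. darr Z (Idn I i) k x = x) \<and>
     (\<forall>a\<in>Arr I. \<forall>b\<in>Arr I. Cod I a = Dom I b \<longrightarrow>
        (\<forall>k. \<forall>x\<in>elts (dobj Z (Dom I a)) k. darr Z (Cmp I b a) k x = darr Z b k (darr Z a k x)))"

definition nat_trans :: "'u cat \<Rightarrow> 'u diagram \<Rightarrow> 'u diagram \<Rightarrow> ('u \<Rightarrow> int \<Rightarrow> 'u \<Rightarrow> 'u) set" where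
  "nat_trans I Z W = {\<eta>.
     (\<forall>i\<in>Obj I. \<eta> i \<in> cdga_hom (dobj Z i) (dobj W i)) \<and>
     (\<forall>a\<in>Arr I. \<forall>k. \<forall>x\<in>elts (dobj Z (Dom I a)) k.
        \<eta> (Cod I a) k (darr Z a k x) = darr W a k (\<eta> (Dom I a) k x))}"

text \<open>
  Cofibrant objects of the projective model structure on diagrams, in which weak equivalences and
  fibrations are objectwise.  The homotopy colimit of a diagram of CDGAs, being the left derived
  functor of the colimit, is the colimit of a projectively cofibrant replacement.
\<close>

definition proj_cofibrant :: "'u cat \<Rightarrow> 'u diagram \<Rightarrow> bool" where
  "proj_cofibrant I Z \<longleftrightarrow> is_diagram I Z \<and>
     (\<forall>E F p g. is_diagram I E \<and> is_diagram I F \<and> p \<in> nat_trans I E F \<and>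
        (\<forall>i\<in>Obj I. fibration (dobj E i) (dobj F i) (p i) \<and>
                    quasi_iso (dobj E i) (dobj F i) (p i)) \<and>
        g \<in> nat_trans I Z F \<longrightarrow>
        (\<exists>h\<in>nat_trans I Z E.
           \<forall>i\<in>Obj I. \<forall>k. \<forall>x\<in>elts (dobj Z i) k. p i k (h i k x) = g i k x))"

definition proj_cofibrant_replacement ::
  "'u cat \<Rightarrow> 'u diagram \<Rightarrow> 'u diagram \<Rightarrow> ('u \<Rightarrow> int \<Rightarrow> 'u \<Rightarrow> 'u) \<Rightarrow> bool" where
  "proj_cofibrant_replacement I Z Z' w \<longleftrightarrow> proj_cofibrant I Z' \<and> w \<in> nat_trans I Z' Z \<and>
     (\<forall>i\<in>Obj I. quasi_iso (dobj Z' i) (dobj Z i) (w i))"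

text \<open>
  The colimit of a filtered diagram: its elements are germs, i.e. classes of pairs \<open>(i, z)\<close> with
  \<open>z \<in> Z\<^sub>i\<close>, two pairs being identified if they become equal at a later stage.
\<close>

definition germ_eq :: "'u cat \<Rightarrow> 'u diagram \<Rightarrow> int \<Rightarrow> ('u \<times> 'u) rel" where
  "germ_eq I Z k = {((i, z), (j, w)).
     i \<in> Obj I \<and> j \<in> Obj I \<and> z \<in> elts (dobj Z i) k \<and> w \<in> elts (dobj Z j) k \<and>
     (\<exists>a\<in>Arr I. \<exists>b\<in>Arr I. Dom I a = i \<and> Dom I b = j \<and> Cod I a = Cod I b \<and>
        darr Z a k z = darr Z b k w)}"

definition germ :: "'u cat \<Rightarrow> 'u diagram \<Rightarrow> 'u \<Rightarrow> int \<Rightarrow> 'u \<Rightarrow> ('u \<times> 'u) set" where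
  "germ I Z i k z = germ_eq I Z k `` {(i, z)}"

definition colimit :: "'u cat \<Rightarrow> 'u diagram \<Rightarrow> ('u \<times> 'u) set cdga" where
  "colimit I Z = \<lparr>
     grade = (\<lambda>k. \<lparr>
       carrier = {germ I Z i k z | i z. i \<in> Obj I \<and> z \<in> elts (dobj Z i) k},
       monoid.mult = undefined, one = undefined,
       ring.zero = (\<Union>i\<in>Obj I. germ I Z i k (\<zero>\<^bsub>grade (dobj Z i) k\<^esub>)),
       ring.add = (\<lambda>C D. \<Union>{germ I Z i k (z \<oplus>\<^bsub>grade (dobj Z i) k\<^esub> w) | i z w. (i, z) \<in> C \<and> (i, w) \<in> D}),
       smult = (\<lambda>c C. \<Union>{germ I Z i k (c \<odot>\<^bsub>grade (dobj Z i) k\<^esub> z) | i z. (i, z) \<in> C})\<rparr>),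
     cunit = (\<Union>i\<in>Obj I. germ I Z i 0 (cunit (dobj Z i))),
     cmult = (\<lambda>k l C D.
       \<Union>{germ I Z i (k + l) (cmult (dobj Z i) k l z w) | i z w. (i, z) \<in> C \<and> (i, w) \<in> D}),
     cdiff = (\<lambda>k C. \<Union>{germ I Z i (k - 1) (cdiff (dobj Z i) k z) | i z. (i, z) \<in> C})\<rparr>"

text \<open>
  \<open>n\<close>-simplices of the nerve: functors \<open>[n] \<rightarrow> I\<close>, given by the arrows \<open>\<sigma> (i, j)\<close> for \<open>i \<le> j \<le> n\<close>.
\<close>

definition nerve :: "'u cat \<Rightarrow> nat \<Rightarrow> (nat \<times> nat \<Rightarrow> 'u) set" where
  "nerve I n = {\<sigma> \<in> extensional {(i, j). i \<le> j \<and> j \<le> n}.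
     (\<forall>i j. i \<le> j \<and> j \<le> n \<longrightarrow> \<sigma> (i, j) \<in> Arr I) \<and>
     (\<forall>i\<le>n. \<exists>x\<in>Obj I. \<sigma> (i, i) = Idn I x) \<and>
     (\<forall>i j k. i \<le> j \<and> j \<le> k \<and> k \<le> n \<longrightarrow>
        Cod I (\<sigma> (i, j)) = Dom I (\<sigma> (j, k)) \<and> \<sigma> (i, k) = Cmp I (\<sigma> (j, k)) (\<sigma> (i, j)))}"

definition source :: "'u cat \<Rightarrow> (nat \<times> nat \<Rightarrow> 'u) \<Rightarrow> 'u" where
  "source I \<sigma> = Dom I (\<sigma> (0, 0))"

text \<open>
  The Bousfield--Kan homotopy colimit of a diagram \<open>F\<close> of simplicial sets, i.e. the diagonal of
  the simplicial replacement: its \<open>n\<close>-simplices are pairs of a chain \<open>i\<^sub>0 \<rightarrow> \<dots> \<rightarrow> i\<^sub>n\<close> in \<open>I\<close> and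
  an \<open>n\<close>-simplex of \<open>F i\<^sub>0\<close>.
\<close>

definition hocolim_sset ::
  "'u cat \<Rightarrow> ('u \<Rightarrow> 's sset) \<Rightarrow> ('u \<Rightarrow> nat \<Rightarrow> 's \<Rightarrow> 's) \<Rightarrow> ((nat \<times> nat \<Rightarrow> 'u) \<times> 's) sset" where
  "hocolim_sset I F Fa = \<lparr>
     simp = (\<lambda>n. {(\<sigma>, x). \<sigma> \<in> nerve I n \<and> x \<in> simp (F (source I \<sigma>)) n}),
     act = (\<lambda>k n \<theta> (\<sigma>, x).
       (restrict (\<lambda>(i, j). \<sigma> (\<theta> i, \<theta> j)) {(i, j). i \<le> j \<and> j \<le> k},
        Fa (\<sigma> (0, \<theta> 0)) k (act (F (source I \<sigma>)) k n \<theta> x)))\<rparr>"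


section \<open>Homotopically finitely presented CDGAs\<close>

text \<open>
  For a cofibrant replacement \<open>Q\<close> of \<open>X\<close> and a filtered diagram \<open>Z\<close> with projectively cofibrant
  replacement \<open>Z'\<close>, the canonical map
  \<open>hocolim\<^sub>i Map(X, Z\<^sub>i) \<rightarrow> Map(X, hocolim\<^sub>i Z\<^sub>i)\<close>
  of derived mapping spaces is
  \<open>hocolim\<^sub>i Hom(Q, Z'\<^sub>i \<otimes> \<Omega>\<^sub>\<bullet>) \<rightarrow> Hom(Q, (colim\<^sub>i Z'\<^sub>i) \<otimes> \<Omega>\<^sub>\<bullet>)\<close>,
  given on a summand \<open>i\<^sub>0 \<rightarrow> \<dots> \<rightarrow> i\<^sub>n\<close> by composing with \<open>Z'\<^sub>i\<^sub>0 \<rightarrow> colim Z'\<close>.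
\<close>

definition canonical_map ::
  "'q cdga \<Rightarrow> 'u cat \<Rightarrow> 'u diagram \<Rightarrow> nat \<Rightarrow>
   (nat \<times> nat \<Rightarrow> 'u) \<times> (int \<Rightarrow> 'q \<Rightarrow> int multiset \<Rightarrow> 'u) \<Rightarrow>
   int \<Rightarrow> 'q \<Rightarrow> int multiset \<Rightarrow> ('u \<times> 'u) set" where
  "canonical_map Q I Z n = (\<lambda>(\<sigma>, f). mapping_push Q (germ I Z (source I \<sigma>)) n f)"

text \<open>
  The type \<open>'u\<close> is the universe from which replacements, diagrams and index categories are
  drawn; it is meant to be infinite and large enough to contain a cofibrant replacement of \<open>X\<close>.
\<close>

definition homotopically_finitely_presented :: "'u itself \<Rightarrow> 'a cdga \<Rightarrow> bool" where
  "homotopically_finitely_presented _ X \<longleftrightarrow>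
     (\<forall>(Q :: 'u cdga) q (I :: 'u cat) Z Z' w.
        cofibrant Q \<and> quasi_iso Q X q \<and>
        filtered_category I \<and> is_diagram I Z \<and> proj_cofibrant_replacement I Z Z' w \<longrightarrow>
        weak_equivalence
          (hocolim_sset I (\<lambda>i. mapping_space Q (dobj Z' i)) (\<lambda>a. mapping_push Q (darr Z' a)))
          (mapping_space Q (colimit I Z'))
          (canonical_map Q I Z'))"

end

theory Submission
  imports Defs "HOL-Library.Function_Algebras" "HOL-Library.Countable_Set"
begin

text \<open>
  For \<open>m \<le> -2\<close> the algebra \<open>B\<^sub>m\<close> is a minimal Sullivan algebra: \<open>dx\<^sub>n\<close> is a quadratic expression in
  the \<open>x\<^sub>q\<close> with \<open>q < n\<close>.  Hence \<open>B\<^sub>m\<close> is cofibrant, and the tower of its subalgebras generated by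
  \<open>x\<^sub>2, \<dots>, x\<^sub>n\<close> is a projectively cofibrant diagram with colimit \<open>B\<^sub>m\<close>.  If \<open>B\<^sub>m\<close> were homotopically
  finitely presented, the vertex of \<open>Map(B\<^sub>m, colim)\<close> given by the identity would lie in the path
  component of a point coming from a finite stage.

  To a simplex \<open>f : B\<^sub>m \<rightarrow> B\<^sub>m \<otimes> \<Omega>\<^sub>n\<close> assign the part of \<open>f(x\<^sub>r)\<close> that is linear in \<open>x\<^sub>r\<close>.  For degree
  reasons it is a polynomial function on the simplex.  It is closed, hence constant: \<open>df(x\<^sub>r) = f(dx\<^sub>r)\<close>
  is a sum of products \<open>f(x\<^sub>q)f(x\<^sub>p)\<close>, and since \<open>x\<^sub>p\<close> and \<open>x\<^sub>q\<close> have degree at most \<open>-2\<close> these have no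
  component \<open>x\<^sub>r \<otimes> \<omega>\<close> with \<open>\<omega>\<close> a 1-form.  So this constant depends only on the path component.
  It is 1 for the identity, and 0 for \<open>r > n\<close> if \<open>f\<close> factors through the \<open>n\<close>-th subalgebra.
\<close>

subsection \<open>Monomials and Koszul signs\<close>


text \<open>The universe \<open>'u\<close> is only assumed infinite, yet diagrams, index categories
  and replacements have to live in it. Polynomials are finitely supported functions from
  \<open>nat multiset\<close> to \<open>rat\<close>, hence countably many, so they can be encoded in
  \<open>'u\<close>, and every algebra is copied along one common encoding. The bound on
  \<open>m\<close> acts through \<open>degB m n = (n - 1) * (m + 1) - 1\<close>. A product contains
  \<open>x_r\<close> linearly only if one factor has a constant term. A constant term in the image
  of \<open>x_p\<close> would have to be multiplied by a form of the degree of \<open>x_p\<close>,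
  which is too low to divide a 1-form. Two facts are computations rather than formalities: that the
  given coefficients satisfy d^2 = 0, a parity check on \<open>coeffB\<close>, and that a derivation
  prescribed on sorted words obeys the Leibniz rule for unsorted ones. That a closed polynomial
  function is constant rests on characteristic 0: the exponents produced by differentiation do not
  vanish in \<open>rat\<close>.\<close>

lemma finite_submultisets [simp]: "finite {M. M \<subseteq># K}"
proof (induction K)
  case (add x K)
  have "{M. M \<subseteq># add_mset x K} \<subseteq> {M. M \<subseteq># K} \<union> add_mset x ` {M. M \<subseteq># K}"
  proof
    fix M assume "M \<in> {M. M \<subseteq># add_mset x K}"
    then have M: "M \<subseteq># add_mset x K" by simp
    show "M \<in> {M. M \<subseteq># K} \<union> add_mset x ` {M. M \<subseteq># K}"
    proof (cases "x \<in># M")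
      case True
      then obtain N where "M = add_mset x N" by (metis insert_DiffM)
      then show ?thesis using M by auto
    next
      case False
      have "count M a \<le> count K a" for a
        using mset_subset_eq_count[OF M, of a] False by (cases "a = x") (auto simp: not_in_iff)
      then have "M \<subseteq># K" by (simp add: subseteq_mset_def)
      then show ?thesis by auto
    qed
  qed
  then show ?case using add finite_subset by fastforce
qed simp

text \<open>With the pointwise \<open>+\<close> and \<open>0\<close> of functions this replaces the
  module operations of \<open>free_cdga\<close>, so that the algebra can be done on plain
  functions.\<close>

definition scal :: "rat \<Rightarrow> ('g multiset \<Rightarrow> rat) \<Rightarrow> 'g multiset \<Rightarrow> rat" (infixr "\<cdot>" 75) where
  "c \<cdot> f = (\<lambda>K. c * f K)"

lemma scal_apply [simp]: "(c \<cdot> f) K = c * f K"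
  by (simp add: scal_def)

lemma scal_simps [simp]:
  "c \<cdot> (d \<cdot> f) = (c * d) \<cdot> f" "1 \<cdot> f = f" "0 \<cdot> f = 0" "c \<cdot> 0 = 0"
  by (auto simp: fun_eq_iff)

lemma scal_add: "c \<cdot> (f + g) = c \<cdot> f + c \<cdot> g" "(c + d) \<cdot> f = c \<cdot> f + d \<cdot> f"
  by (auto simp: fun_eq_iff algebra_simps)

lemma sum_apply: "(\<Sum>x\<in>A. F x) K = (\<Sum>x\<in>A. F x (K::'b) :: 'c::comm_monoid_add)"
  by (induction A rule: infinite_finite_induct) auto

lemma scal_sum: "c \<cdot> (\<Sum>x\<in>A. F x) = (\<Sum>x\<in>A. c \<cdot> F x)"
  by (auto simp: fun_eq_iff sum_apply sum_distrib_left)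

lemma mdeg_simps [simp]:
  "mdeg deg {#} = 0" "mdeg deg (add_mset g M) = deg g + mdeg deg M"
  "mdeg deg (M + N) = mdeg deg M + mdeg deg N"
  by (auto simp: mdeg_def)

lemma mdeg_diff: "M \<subseteq># K \<Longrightarrow> mdeg deg (K - M) = mdeg deg K - mdeg deg M"
  by (metis mdeg_simps(3) subset_mset.diff_add add_diff_cancel_right')

lemma mon_sign_add_left: "mon_sign deg (M + M') N = mon_sign deg M N * mon_sign deg M' N"
  by (simp add: mon_sign_def power_add)

lemma mon_sign_add_right: "mon_sign deg M (N + N') = mon_sign deg M N * mon_sign deg M N'"
  by (simp add: mon_sign_def power_add sum_mset.distrib)

lemma mon_sign_empty [simp]: "mon_sign deg {#} N = 1" "mon_sign deg M {#} = 1"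
  by (auto simp: mon_sign_def)

lemma mon_sign_single: "mon_sign deg {#g#} {#h#} = (if h < g \<and> odd (deg g) \<and> odd (deg h) then -1 else 1)"
  by (auto simp: mon_sign_def)

lemma mon_sign_add_mset:
  "mon_sign deg (add_mset g M) N = mon_sign deg {#g#} N * mon_sign deg M N"
  "mon_sign deg M (add_mset h N) = mon_sign deg M {#h#} * mon_sign deg M N"
  using mon_sign_add_left[of deg "{#g#}" M N] mon_sign_add_right[of deg M "{#h#}" N] by auto

lemma mon_sign_minimal:
  assumes "\<forall>h\<in>#N. g \<le> h" shows "mon_sign deg {#g#} N = 1"
  using assms
  by (induction N) (auto simp: mon_sign_add_mset(2)[of deg "{#g#}" _ "_ :: _ multiset"] mon_sign_single)

lemma mon_sign_even_gen:
  "even (deg g) \<Longrightarrow> mon_sign deg {#g#} N = 1" "even (deg g) \<Longrightarrow> mon_sign deg N {#g#} = 1"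
  by (auto simp: mon_sign_def)

text \<open>For two distinct odd generators exactly one of the two orders costs a sign. For equal
  odd generators neither does, although the product of the degrees is odd; hence the
  exclusion.\<close>

lemma mon_sign_single_commute:
  assumes "\<not> (g \<in># M \<and> odd (deg g))"
  shows "mon_sign deg {#g#} M = (-1) powi (deg g * mdeg deg M) * mon_sign deg M {#g#}"
  using assms
proof (induction M)
  case (add h M)
  then have "mon_sign deg {#g#} {#h#} = (-1) powi (deg g * deg h) * mon_sign deg {#h#} {#g#}"
    by (auto simp: mon_sign_single)
  moreover have "mon_sign deg {#g#} M = (-1) powi (deg g * mdeg deg M) * mon_sign deg M {#g#}"
    using add by auto
  ultimately show ?case
    unfolding mon_sign_add_mset(2)[of deg "{#g#}" h M] mon_sign_add_mset(1)[of deg h M "{#g#}"]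
    by (simp add: distrib_left power_int_add)
qed simp

lemma mon_sign_commute:
  assumes "\<forall>g. odd (deg g) \<longrightarrow> count (M + N) g \<le> 1"
  shows "mon_sign deg M N = (-1) powi (mdeg deg M * mdeg deg N) * mon_sign deg N M"
  using assms
proof (induction M)
  case (add g M)
  have *: "\<not> (g \<in># N \<and> odd (deg g))"
    using add.prems[rule_format, of g] by (auto simp: not_in_iff)
  have "\<forall>h. odd (deg h) \<longrightarrow> count (M + N) h \<le> 1"
  proof (intro allI impI)
    fix h assume "odd (deg h)"
    then have "count (add_mset g M + N) h \<le> 1" using add.prems by blast
    then show "count (M + N) h \<le> 1" by (simp split: if_splits)
  qed
  then have "mon_sign deg M N = (-1) powi (mdeg deg M * mdeg deg N) * mon_sign deg N M"
    by (rule add.IH)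
  with mon_sign_single_commute[where M=N and deg=deg and g=g, OF *] show ?case
    by (simp add: distrib_right power_int_add mon_sign_add_mset(1)[of deg g M N] mon_sign_add_mset(2)[of deg N g M])
qed simp

lemma pmono_apply [simp]: "pmono M M = 1" "K \<noteq> M \<Longrightarrow> pmono M K = 0"
  by (auto simp: pmono_def)

lemma pmono_nz [simp]: "pmono M K \<noteq> 0 \<longleftrightarrow> K = M" "pmono M K = 0 \<longleftrightarrow> K \<noteq> M"
  by (auto simp: pmono_def)

subsection \<open>The product\<close>

locale graded_gens =
  fixes deg :: "'g::linorder \<Rightarrow> int" and G :: "'g set"
begin

abbreviation "mons \<equiv> monomials deg G"

abbreviation mul (infixl "\<star>" 70) where "mul \<equiv> pmul deg G"

text \<open>The degree \<open>k\<close> part of \<open>free_cdga\<close> (see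
  \<open>elts_free\<close>), named separately so that product and derivation can be treated before
  any CDGA is formed.\<close>

definition homog :: "int \<Rightarrow> ('g multiset \<Rightarrow> rat) set" where
  "homog k = {f. finite {K. f K \<noteq> 0} \<and> (\<forall>K. f K \<noteq> 0 \<longrightarrow> K \<in> mons \<and> mdeg deg K = k)}"

lemma mons_mono: "K \<in> mons \<Longrightarrow> M \<subseteq># K \<Longrightarrow> M \<in> mons"
  by (auto simp: monomials_def dest: mset_subset_eqD)
    (meson le_trans mset_subset_eq_count)

lemma mons_diff: "K \<in> mons \<Longrightarrow> K - M \<in> mons"
  by (erule mons_mono) simp

lemma mons_empty [simp]: "{#} \<in> mons"
  by (simp add: monomials_def)

lemma mons_single [simp]: "{#g#} \<in> mons \<longleftrightarrow> g \<in> G"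
  by (auto simp: monomials_def)

lemma mons_add_mset:
  "add_mset g M \<in> mons \<longleftrightarrow> g \<in> G \<and> M \<in> mons \<and> \<not> (g \<in># M \<and> odd (deg g))"
proof -
  have "(\<forall>h. odd (deg h) \<longrightarrow> count (add_mset g M) h \<le> 1) \<longleftrightarrow>
    (\<forall>h. odd (deg h) \<longrightarrow> count M h \<le> 1) \<and> \<not> (g \<in># M \<and> odd (deg g))" (is "?A \<longleftrightarrow> ?B \<and> ?C")
  proof (intro iffI conjI allI impI)
    fix h assume "?A" "odd (deg h)"
    then have "count (add_mset g M) h \<le> 1" by blast
    then show "count M h \<le> 1" by (simp split: if_splits)
  next
    assume ?A
    then have "odd (deg g) \<Longrightarrow> count (add_mset g M) g \<le> 1" by blast
    then show ?C by (auto simp: not_in_iff)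
  next
    fix h assume "?B \<and> ?C" "odd (deg h)"
    then show "count (add_mset g M) h \<le> 1" by (cases "h = g") (auto simp: not_in_iff)
  qed
  then show ?thesis by (auto simp: monomials_def)
qed

lemma homogD: "f \<in> homog k \<Longrightarrow> finite {K. f K \<noteq> 0}"
  "f \<in> homog k \<Longrightarrow> f K \<noteq> 0 \<Longrightarrow> K \<in> mons" "f \<in> homog k \<Longrightarrow> f K \<noteq> 0 \<Longrightarrow> mdeg deg K = k"
  by (auto simp: homog_def)

lemma homog_zero [simp]: "0 \<in> homog k"
  by (simp add: homog_def)

lemma homog_scal: "f \<in> homog k \<Longrightarrow> c \<cdot> f \<in> homog k"
  by (auto simp: homog_def elim: finite_subset[rotated])

lemma homog_add: assumes "f \<in> homog k" "g \<in> homog k" shows "f + g \<in> homog k"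
proof -
  have "finite {K. (f + g) K \<noteq> 0}"
    by (rule finite_subset[of _ "{K. f K \<noteq> 0} \<union> {K. g K \<noteq> 0}"]) (use assms in \<open>auto simp: homog_def\<close>)
  moreover have "K \<in> mons \<and> mdeg deg K = k" if "(f + g) K \<noteq> 0" for K
    using that assms by (cases "f K = 0") (auto simp: homog_def)
  ultimately show ?thesis by (auto simp: homog_def)
qed

lemma homog_sum: "(\<And>x. x \<in> A \<Longrightarrow> F x \<in> homog k) \<Longrightarrow> (\<Sum>x\<in>A. F x) \<in> homog k"
  by (induction A rule: infinite_finite_induct) (auto intro: homog_add)

lemma homog_pmono: "M \<in> mons \<Longrightarrow> mdeg deg M = k \<Longrightarrow> pmono M \<in> homog k"
  by (auto simp: homog_def)

lemma homog_pvar: "g \<in> G \<Longrightarrow> pvar g \<in> homog (deg g)"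
  by (rule homog_pmono) auto

lemma pmono_expand:
  assumes "finite S" "{K. f K \<noteq> 0} \<subseteq> S"
  shows "f = (\<Sum>K\<in>S. f K \<cdot> pmono K)"
proof
  fix L
  have "(\<Sum>K\<in>S. f K \<cdot> pmono K) L = (\<Sum>K\<in>S. if K = L then f K else 0)"
    unfolding sum_apply by (rule sum.cong) (auto simp: pmono_def)
  then show "f L = (\<Sum>K\<in>S. f K \<cdot> pmono K) L" using assms by (auto simp: sum.delta)
qed

text \<open>Adding one monomial at a time reduces every identity that is linear in a homogeneous
  polynomial to monomials.\<close>

lemma homog_induct [consumes 1, case_names zero add]:
  assumes f: "f \<in> homog k" and zero: "P 0"
    and add: "\<And>c K f. f \<in> homog k \<Longrightarrow> K \<in> mons \<Longrightarrow> mdeg deg K = k \<Longrightarrow> P f \<Longrightarrow> P (c \<cdot> pmono K + f)"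
  shows "P f"
proof -
  have "P (\<Sum>K\<in>S. f K \<cdot> pmono K) \<and> (\<Sum>K\<in>S. f K \<cdot> pmono K) \<in> homog k"
    if "finite S" "S \<subseteq> {K. f K \<noteq> 0}" for S
    using that
  proof (induction S rule: finite_induct)
    case (insert K S)
    then have "K \<in> mons" "mdeg deg K = k" using f by (auto simp: homog_def)
    moreover have "P (\<Sum>K\<in>S. f K \<cdot> pmono K)" "(\<Sum>K\<in>S. f K \<cdot> pmono K) \<in> homog k"
      using insert by blast+
    ultimately show ?case unfolding sum.insert[OF insert(1,2)]
      by (intro conjI add homog_add homog_scal homog_pmono)
  qed (use zero in auto)
  from this[OF homogD(1)[OF f] order_refl] show ?thesis
    unfolding pmono_expand[OF homogD(1)[OF f] order_refl, symmetric] by blast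
qed

lemma mul_add: "(f + g) \<star> h = f \<star> h + g \<star> h" "f \<star> (g + h) = f \<star> g + f \<star> h"
  by (auto simp: fun_eq_iff pmul_def algebra_simps sum.distrib)

lemma mul_scal: "(c \<cdot> f) \<star> h = c \<cdot> (f \<star> h)" "f \<star> (c \<cdot> h) = c \<cdot> (f \<star> h)"
  by (auto simp: fun_eq_iff pmul_def algebra_simps sum_distrib_left)

lemma mul_zero [simp]: "0 \<star> h = 0" "h \<star> 0 = 0"
  by (auto simp: fun_eq_iff pmul_def)

lemma mul_sum_left: "(\<Sum>x\<in>A. F x) \<star> h = (\<Sum>x\<in>A. F x \<star> h)"
  by (induction A rule: infinite_finite_induct)
    (simp_all only: sum.infinite sum.empty sum.insert mul_add mul_zero not_False_eq_True)

lemma mul_sum_right: "h \<star> (\<Sum>x\<in>A. F x) = (\<Sum>x\<in>A. h \<star> F x)"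
  by (induction A rule: infinite_finite_induct)
    (simp_all only: sum.infinite sum.empty sum.insert mul_add mul_zero not_False_eq_True)

lemma mul_pmono_left:
  "(pmono M \<star> f) K = (if K \<in> mons \<and> M \<subseteq># K then mon_sign deg M (K - M) * f (K - M) else 0)"
proof -
  have "(\<Sum>N | N \<subseteq># K. mon_sign deg N (K - N) * pmono M N * f (K - N)) =
        (\<Sum>N | N \<subseteq># K. if N = M then mon_sign deg M (K - M) * f (K - M) else 0)"
    by (rule sum.cong) (auto simp: pmono_def)
  then show ?thesis by (auto simp: pmul_def sum.delta)
qed

lemma mul_pmono:
  "pmono M \<star> pmono N = (if M + N \<in> mons then mon_sign deg M N \<cdot> pmono (M + N) else 0)"
proof
  fix K
  have "M \<subseteq># K \<Longrightarrow> K - M = N \<longleftrightarrow> K = M + N" by auto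
  then show "(pmono M \<star> pmono N) K = (if M + N \<in> mons then mon_sign deg M N \<cdot> pmono (M + N) else 0) K"
    unfolding mul_pmono_left by (auto simp: pmono_def)
qed

lemma mul_unit_left: "(\<And>K. f K \<noteq> 0 \<Longrightarrow> K \<in> mons) \<Longrightarrow> pmono {#} \<star> f = f"
  by (auto simp: fun_eq_iff mul_pmono_left)

lemma homog_mul:
  assumes "f \<in> homog k" "g \<in> homog l" shows "f \<star> g \<in> homog (k + l)"
proof -
  let ?S = "(\<lambda>(M, N). M + N) ` ({K. f K \<noteq> 0} \<times> {K. g K \<noteq> 0})"
  have *: "K \<in> mons \<and> K \<in> ?S \<and> mdeg deg K = k + l" if nz: "(f \<star> g) K \<noteq> 0" for K
  proof -
    have K: "K \<in> mons" using nz by (auto simp: pmul_def split: if_splits)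
    with nz obtain M where M: "M \<subseteq># K" "f M \<noteq> 0" "g (K - M) \<noteq> 0"
      by (auto simp: pmul_def split: if_splits elim: sum.not_neutral_contains_not_neutral)
    then have "mdeg deg M = k" "mdeg deg (K - M) = l" using assms by (auto simp: homog_def)
    then have "mdeg deg K = k + l" using M(1) by (auto simp: mdeg_diff)
    moreover have "K = M + (K - M)" using M by simp
    then have "K \<in> ?S" using M(2,3) by (auto intro!: image_eqI[of _ _ "(M, K - M)"])
    ultimately show ?thesis using K by blast
  qed
  have "finite {K. (f \<star> g) K \<noteq> 0}"
    by (rule finite_subset[of _ ?S]) (use * assms homogD(1) in auto)
  then show ?thesis using * by (auto simp: homog_def)
qed

text \<open>Both bracketings sum over the ordered decompositions of \<open>K\<close> into three
  parts. The signs agree because \<open>mon_sign\<close> is multiplicative in each argument.\<close>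

lemma mul_assoc: "f \<star> g \<star> h = f \<star> (g \<star> h)"
proof
  fix K
  show "(f \<star> g \<star> h) K = (f \<star> (g \<star> h)) K"
  proof (cases "K \<in> mons")
    case True
    have "(f \<star> g \<star> h) K = (\<Sum>N | N \<subseteq># K. \<Sum>M | M \<subseteq># N.
        mon_sign deg N (K - N) * mon_sign deg M (N - M) * f M * g (N - M) * h (K - N))"
      using True mons_mono[OF True]
      by (auto simp: pmul_def sum_distrib_left sum_distrib_right algebra_simps intro!: sum.cong)
    also have "\<dots> = (\<Sum>(N, M)\<in>(SIGMA N:{N. N \<subseteq># K}. {M. M \<subseteq># N}).
        mon_sign deg N (K - N) * mon_sign deg M (N - M) * f M * g (N - M) * h (K - N))"
      by (subst sum.Sigma) auto
    also have "\<dots> = (\<Sum>(M, L)\<in>(SIGMA M:{M. M \<subseteq># K}. {L. L \<subseteq># K - M}).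
        mon_sign deg M (K - M) * mon_sign deg L (K - M - L) * f M * g L * h (K - M - L))"
    proof (rule sum.reindex_bij_witness[of _ "\<lambda>(M, L). (M + L, M)" "\<lambda>(N, M). (M, N - M)"])
      fix a assume "a \<in> (SIGMA N:{N. N \<subseteq># K}. {M. M \<subseteq># N})"
      then obtain N M where a: "a = (N, M)" and N: "N \<subseteq># K" "M \<subseteq># N" by auto
      show "(case case a of (N, M) \<Rightarrow> (M, N - M) of (M, L) \<Rightarrow> (M + L, M)) = a"
        using a N by simp
      have MK: "M \<subseteq># K" using N by (rule subset_mset.trans[rotated])
      have "N - M \<subseteq># K - M" using N MK by (simp add: subseteq_mset_def diff_le_mono)
      then show "(case a of (N, M) \<Rightarrow> (M, N - M)) \<in> (SIGMA M:{M. M \<subseteq># K}. {L. L \<subseteq># K - M})"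
        using a MK by auto
      obtain P where P: "N = M + P" using N by (auto simp: subset_mset.le_iff_add)
      obtain R where R: "K = M + P + R" using N P by (auto simp: subset_mset.le_iff_add)
      show "(case case a of (N, M) \<Rightarrow> (M, N - M) of
         (M, L) \<Rightarrow> mon_sign deg M (K - M) * mon_sign deg L (K - M - L) * f M * g L * h (K - M - L)) =
         (case a of (N, M) \<Rightarrow>
          mon_sign deg N (K - N) * mon_sign deg M (N - M) * f M * g (N - M) * h (K - N))"
        unfolding a P R by (simp add: mon_sign_add_left mon_sign_add_right add.assoc)
    next
      fix b assume "b \<in> (SIGMA M:{M. M \<subseteq># K}. {L. L \<subseteq># K - M})"
      then obtain M L where b: "b = (M, L)" and M: "M \<subseteq># K" "L \<subseteq># K - M" by auto
      then show "(case case b of (M, L) \<Rightarrow> (M + L, M) of (N, M) \<Rightarrow> (M, N - M)) = b" by simp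
      have "M + L \<subseteq># K" using M by (metis add.commute subset_mset.le_diff_conv2)
      then show "(case b of (M, L) \<Rightarrow> (M + L, M)) \<in> (SIGMA N:{N. N \<subseteq># K}. {M. M \<subseteq># N})"
        using b by auto
    qed
    also have "\<dots> = (\<Sum>M | M \<subseteq># K. \<Sum>L | L \<subseteq># K - M.
        mon_sign deg M (K - M) * mon_sign deg L (K - M - L) * f M * g L * h (K - M - L))"
      by (subst sum.Sigma) auto
    also have "\<dots> = (f \<star> (g \<star> h)) K"
      using True mons_diff[OF True]
      by (auto simp: pmul_def sum_distrib_left algebra_simps intro!: sum.cong)
    finally show ?thesis .
  qed (simp add: pmul_def)
qed

lemma mul_commute:
  assumes "f \<in> homog k" "g \<in> homog l"
  shows "f \<star> g = ((-1) powi (k * l)) \<cdot> (g \<star> f)"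
proof
  fix K
  show "(f \<star> g) K = (((-1) powi (k * l)) \<cdot> (g \<star> f)) K"
  proof (cases "K \<in> mons")
    case True
    have "(f \<star> g) K = (\<Sum>M | M \<subseteq># K. mon_sign deg M (K - M) * f M * g (K - M))"
      using True by (simp add: pmul_def)
    also have "\<dots> = (\<Sum>N | N \<subseteq># K. (-1) powi (k * l) * (mon_sign deg N (K - N) * g N * f (K - N)))"
    proof (rule sum.reindex_bij_witness[of _ "\<lambda>M. K - M" "\<lambda>M. K - M"])
      fix M assume "M \<in> {M. M \<subseteq># K}"
      then have M: "M \<subseteq># K" by simp
      have dd: "K - (K - M) = M" using M by (simp add: multiset_eq_iff subseteq_mset_def)
      have "mon_sign deg M (K - M) = (-1) powi (mdeg deg M * mdeg deg (K - M)) * mon_sign deg (K - M) M"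
        by (rule mon_sign_commute) (use True M in \<open>auto simp: monomials_def\<close>)
      then show "(-1) powi (k * l) * (mon_sign deg (K - M) (K - (K - M)) * g (K - M) * f (K - (K - M))) =
         mon_sign deg M (K - M) * f M * g (K - M)"
        using homogD(3)[OF assms(1), of M] homogD(3)[OF assms(2), of "K - M"]
        by (cases "f M = 0 \<or> g (K - M) = 0") (auto simp: dd)
    qed (auto simp: multiset_eq_iff subseteq_mset_def)
    also have "\<dots> = (((-1) powi (k * l)) \<cdot> (g \<star> f)) K"
      using True by (simp add: pmul_def sum_distrib_left)
    finally show ?thesis .
  qed (simp add: pmul_def)
qed

end

subsection \<open>The derivation\<close>

locale free_derivation = graded_gens deg G for deg :: "'g::linorder \<Rightarrow> int" and G +
  fixes \<delta> :: "'g \<Rightarrow> 'g multiset \<Rightarrow> rat"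
  assumes delta_homog: "g \<in> G \<Longrightarrow> \<delta> g \<in> homog (deg g - 1)"
begin

definition D :: "('g multiset \<Rightarrow> rat) \<Rightarrow> 'g multiset \<Rightarrow> rat" where
  "D f = (\<lambda>L. \<Sum>K | f K \<noteq> 0. f K * dmono deg G \<delta> K L)"

abbreviation "dm \<equiv> dmono deg G \<delta>"

abbreviation "sg k \<equiv> (-1::rat) powi k"

lemma homog_mul': "f \<in> homog k \<Longrightarrow> g \<in> homog l \<Longrightarrow> k + l = j \<Longrightarrow> f \<star> g \<in> homog j"
  using homog_mul by blast

lemma dm_empty [simp]: "dm {#} = 0"
  by (simp add: dmono_def zero_fun_def)

text \<open>The least generator heads the sorted word, so no Koszul sign arises and
  \<open>dword\<close> unfolds once. All later inductions with \<open>multiset_induct_min\<close>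
  rest on this.\<close>

lemma prepend_minimal:
  assumes "\<forall>x\<in>#K. h \<le> x" "add_mset h K \<in> mons"
  shows "pmono (add_mset h K) = pvar h \<star> pmono K"
    and "dm (add_mset h K) = \<delta> h \<star> pmono K + sg (deg h) \<cdot> (pvar h \<star> dm K)"
proof -
  show "pmono (add_mset h K) = pvar h \<star> pmono K"
    unfolding mul_pmono using assms by (simp add: mon_sign_minimal)
  have "insort h (sorted_list_of_multiset K) = h # sorted_list_of_multiset K"
    using assms(1) by (intro insort_is_Cons) auto
  then show "dm (add_mset h K) = \<delta> h \<star> pmono K + sg (deg h) \<cdot> (pvar h \<star> dm K)"
    unfolding dmono_def sorted_list_of_multiset_insert by (simp add: fun_eq_iff)
qed

lemma dm_homog: "K \<in> mons \<Longrightarrow> dm K \<in> homog (mdeg deg K - 1)"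
proof (induction K rule: multiset_induct_min)
  case (add h K)
  have h: "h \<in> G" and K: "K \<in> mons" using add.prems by (auto simp: mons_add_mset)
  have min: "\<forall>x\<in>#K. h \<le> x" using add.hyps by auto
  have "\<delta> h \<star> pmono K \<in> homog (mdeg deg (add_mset h K) - 1)"
    by (rule homog_mul'[OF delta_homog[OF h] homog_pmono[OF K refl]]) simp
  moreover have "pvar h \<star> dm K \<in> homog (mdeg deg (add_mset h K) - 1)"
    by (rule homog_mul'[OF homog_pvar[OF h] add.IH[OF K]]) simp
  ultimately show ?case
    unfolding prepend_minimal(2)[OF min add.prems] by (intro homog_add homog_scal)
qed simp

lemma D_eq:
  assumes "finite S" "{K. f K \<noteq> 0} \<subseteq> S"
  shows "D f = (\<Sum>K\<in>S. f K \<cdot> dm K)"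
  unfolding D_def fun_eq_iff sum_apply scal_apply
  by (intro allI sum.mono_neutral_left assms) auto

lemma D_zero [simp]: "D 0 = 0"
  by (auto simp: D_def)

lemma D_pmono [simp]: "D (pmono K) = dm K"
proof -
  have "D (pmono K) = (\<Sum>L\<in>{K}. pmono K L \<cdot> dm L)"
    by (rule D_eq) (auto simp: pmono_def)
  then show ?thesis by simp
qed

lemma D_scal: "D (c \<cdot> f) = c \<cdot> D f"
proof (cases "c = 0")
  case False
  then show ?thesis by (auto simp: D_def fun_eq_iff sum_distrib_left mult.assoc)
qed simp

lemma D_add:
  assumes "finite {K. f K \<noteq> 0}" "finite {K. g K \<noteq> 0}"
  shows "D (f + g) = D f + D g"
proof -
  let ?S = "{K. f K \<noteq> 0} \<union> {K. g K \<noteq> 0}"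
  have "D (f + g) = (\<Sum>K\<in>?S. (f + g) K \<cdot> dm K)" by (rule D_eq) (use assms in auto)
  also have "\<dots> = (\<Sum>K\<in>?S. f K \<cdot> dm K) + (\<Sum>K\<in>?S. g K \<cdot> dm K)"
    unfolding plus_fun_apply scal_add sum.distrib ..
  also have "(\<Sum>K\<in>?S. f K \<cdot> dm K) = D f" by (rule D_eq[symmetric]) (use assms in auto)
  also have "(\<Sum>K\<in>?S. g K \<cdot> dm K) = D g" by (rule D_eq[symmetric]) (use assms in auto)
  finally show ?thesis .
qed

lemma D_add_homog: "f \<in> homog k \<Longrightarrow> g \<in> homog l \<Longrightarrow> D (f + g) = D f + D g"
  by (rule D_add) (auto dest: homogD(1))

lemma D_homog: assumes "f \<in> homog k" shows "D f \<in> homog (k - 1)"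
proof -
  have "D f = (\<Sum>K\<in>{K. f K \<noteq> 0}. f K \<cdot> dm K)"
    by (rule D_eq) (use homogD(1)[OF assms] in auto)
  also have "\<dots> \<in> homog (k - 1)"
    using homogD[OF assms] dm_homog by (intro homog_sum homog_scal) auto
  finally show ?thesis .
qed

lemma D_sum:
  "(\<And>x. x \<in> A \<Longrightarrow> F x \<in> homog k) \<Longrightarrow> D (\<Sum>x\<in>A. F x) = (\<Sum>x\<in>A. D (F x))"
proof (induction A rule: infinite_finite_induct)
  case (insert x A)
  then have "D (F x + sum F A) = D (F x) + D (sum F A)"
    by (intro D_add_homog[where k=k and l=k] homog_sum) auto
  moreover have "D (sum F A) = (\<Sum>x\<in>A. D (F x))" using insert by blast
  ultimately show ?case unfolding sum.insert[OF insert(1,2)] by argo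
qed (simp_all only: sum.infinite sum.empty D_zero not_False_eq_True)

lemma pvar_sq: "odd (deg g) \<Longrightarrow> pvar g \<star> pvar g = 0"
  by (auto simp: mul_pmono mons_add_mset)

text \<open>\<open>dword\<close> applies the Leibniz rule in sorted order only; this extends it to a
  generator inserted anywhere. Compare \<open>g\<close> with the least generator \<open>h\<close>:
  if \<open>g\<close> comes first, the definition suffices; a repeated odd \<open>g\<close> makes
  both sides vanish; a later \<open>g\<close> is exchanged with \<open>h\<close>, and the same
  Koszul signs appear on both sides.\<close>

lemma D_pvar_mono:
  assumes g: "g \<in> G" and N: "N \<in> mons"
  shows "D (pvar g \<star> pmono N) = \<delta> g \<star> pmono N + sg (deg g) \<cdot> (pvar g \<star> dm N)"
  using N
proof (induction N rule: multiset_induct_min)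
  case empty
  have "D (pvar g \<star> pmono {#}) = dm {#g#}" using g by (simp add: mul_pmono)
  also have "\<dots> = \<delta> g \<star> pmono {#} + sg (deg g) \<cdot> (pvar g \<star> dm {#})"
    using prepend_minimal(2)[of "{#}" g] g by simp
  finally show ?case .
next
  case (add h W)
  have h: "h \<in> G" and W: "W \<in> mons" and hW: "\<not> (h \<in># W \<and> odd (deg h))"
    using add.prems by (auto simp: mons_add_mset)
  have IH: "D (pvar g \<star> pmono W) = \<delta> g \<star> pmono W + sg (deg g) \<cdot> (pvar g \<star> dm W)"
    by (rule add.IH[OF W])
  have min: "\<forall>x\<in>#W. h \<le> x" using add.hyps by auto
  note pm = prepend_minimal[OF min add.prems]
  note [simp] = mul_add mul_scal scal_add
  consider "g < h \<or> g = h \<and> even (deg g)" | "g = h" "odd (deg g)" | "h < g" by fastforce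
  then show ?case
  proof cases
    case 1
    have *: "\<forall>x\<in>#add_mset h W. g \<le> x" using 1 min by auto
    have "add_mset g (add_mset h W) \<in> mons"
      using 1 g add.prems min by (auto simp: mons_add_mset)
    from prepend_minimal[OF * this] show ?thesis by (metis D_pmono)
  next
    case 2
    have sq: "pvar h \<star> pvar h = 0" by (rule pvar_sq) (use 2 in auto)
    have z: "pvar g \<star> pmono (add_mset h W) = 0"
      unfolding pm 2(1) by (metis mul_assoc mul_zero(1) sq)
    have c: "pvar h \<star> \<delta> h = \<delta> h \<star> pvar h"
      using mul_commute[OF homog_pvar[OF h] delta_homog[OF h]] 2 by simp
    have "\<delta> h \<star> (pvar h \<star> pmono W) = pvar h \<star> (\<delta> h \<star> pmono W)"
      by (metis c mul_assoc)
    moreover have "pvar h \<star> (pvar h \<star> dm W) = 0"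
      by (metis mul_assoc mul_zero(1) sq)
    ultimately have "\<delta> g \<star> pmono (add_mset h W) + sg (deg g) \<cdot> (pvar g \<star> dm (add_mset h W)) = 0"
      unfolding pm 2(1) using 2 by (simp add: fun_eq_iff)
    then show ?thesis using z by (metis D_zero)
  next
    case 3
    have s: "pvar h \<star> pvar g = sg (deg h * deg g) \<cdot> (pvar g \<star> pvar h)"
      by (rule mul_commute) (auto intro: homog_pvar g h)
    have s1: "pvar g \<star> (pvar h \<star> F) = sg (deg h * deg g) \<cdot> (pvar h \<star> (pvar g \<star> F))" for F
      by (simp add: s flip: mul_assoc)
    have s2: "pvar h \<star> (\<delta> g \<star> F) = sg (deg h * (deg g - 1)) \<cdot> (\<delta> g \<star> (pvar h \<star> F))" for F
      using mul_commute[OF homog_pvar[OF h] delta_homog[OF g]] by (simp flip: mul_assoc)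
    have s3: "\<delta> h \<star> (pvar g \<star> F) = sg ((deg h - 1) * deg g) \<cdot> (pvar g \<star> (\<delta> h \<star> F))" for F
      using mul_commute[OF delta_homog[OF h] homog_pvar[OF g]] by (simp flip: mul_assoc)
    \<comment> \<open>After the exchange \<open>h\<close> is least again and stands first, so the
      recursion applies to it. If \<open>g\<close> cannot be added to \<open>W\<close>, the product
      with \<open>g\<close> is zero.\<close>
    have step: "D (pvar h \<star> (pvar g \<star> pmono W)) =
      \<delta> h \<star> (pvar g \<star> pmono W) + sg (deg h) \<cdot> (pvar h \<star> D (pvar g \<star> pmono W))"
    proof (cases "add_mset g W \<in> mons")
      case True
      have *: "\<forall>x\<in>#add_mset g W. h \<le> x" using 3 min by auto
      have **: "add_mset h (add_mset g W) \<in> mons"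
        using 3 True h hW by (auto simp: mons_add_mset)
      have e: "pvar g \<star> pmono W = mon_sign deg {#g#} W \<cdot> pmono (add_mset g W)"
        using True by (simp add: mul_pmono)
      show ?thesis unfolding e
        by (simp add: D_scal prepend_minimal[OF * **, symmetric])
          (simp add: prepend_minimal(2)[OF * **] mult.commute)
    next
      case False
      then have "pvar g \<star> pmono W = 0" by (simp add: mul_pmono)
      then show ?thesis by simp
    qed
    have "D (pvar g \<star> pmono (add_mset h W)) =
      \<delta> g \<star> pmono (add_mset h W) + sg (deg g) \<cdot> (pvar g \<star> dm (add_mset h W))"
      unfolding pm(1) s1 D_scal step IH
      unfolding pm(2)
      by (cases "even (deg g)"; cases "even (deg h)") (simp_all add: s1 s2 s3 add_ac)
    then show ?thesis .
  qed
qed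

lemma D_pvar_mul:
  assumes "g \<in> G" "f \<in> homog k"
  shows "D (pvar g \<star> f) = \<delta> g \<star> f + sg (deg g) \<cdot> (pvar g \<star> D f)"
  using assms(2)
proof (induction f rule: homog_induct)
  case zero
  have "D (pvar g \<star> 0) = \<delta> g \<star> 0 + sg (deg g) \<cdot> (pvar g \<star> D 0)" by simp
  then show ?case .
next
  case (add c K f)
  have "D (pvar g \<star> (c \<cdot> pmono K + f)) = c \<cdot> D (pvar g \<star> pmono K) + D (pvar g \<star> f)"
    unfolding mul_add mul_scal
    using add assms by (subst D_add_homog[of _ "deg g + k" _ "deg g + k"])
      (auto intro!: homog_scal homog_mul homog_pvar homog_pmono simp: D_scal)
  also have "\<dots> = \<delta> g \<star> (c \<cdot> pmono K + f) + sg (deg g) \<cdot> (pvar g \<star> (c \<cdot> dm K + D f))"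
  proof -
    have "D (pvar g \<star> f) = \<delta> g \<star> f + sg (deg g) \<cdot> (pvar g \<star> D f)" by (rule add.IH)
    then show ?thesis using D_pvar_mono[OF assms(1) add(2)]
      by (simp add: mul_add mul_scal scal_add add_ac mult.commute)
  qed
  also have "c \<cdot> dm K + D f = D (c \<cdot> pmono K + f)"
    using add by (subst D_add_homog[of _ k _ k]) (auto intro!: homog_scal homog_pmono simp: D_scal)
  finally show ?case .
qed

lemma D_mono_mono:
  assumes "M \<in> mons" "N \<in> mons"
  shows "D (pmono M \<star> pmono N) = dm M \<star> pmono N + sg (mdeg deg M) \<cdot> (pmono M \<star> dm N)"
  using assms(1)
proof (induction M rule: multiset_induct_min)
  case empty
  have "pmono {#} \<star> dm N = dm N" "pmono {#} \<star> pmono N = pmono N"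
    by (rule mul_unit_left; use homogD(2)[OF dm_homog[OF assms(2)]] assms(2) in auto)+
  then have "D (pmono {#} \<star> pmono N) = dm {#} \<star> pmono N + sg (mdeg deg {#}) \<cdot> (pmono {#} \<star> dm N)"
    by simp
  then show ?case .
next
  case (add h M)
  have h: "h \<in> G" and M: "M \<in> mons" using add.prems by (auto simp: mons_add_mset)
  have min: "\<forall>x\<in>#M. h \<le> x" using add.hyps by auto
  note pm = prepend_minimal[OF min add.prems]
  have "pmono M \<star> pmono N \<in> homog (mdeg deg M + mdeg deg N)"
    using M assms by (intro homog_mul homog_pmono) auto
  note 1 = D_pvar_mul[OF h this]
  have 2: "D (pmono M \<star> pmono N) = dm M \<star> pmono N + sg (mdeg deg M) \<cdot> (pmono M \<star> dm N)"
    by (rule add.IH[OF M])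
  have "D (pmono (add_mset h M) \<star> pmono N) = dm (add_mset h M) \<star> pmono N +
    sg (mdeg deg (add_mset h M)) \<cdot> (pmono (add_mset h M) \<star> dm N)"
    unfolding pm mul_assoc 1 2
    by (simp add: mul_add mul_scal scal_add add_ac mul_assoc power_int_add)
  then show ?case .
qed

lemma D_mul:
  assumes "f \<in> homog k" "g \<in> homog l"
  shows "D (f \<star> g) = D f \<star> g + sg k \<cdot> (f \<star> D g)"
proof -
  have *: "D (pmono M \<star> g) = dm M \<star> g + sg k \<cdot> (pmono M \<star> D g)"
    if M: "M \<in> mons" "mdeg deg M = k" for M
    using assms(2)
  proof (induction g rule: homog_induct)
    case zero
    have "D (pmono M \<star> 0) = dm M \<star> 0 + sg k \<cdot> (pmono M \<star> D 0)" by simp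
    then show ?case .
  next
    case (add c K g)
    have "D (pmono M \<star> (c \<cdot> pmono K + g)) = c \<cdot> D (pmono M \<star> pmono K) + D (pmono M \<star> g)"
      unfolding mul_add mul_scal
      using add M by (subst D_add_homog[of _ "k + l" _ "k + l"])
        (auto intro!: homog_scal homog_mul homog_pmono simp: D_scal)
    also have "\<dots> = dm M \<star> (c \<cdot> pmono K + g) + sg k \<cdot> (pmono M \<star> (c \<cdot> dm K + D g))"
    proof -
      have "D (pmono M \<star> g) = dm M \<star> g + sg k \<cdot> (pmono M \<star> D g)" by (rule add.IH)
      then show ?thesis using D_mono_mono[OF M(1) add(2)] M
        by (simp add: mul_add mul_scal scal_add add_ac mult.commute)
    qed
    also have "c \<cdot> dm K + D g = D (c \<cdot> pmono K + g)"
      using add by (subst D_add_homog[of _ l _ l]) (auto intro!: homog_scal homog_pmono simp: D_scal)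
    finally show ?case .
  qed
  show ?thesis using assms(1)
  proof (induction f rule: homog_induct)
    case zero
    have "D (0 \<star> g) = D 0 \<star> g + sg k \<cdot> (0 \<star> D g)" by simp
    then show ?case .
  next
    case (add c K f)
    have "D ((c \<cdot> pmono K + f) \<star> g) = c \<cdot> D (pmono K \<star> g) + D (f \<star> g)"
      unfolding mul_add mul_scal
      using add assms(2) by (subst D_add_homog[of _ "k + l" _ "k + l"])
        (auto intro!: homog_scal homog_mul homog_pmono simp: D_scal)
    also have "\<dots> = (c \<cdot> dm K + D f) \<star> g + sg k \<cdot> ((c \<cdot> pmono K + f) \<star> D g)"
    proof -
      have "D (f \<star> g) = D f \<star> g + sg k \<cdot> (f \<star> D g)" by (rule add.IH)
      then show ?thesis using *[OF add(2,3)]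
        by (simp add: mul_add mul_scal scal_add add_ac mult.commute)
    qed
    also have "c \<cdot> dm K + D f = D (c \<cdot> pmono K + f)"
      using add by (subst D_add_homog[of _ k _ k]) (auto intro!: homog_scal homog_pmono simp: D_scal)
    finally show ?case .
  qed
qed

text \<open>The mixed terms of the two Leibniz expansions are both \<open>\<delta> h\<close> times
  \<open>dm K\<close>, with signs \<open>sg (deg h - 1)\<close> and \<open>sg (deg h)\<close>, and
  cancel. So generators decide.\<close>

lemma D_D:
  assumes dd: "\<And>g. g \<in> G \<Longrightarrow> D (\<delta> g) = 0" and "f \<in> homog k"
  shows "D (D f) = 0"
proof -
  have *: "D (dm K) = 0" if "K \<in> mons" for K
    using that
  proof (induction K rule: multiset_induct_min)
    case (add h K)
    have h: "h \<in> G" and K: "K \<in> mons" using add.prems by (auto simp: mons_add_mset)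
    have min: "\<forall>x\<in>#K. h \<le> x" using add.hyps by auto
    have 1: "D (\<delta> h \<star> pmono K) = sg (deg h - 1) \<cdot> (\<delta> h \<star> dm K)"
      by (simp add: D_mul[OF delta_homog[OF h] homog_pmono[OF K refl]] dd[OF h])
    have IH: "D (dm K) = 0" by (rule add.IH[OF K])
    have 2: "D (pvar h \<star> dm K) = \<delta> h \<star> dm K"
      by (simp add: D_pvar_mul[OF h dm_homog[OF K]] IH)
    have "D (dm (add_mset h K)) = D (\<delta> h \<star> pmono K) + sg (deg h) \<cdot> D (pvar h \<star> dm K)"
      unfolding prepend_minimal(2)[OF min add.prems] D_scal[symmetric]
      by (rule D_add_homog[OF homog_mul[OF delta_homog[OF h] homog_pmono[OF K refl]]
            homog_scal[OF homog_mul[OF homog_pvar[OF h] dm_homog[OF K]]]])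
    also have "\<dots> = 0" unfolding 1 2 by (cases "even (deg h)") (auto simp: fun_eq_iff)
    finally show ?case .
  qed simp
  show ?thesis using assms(2)
  proof (induction f rule: homog_induct)
    case zero
    have "D (D 0) = 0" by simp
    then show ?case .
  next
    case (add c K f)
    have "D (D (c \<cdot> pmono K + f)) = D (c \<cdot> dm K + D f)"
      using add by (subst D_add_homog[of _ k _ k]) (auto intro!: homog_scal homog_pmono simp: D_scal)
    also have "\<dots> = c \<cdot> D (dm K) + D (D f)"
      using add dm_homog[OF add(2)]
      by (subst D_add_homog[of _ "k - 1" _ "k - 1"]) (auto intro!: homog_scal D_homog simp: D_scal)
    also have "D (dm K) = 0" by (rule *[OF add(2)])
    also have "D (D f) = 0" by (rule add.IH)
    finally show ?case by simp
  qed
qed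

end

subsection \<open>The differential of \<open>B\<^sub>m\<close>\<close>

text \<open>The product \<open>x_q x_p\<close> does not depend on \<open>i\<close>, so the sum over
  \<open>i\<close> in the defining formula collapses to this number.\<close>

definition coeffB :: "int \<Rightarrow> nat \<Rightarrow> nat \<Rightarrow> rat" where
  "coeffB m p q =
    (\<Sum>i = 1..p. (-1) powi ((int q - 1) * int i + (int p + m * (int i - 1)) * (int q + 1) * m))"

lemma sum_alternating: "(\<Sum>i = 1..p::nat. if even i then 1 else -1) = (if even p then 0 else -1 :: rat)"
  by (induction p) auto

text \<open>The second summand of the exponent contains the factor \<open>m\<close>, so only
  \<open>(q - 1) * i\<close> matters: the signs are constant for odd \<open>q\<close> and alternate
  for even \<open>q\<close>.\<close>

lemma coeffB_even:
  assumes "even m"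
  shows "coeffB m p q = (if odd q then of_nat p else if odd p then -1 else 0)"
proof (cases "odd q")
  case True
  then have "coeffB m p q = (\<Sum>i = 1..p. 1)"
    unfolding coeffB_def using assms by (intro sum.cong refl) simp
  then show ?thesis using True by simp
next
  case False
  then have "coeffB m p q = (\<Sum>i = 1..p. if even i then 1 else -1)"
    unfolding coeffB_def using assms by (intro sum.cong refl) simp
  then show ?thesis unfolding sum_alternating using False by simp
qed

text \<open>Modulo 2 the exponent is \<open>(q + 1) * (p - 1)\<close>, since \<open>i\<close> enters
  twice and cancels; hence all \<open>p\<close> summands are equal.\<close>

lemma coeffB_odd:
  assumes "odd m"
  shows "coeffB m p q = (if even p \<and> even q then - of_nat p else of_nat p)"
proof -
  have "coeffB m p q = (\<Sum>i = 1..p. if even p \<and> even q then -1 else 1)"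
    unfolding coeffB_def
  proof (intro sum.cong refl)
    fix i
    show "(-1) powi ((int q - 1) * int i + (int p + m * (int i - 1)) * (int q + 1) * m) =
      (if even p \<and> even q then -1 else 1 :: rat)"
      using assms by (cases "even p"; cases "even q"; cases "even i") simp_all
  qed
  then show ?thesis by simp
qed

interpretation B: graded_gens "degB m" "{2..}" for m .

lemma dB_eq:
  "dB m n = (\<Sum>q\<in>{2..<n}. coeffB m (n + 1 - q) q \<cdot> pmul (degB m) {2..} (pvar q) (pvar (n + 1 - q)))"
proof
  fix K
  let ?F = "\<lambda>p q i. (-1) powi ((int q - 1) * int i + (int p + m * (int i - 1)) * (int q + 1) * m)
       * pmul (degB m) {2..} (pvar q) (pvar p) K"
  have "dB m n K = (\<Sum>(q, i)\<in>(SIGMA q:{2..<n}. {1..n + 1 - q}). ?F (n + 1 - q) q i)"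
    unfolding dB_def
    by (rule sum.reindex_bij_witness[of _ "\<lambda>(q, i). (n + 1 - q, q, i)" "\<lambda>(p, q, i). (q, i)"]) auto
  also have "\<dots> = (\<Sum>q\<in>{2..<n}. \<Sum>i = 1..n + 1 - q. ?F (n + 1 - q) q i)"
    by (rule sum.Sigma[symmetric]) auto
  also have "\<dots> = (\<Sum>q\<in>{2..<n}. coeffB m (n + 1 - q) q * pmul (degB m) {2..} (pvar q) (pvar (n + 1 - q)) K)"
    unfolding coeffB_def sum_distrib_right ..
  finally show "dB m n K = (\<Sum>q\<in>{2..<n}. coeffB m (n + 1 - q) q \<cdot> pmul (degB m) {2..} (pvar q) (pvar (n + 1 - q))) K"
    unfolding sum_apply scal_apply .
qed

lemma degB_add: "2 \<le> n \<Longrightarrow> q \<in> {2..<n} \<Longrightarrow> degB m q + degB m (n + 1 - q) = degB m n - 1"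
  by (auto simp: degB_def of_nat_diff algebra_simps)

lemma dB_homog: "n \<in> {2..} \<Longrightarrow> dB m n \<in> B.homog m (degB m n - 1)"
  unfolding dB_eq
proof (intro B.homog_sum B.homog_scal)
  fix q assume n: "n \<in> {2..}" and q: "q \<in> {2..<n}"
  then have "pmul (degB m) {2..} (pvar q) (pvar (n + 1 - q)) \<in> B.homog m (degB m q + degB m (n + 1 - q))"
    by (intro B.homog_mul B.homog_pvar) auto
  then show "pmul (degB m) {2..} (pvar q) (pvar (n + 1 - q)) \<in> B.homog m (degB m n - 1)"
    using degB_add q n by auto
qed

text \<open>The strict bounds make initial segments of generators closed under the differential
  (\<open>free_derivation_B\<close>) and allow recursion on the index; the size 2 gives minimality
  (\<open>dmB_size\<close>).\<close>

lemma dB_supp: assumes "dB m n K \<noteq> 0" shows "\<exists>p q. K = {#p, q#} \<and> p \<in> {2..<n} \<and> q \<in> {2..<n}"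
proof -
  obtain q where q: "q \<in> {2..<n}" "pmul (degB m) {2..} (pvar q) (pvar (n + 1 - q)) K \<noteq> 0"
    using assms unfolding dB_eq sum_apply scal_apply
    by (metis (no_types, lifting) mult_zero_right sum.not_neutral_contains_not_neutral)
  then have "K = {#q, n + 1 - q#}"
    unfolding B.mul_pmono by (auto split: if_splits)
  then show ?thesis using q(1) by (intro exI[of _ q] exI[of _ "n + 1 - q"]) auto
qed

interpretation B: free_derivation "degB m" "{2..}" "dB m" for m
  by unfold_locales (rule dB_homog)

text \<open>
  The coefficient of \<open>x\<^sub>a x\<^sub>b x\<^sub>c\<close> in \<open>d\<^sup>2x\<^sub>n\<close> before sorting.  Exchanging \<open>a\<close> and \<open>b\<close> changes it by
  minus the Koszul sign, which makes \<open>d\<^sup>2x\<^sub>n\<close> equal to its own negative.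
\<close>

definition coeffBB :: "int \<Rightarrow> nat \<Rightarrow> nat \<Rightarrow> nat \<Rightarrow> rat" where
  "coeffBB m a b c = coeffB m c (a + b - 1) * coeffB m b a +
     (-1) powi (degB m a) * coeffB m (b + c - 1) a * coeffB m c b"

lemma coeffBB_swap:
  assumes "2 \<le> a" "2 \<le> b" "2 \<le> c"
  shows "coeffBB m b a c * (-1) powi (degB m a * degB m b) = - coeffBB m a b c"
\<comment> \<open>Up to a factor \<open>p\<close>, \<open>coeffB\<close> depends on parities only,
  and so does the Koszul sign. Fixing the parities of \<open>a\<close>, \<open>b\<close>,
  \<open>c\<close> leaves a polynomial identity in them.\<close>
proof (cases "even m")
  case True
  have e: "even (degB m n) \<longleftrightarrow> even n" for n using True by (simp add: degB_def)
  show ?thesis using assms True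
    by (cases "even a"; cases "even b"; cases "even c")
      (simp_all add: coeffBB_def coeffB_even e of_nat_diff algebra_simps)
next
  case False
  have e: "odd (degB m n)" for n using False by (simp add: degB_def)
  show ?thesis using assms False
    by (cases "even a"; cases "even b"; cases "even c")
      (simp_all add: coeffBB_def coeffB_odd e of_nat_diff algebra_simps)
qed

lemma D_dB: assumes n: "n \<in> {2..}" shows "B.D m (dB m n) = 0"
proof -
  let ?x = "\<lambda>a. pvar a :: nat multiset \<Rightarrow> rat"
  let ?mul = "pmul (degB m) {2..}"
  let ?X = "\<lambda>a b c. ?mul (?x a) (?mul (?x b) (?x c))"
  \<comment> \<open>The index relation \<open>p + q - 1 = n\<close> is applied twice:
    \<open>a + b - 1 = q\<close> and \<open>q + c - 1 = n\<close> give \<open>n + 2\<close>.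
    \<open>?S1\<close> collects the terms in which the first factor is differentiated,
    \<open>?S2\<close> those of the second.\<close>
  define T where "T = {(a, b, c). 2 \<le> a \<and> 2 \<le> b \<and> 2 \<le> c \<and> a + b + c = n + 2}"
  let ?S1 = "\<Sum>q\<in>{2..<n}. \<Sum>a\<in>{2..<q}. (coeffB m (n + 1 - q) q * coeffB m (q + 1 - a) a) \<cdot> ?X a (q + 1 - a) (n + 1 - q)"
  let ?S2 = "\<Sum>q\<in>{2..<n}. \<Sum>b\<in>{2..<n + 1 - q}. ((-1) powi (degB m q) * coeffB m (n + 1 - q) q * coeffB m (n + 2 - q - b) b) \<cdot> ?X q b (n + 2 - q - b)"
  have finT: "finite T"
    by (rule finite_subset[of _ "{..n+2} \<times> {..n+2} \<times> {..n+2}"]) (auto simp: T_def)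
  have "B.D m (dB m n) = (\<Sum>q\<in>{2..<n}. B.D m (coeffB m (n + 1 - q) q \<cdot> ?mul (?x q) (?x (n + 1 - q))))"
    unfolding dB_eq[of m n] using n
    by (intro B.D_sum[where k="degB m n - 1"] B.homog_scal B.homog_mul'[OF B.homog_pvar B.homog_pvar])
      (use degB_add[of n _ m] in auto)
  also have "\<dots> = (\<Sum>q\<in>{2..<n}. coeffB m (n + 1 - q) q \<cdot> (?mul (dB m q) (?x (n + 1 - q)) +
      (-1) powi (degB m q) \<cdot> ?mul (?x q) (dB m (n + 1 - q))))"
  proof (intro sum.cong refl)
    fix q assume q: "q \<in> {2..<n}"
    have "B.D m (?x a) = dB m a" if "a \<ge> 2" for a
    proof -
      have "?mul (pvar a) (pmono {#}) = ?x a" "?mul (dB m a) (pmono {#}) = dB m a"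
        using that B.mul_unit_left[of "dB m a" m] B.mul_commute[OF B.homog_pmono[OF B.mons_empty, of m 0] dB_homog[of a m]]
          B.homogD(2)[OF dB_homog[of a m]]
        by (auto simp: B.mul_pmono)
      then show ?thesis using B.prepend_minimal(2)[of "{#}" a m] that by simp
    qed
    then show "B.D m (coeffB m (n + 1 - q) q \<cdot> ?mul (?x q) (?x (n + 1 - q))) =
      coeffB m (n + 1 - q) q \<cdot> (?mul (dB m q) (?x (n + 1 - q)) +
      (-1) powi (degB m q) \<cdot> ?mul (?x q) (dB m (n + 1 - q)))"
      using q unfolding B.D_scal
      by (subst B.D_mul[OF B.homog_pvar B.homog_pvar]) auto
  qed
  also have "\<dots> = ?S1 + ?S2"
    unfolding sum.distrib[symmetric]
  proof (intro sum.cong refl)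
    fix q assume q: "q \<in> {2..<n}"
    have e: "n + 1 - q + 1 - b = n + 2 - q - b" for b using q by simp
    show "coeffB m (n + 1 - q) q \<cdot> (?mul (dB m q) (?x (n + 1 - q)) +
      (-1) powi (degB m q) \<cdot> ?mul (?x q) (dB m (n + 1 - q))) =
      (\<Sum>a\<in>{2..<q}. (coeffB m (n + 1 - q) q * coeffB m (q + 1 - a) a) \<cdot> ?X a (q + 1 - a) (n + 1 - q)) +
      (\<Sum>b\<in>{2..<n + 1 - q}. ((-1) powi (degB m q) * coeffB m (n + 1 - q) q * coeffB m (n + 2 - q - b) b) \<cdot> ?X q b (n + 2 - q - b))"
      unfolding dB_eq[of m q] dB_eq[of m "n + 1 - q"] B.mul_sum_left B.mul_sum_right B.mul_scal
        scal_add scal_sum scal_simps e B.mul_assoc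
      by (simp only: mult.assoc mult.left_commute)
  qed
  also have "?S1 = (\<Sum>(a, b, c)\<in>T. (coeffB m c (a + b - 1) * coeffB m b a) \<cdot> ?X a b c)"
    unfolding T_def
    by (subst sum.Sigma, simp, simp)
      (rule sum.reindex_bij_witness[of _ "\<lambda>(a, b, c). (a + b - 1, a)" "\<lambda>(q, a). (a, q + 1 - a, n + 1 - q)"];
        auto)
  also have "?S2 = (\<Sum>(a, b, c)\<in>T. ((-1) powi (degB m a) * coeffB m (b + c - 1) a * coeffB m c b) \<cdot> ?X a b c)"
    unfolding T_def
    by (subst sum.Sigma, simp, simp)
      (rule sum.reindex_bij_witness[of _ "\<lambda>(a, b, c). (a, b)" "\<lambda>(q, b). (q, b, n + 2 - q - b)"];
        auto simp: Suc_diff_le)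
  finally have 1: "B.D m (dB m n) = (\<Sum>(a, b, c)\<in>T. coeffBB m a b c \<cdot> ?X a b c)"
    by (simp only: case_prod_unfold coeffBB_def scal_add sum.distrib)
  also have "\<dots> = (\<Sum>(a, b, c)\<in>T. coeffBB m b a c \<cdot> ?X b a c)"
    by (rule sum.reindex_bij_witness[of _ "\<lambda>(a, b, c). (b, a, c)" "\<lambda>(a, b, c). (b, a, c)"])
      (auto simp: T_def)
  also have "\<dots> = (\<Sum>(a, b, c)\<in>T. (-1) \<cdot> (coeffBB m a b c \<cdot> ?X a b c))"
  proof (intro sum.cong refl, clarify)
    fix a b c assume "(a, b, c) \<in> T"
    then have abc: "2 \<le> a" "2 \<le> b" "2 \<le> c" by (auto simp: T_def)
    have "?X b a c = (-1) powi (degB m a * degB m b) \<cdot> ?X a b c"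
      using B.mul_commute[OF B.homog_pvar[of b m] B.homog_pvar[of a m]] abc
      by (simp add: B.mul_scal mult.commute flip: B.mul_assoc)
    then have "coeffBB m b a c \<cdot> ?X b a c = (coeffBB m b a c * (-1) powi (degB m a * degB m b)) \<cdot> ?X a b c"
      by simp
    then show "coeffBB m b a c \<cdot> ?X b a c = (-1) \<cdot> (coeffBB m a b c \<cdot> ?X a b c)"
      unfolding coeffBB_swap[OF abc] by simp
  qed
  also have "\<dots> = (-1) \<cdot> B.D m (dB m n)"
    unfolding 1 scal_sum by (simp add: case_prod_unfold)
  finally show ?thesis by (simp add: fun_eq_iff)
qed

subsection \<open>CDGAs and their homomorphisms\<close>

lemma RAT_simps [simp]:
  "carrier RAT = UNIV" "x \<oplus>\<^bsub>RAT\<^esub> y = x + y" "x \<otimes>\<^bsub>RAT\<^esub> y = x * y" "\<one>\<^bsub>RAT\<^esub> = 1" "\<zero>\<^bsub>RAT\<^esub> = 0"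
  by (simp_all add: RAT_def)

lemma cring_RAT: "cring RAT"
proof (rule cringI)
  show "abelian_group RAT"
  proof (rule abelian_groupI)
    fix x assume "x \<in> carrier RAT"
    show "\<exists>y\<in>carrier RAT. y \<oplus>\<^bsub>RAT\<^esub> x = \<zero>\<^bsub>RAT\<^esub>" by (rule bexI[of _ "-x"]) auto
  qed auto
  show "comm_monoid RAT" by (rule comm_monoidI) auto
qed (auto simp: algebra_simps)

lemma RAT_moduleI:
  assumes "\<And>x y. x \<in> carrier M \<Longrightarrow> y \<in> carrier M \<Longrightarrow> x \<oplus>\<^bsub>M\<^esub> y \<in> carrier M"
    and "\<zero>\<^bsub>M\<^esub> \<in> carrier M"
    and "\<And>c x. x \<in> carrier M \<Longrightarrow> c \<odot>\<^bsub>M\<^esub> x \<in> carrier M"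
    and "\<And>x y z. x \<in> carrier M \<Longrightarrow> y \<in> carrier M \<Longrightarrow> z \<in> carrier M \<Longrightarrow>
      x \<oplus>\<^bsub>M\<^esub> y \<oplus>\<^bsub>M\<^esub> z = x \<oplus>\<^bsub>M\<^esub> (y \<oplus>\<^bsub>M\<^esub> z)"
    and "\<And>x y. x \<in> carrier M \<Longrightarrow> y \<in> carrier M \<Longrightarrow> x \<oplus>\<^bsub>M\<^esub> y = y \<oplus>\<^bsub>M\<^esub> x"
    and "\<And>x. x \<in> carrier M \<Longrightarrow> \<zero>\<^bsub>M\<^esub> \<oplus>\<^bsub>M\<^esub> x = x"
    and "\<And>x. x \<in> carrier M \<Longrightarrow> ((-1) \<odot>\<^bsub>M\<^esub> x) \<oplus>\<^bsub>M\<^esub> x = \<zero>\<^bsub>M\<^esub>"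
    and "\<And>c d x. x \<in> carrier M \<Longrightarrow> (c + d) \<odot>\<^bsub>M\<^esub> x = c \<odot>\<^bsub>M\<^esub> x \<oplus>\<^bsub>M\<^esub> d \<odot>\<^bsub>M\<^esub> x"
    and "\<And>c x y. x \<in> carrier M \<Longrightarrow> y \<in> carrier M \<Longrightarrow> c \<odot>\<^bsub>M\<^esub> (x \<oplus>\<^bsub>M\<^esub> y) = c \<odot>\<^bsub>M\<^esub> x \<oplus>\<^bsub>M\<^esub> c \<odot>\<^bsub>M\<^esub> y"
    and "\<And>c d x. x \<in> carrier M \<Longrightarrow> (c * d) \<odot>\<^bsub>M\<^esub> x = c \<odot>\<^bsub>M\<^esub> (d \<odot>\<^bsub>M\<^esub> x)"
    and "\<And>x. x \<in> carrier M \<Longrightarrow> 1 \<odot>\<^bsub>M\<^esub> x = x"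
  shows "Module.module RAT M"
proof (rule moduleI[OF cring_RAT])
  show "abelian_group M"
  proof (rule abelian_groupI)
    fix x assume "x \<in> carrier M"
    then show "\<exists>y\<in>carrier M. y \<oplus>\<^bsub>M\<^esub> x = \<zero>\<^bsub>M\<^esub>" using assms(3,7) by blast
  qed (use assms in auto)
qed (use assms in auto)

locale cdga =
  fixes A :: "'a cdga"
  assumes A: "is_cdga A"
begin

lemma mod: "Module.module RAT (grade A k)"
  using A by (simp add: is_cdga_def)

sublocale M: Module.module RAT "grade A k" for k
  by (rule mod)

lemma smult_closed [simp]: "x \<in> elts A k \<Longrightarrow> c \<odot>\<^bsub>grade A k\<^esub> x \<in> elts A k"
  using M.smult_closed by simp

lemma smult_add: "x \<in> elts A k \<Longrightarrow> (c + d) \<odot>\<^bsub>grade A k\<^esub> x = c \<odot>\<^bsub>grade A k\<^esub> x \<oplus>\<^bsub>grade A k\<^esub> d \<odot>\<^bsub>grade A k\<^esub> x"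
  using M.smult_l_distr[of c d x k] by simp

lemma smult_smult: "x \<in> elts A k \<Longrightarrow> c \<odot>\<^bsub>grade A k\<^esub> (d \<odot>\<^bsub>grade A k\<^esub> x) = (c * d) \<odot>\<^bsub>grade A k\<^esub> x"
  using M.smult_assoc1[of c d x k] by simp

lemma smult_plus: "x \<in> elts A k \<Longrightarrow> y \<in> elts A k \<Longrightarrow>
  c \<odot>\<^bsub>grade A k\<^esub> (x \<oplus>\<^bsub>grade A k\<^esub> y) = c \<odot>\<^bsub>grade A k\<^esub> x \<oplus>\<^bsub>grade A k\<^esub> c \<odot>\<^bsub>grade A k\<^esub> y"
  using M.smult_r_distr[of c x k y] by simp

lemma smult_one [simp]: "x \<in> elts A k \<Longrightarrow> 1 \<odot>\<^bsub>grade A k\<^esub> x = x"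
  using M.smult_one[of x k] by simp

lemma smult_0 [simp]: "x \<in> elts A k \<Longrightarrow> 0 \<odot>\<^bsub>grade A k\<^esub> x = \<zero>\<^bsub>grade A k\<^esub>"
  using M.smult_l_null[of x k] by simp

lemma smult_zero [simp]: "c \<odot>\<^bsub>grade A k\<^esub> \<zero>\<^bsub>grade A k\<^esub> = \<zero>\<^bsub>grade A k\<^esub>"
  using M.smult_r_null[of c k] by simp

lemma uminus_smult: "x \<in> elts A k \<Longrightarrow> (-1) \<odot>\<^bsub>grade A k\<^esub> x = \<ominus>\<^bsub>grade A k\<^esub> x"
  using smult_add[of x k "-1" 1] by (simp add: M.minus_equality)

lemma unit_closed [simp]: "cunit A \<in> elts A 0"
  using A by (simp add: is_cdga_def)

lemma mult_linear_right: "x \<in> elts A k \<Longrightarrow> linear_between (grade A l) (grade A (k + l)) (\<lambda>y. cmult A k l x y)"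
  using A by (simp add: is_cdga_def)

lemma mult_linear_left: "y \<in> elts A l \<Longrightarrow> linear_between (grade A k) (grade A (k + l)) (\<lambda>x. cmult A k l x y)"
  using A by (simp add: is_cdga_def)

lemma mult_closed [simp]: "x \<in> elts A k \<Longrightarrow> y \<in> elts A l \<Longrightarrow> cmult A k l x y \<in> elts A (k + l)"
  using mult_linear_right[of x k l] by (auto simp: linear_between_def Pi_iff)

lemma diff_linear: "linear_between (grade A k) (grade A (k - 1)) (cdiff A k)"
  using A by (simp add: is_cdga_def)

lemma diff_closed [simp]: "x \<in> elts A k \<Longrightarrow> cdiff A k x \<in> elts A (k - 1)"
  using diff_linear[of k] by (auto simp: linear_between_def Pi_iff)

lemma diff_plus: "x \<in> elts A k \<Longrightarrow> y \<in> elts A k \<Longrightarrow>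
  cdiff A k (x \<oplus>\<^bsub>grade A k\<^esub> y) = cdiff A k x \<oplus>\<^bsub>grade A (k - 1)\<^esub> cdiff A k y"
  using diff_linear[of k] by (auto simp: linear_between_def Pi_iff)

lemma diff_diff: "x \<in> elts A k \<Longrightarrow> cdiff A (k - 1) (cdiff A k x) = \<zero>\<^bsub>grade A (k - 2)\<^esub>"
  using A unfolding is_cdga_def by blast

lemma unit_left: "x \<in> elts A k \<Longrightarrow> cmult A 0 k (cunit A) x = x"
  using A unfolding is_cdga_def by blast

lemma mult_assoc: "x \<in> elts A j \<Longrightarrow> y \<in> elts A k \<Longrightarrow> z \<in> elts A l \<Longrightarrow>
  cmult A (j + k) l (cmult A j k x y) z = cmult A j (k + l) x (cmult A k l y z)"
  using A unfolding is_cdga_def by blast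

lemma mult_commute: "x \<in> elts A k \<Longrightarrow> y \<in> elts A l \<Longrightarrow>
  cmult A k l x y = ((-1) powi (k * l)) \<odot>\<^bsub>grade A (k + l)\<^esub> cmult A l k y x"
  using A unfolding is_cdga_def by blast

lemma leibniz: "x \<in> elts A k \<Longrightarrow> y \<in> elts A l \<Longrightarrow>
  cdiff A (k + l) (cmult A k l x y) =
          cmult A (k - 1) l (cdiff A k x) y \<oplus>\<^bsub>grade A (k + l - 1)\<^esub>
          ((-1) powi k) \<odot>\<^bsub>grade A (k + l - 1)\<^esub> cmult A k (l - 1) x (cdiff A l y)"
  using A unfolding is_cdga_def by blast

end

section \<open>Linear maps and morphisms of CDGAs\<close>

lemma linear_between_zero:
  assumes "linear_between M N f" "Module.module RAT M" "Module.module RAT N"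
  shows "f \<zero>\<^bsub>M\<^esub> = \<zero>\<^bsub>N\<^esub>"
proof -
  interpret M: Module.module RAT M by fact
  interpret N: Module.module RAT N by fact
  have "f \<zero>\<^bsub>M\<^esub> = f (0 \<odot>\<^bsub>M\<^esub> \<zero>\<^bsub>M\<^esub>)" using M.smult_l_null[of "\<zero>\<^bsub>M\<^esub>"] by simp
  also have "\<dots> = 0 \<odot>\<^bsub>N\<^esub> f \<zero>\<^bsub>M\<^esub>" using assms(1) M.zero_closed unfolding linear_between_def by blast
  also have "\<dots> = \<zero>\<^bsub>N\<^esub>"
    using N.smult_l_null[of "f \<zero>\<^bsub>M\<^esub>"] assms(1) by (auto simp: linear_between_def Pi_iff)
  finally show ?thesis .
qed

lemma linear_between_finsum:
  assumes f: "linear_between M N f" and "Module.module RAT M" "Module.module RAT N"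
    and "finite S" "\<And>x. x \<in> S \<Longrightarrow> u x \<in> carrier M"
  shows "f (\<Oplus>\<^bsub>M\<^esub>x\<in>S. u x) = (\<Oplus>\<^bsub>N\<^esub>x\<in>S. f (u x))"
proof -
  interpret M: Module.module RAT M by fact
  interpret N: Module.module RAT N by fact
  show ?thesis using assms(4,5)
  proof (induction S rule: finite_induct)
    case empty
    then show ?case using linear_between_zero[OF assms(1-3)] by simp
  next
    case (insert x S)
    have "f (u x \<oplus>\<^bsub>M\<^esub> (\<Oplus>\<^bsub>M\<^esub>x\<in>S. u x)) = f (u x) \<oplus>\<^bsub>N\<^esub> f (\<Oplus>\<^bsub>M\<^esub>x\<in>S. u x)"
      using f insert by (auto simp: linear_between_def intro!: M.finsum_closed)
    moreover have "f \<in> carrier M \<rightarrow> carrier N" using f by (auto simp: linear_between_def)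
    ultimately show ?case
      using insert by (subst M.finsum_insert N.finsum_insert, auto)+
  qed
qed

lemma cdga_homD:
  assumes "f \<in> cdga_hom A B"
  shows "f k \<in> extensional (elts A k)" "linear_between (grade A k) (grade B k) (f k)"
    "x \<in> elts A k \<Longrightarrow> f k x \<in> elts B k"
    "x \<in> elts A k \<Longrightarrow> y \<in> elts A k \<Longrightarrow> f k (x \<oplus>\<^bsub>grade A k\<^esub> y) = f k x \<oplus>\<^bsub>grade B k\<^esub> f k y"
    "x \<in> elts A k \<Longrightarrow> f k (c \<odot>\<^bsub>grade A k\<^esub> x) = c \<odot>\<^bsub>grade B k\<^esub> f k x"
    "f 0 (cunit A) = cunit B"
    "x \<in> elts A k \<Longrightarrow> y \<in> elts A l \<Longrightarrow> f (k + l) (cmult A k l x y) = cmult B k l (f k x) (f l y)"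
    "x \<in> elts A k \<Longrightarrow> f (k - 1) (cdiff A k x) = cdiff B k (f k x)"
  using assms by (auto simp: cdga_hom_def linear_between_def)

lemma cdga_hom_zero: "is_cdga A \<Longrightarrow> is_cdga B \<Longrightarrow> f \<in> cdga_hom A B \<Longrightarrow> f k \<zero>\<^bsub>grade A k\<^esub> = \<zero>\<^bsub>grade B k\<^esub>"
  by (rule linear_between_zero[OF cdga_homD(2)]) (auto simp: is_cdga_def)

definition hom_comp :: "'a cdga \<Rightarrow> (int \<Rightarrow> 'b \<Rightarrow> 'c) \<Rightarrow> (int \<Rightarrow> 'a \<Rightarrow> 'b) \<Rightarrow> int \<Rightarrow> 'a \<Rightarrow> 'c" where
  "hom_comp A g f = (\<lambda>k. restrict (\<lambda>x. g k (f k x)) (elts A k))"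

lemma hom_comp_apply [simp]: "x \<in> elts A k \<Longrightarrow> hom_comp A g f k x = g k (f k x)"
  by (simp add: hom_comp_def)

lemma cdga_hom_comp:
  assumes "is_cdga A" "f \<in> cdga_hom A B" "g \<in> cdga_hom B C"
  shows "hom_comp A g f \<in> cdga_hom A C"
proof -
  interpret cdga A by unfold_locales fact
  note f = cdga_homD[OF assms(2)] and g = cdga_homD[OF assms(3)]
  show ?thesis unfolding cdga_hom_def linear_between_def
    by (auto simp: hom_comp_def f(3-8) g(3-8))
qed

text \<open>A surjective image of a CDGA satisfies all the axioms, as these are universal equations.\<close>

lemma is_cdga_surj:
  fixes \<phi> :: "int \<Rightarrow> 'a \<Rightarrow> 'b"
  assumes A: "is_cdga A"
    and surj: "\<And>k. elts C k = \<phi> k ` elts A k"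
    and zero: "\<And>k. \<zero>\<^bsub>grade C k\<^esub> = \<phi> k \<zero>\<^bsub>grade A k\<^esub>"
    and add: "\<And>k x y. x \<in> elts A k \<Longrightarrow> y \<in> elts A k \<Longrightarrow> \<phi> k x \<oplus>\<^bsub>grade C k\<^esub> \<phi> k y = \<phi> k (x \<oplus>\<^bsub>grade A k\<^esub> y)"
    and smult: "\<And>k c x. x \<in> elts A k \<Longrightarrow> c \<odot>\<^bsub>grade C k\<^esub> \<phi> k x = \<phi> k (c \<odot>\<^bsub>grade A k\<^esub> x)"
    and unit: "cunit C = \<phi> 0 (cunit A)"
    and mult: "\<And>k l x y. x \<in> elts A k \<Longrightarrow> y \<in> elts A l \<Longrightarrow> cmult C k l (\<phi> k x) (\<phi> l y) = \<phi> (k + l) (cmult A k l x y)"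
    and diff: "\<And>k x. x \<in> elts A k \<Longrightarrow> cdiff C k (\<phi> k x) = \<phi> (k - 1) (cdiff A k x)"
  shows "is_cdga C"
proof -
  interpret cdga A by unfold_locales fact
  have c0: "Module.module RAT (grade C k)" for k
    by (rule RAT_moduleI)
      (auto simp: surj zero add smult M.a_ac smult_add smult_plus smult_smult uminus_smult M.l_neg M.r_neg
        M.add.m_closed)
  have c1: "cmult C (j + k) l (cmult C j k x y) z = cmult C j (k + l) x (cmult C k l y z)"
    if xyz: "x \<in> elts C j" "y \<in> elts C k" "z \<in> elts C l" for j k l x y z
  proof -
    obtain a b c where abc: "a \<in> elts A j" "b \<in> elts A k" "c \<in> elts A l" "x = \<phi> j a" "y = \<phi> k b" "z = \<phi> l c"
      using xyz unfolding surj by auto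
    then show ?thesis
      using mult[of "cmult A j k a b" "j + k" c l] mult[of a j "cmult A k l b c" "k + l"]
      by (simp add: mult mult_assoc add.assoc)
  qed
  have c2: "cdiff C (k - 1) (cdiff C k x) = \<zero>\<^bsub>grade C (k - 2)\<^esub>" if x: "x \<in> elts C k" for k x
  proof -
    obtain a where a: "a \<in> elts A k" "x = \<phi> k a" using x unfolding surj by auto
    then show ?thesis using diff[of "cdiff A k a" "k - 1"] by (simp add: diff zero diff_diff)
  qed
  have c3: "cdiff C (k + l) (cmult C k l x y) =
          cmult C (k - 1) l (cdiff C k x) y \<oplus>\<^bsub>grade C (k + l - 1)\<^esub>
          ((-1) powi k) \<odot>\<^bsub>grade C (k + l - 1)\<^esub> cmult C k (l - 1) x (cdiff C l y)"
    if xy: "x \<in> elts C k" "y \<in> elts C l" for k l x y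
  proof -
    obtain a b where ab: "a \<in> elts A k" "b \<in> elts A l" "x = \<phi> k a" "y = \<phi> l b"
      using xy unfolding surj by auto
    have 1: "cmult A (k - 1) l (cdiff A k a) b \<in> elts A (k + l - 1)"
      using mult_closed[of "cdiff A k a" "k - 1" b l] ab by (simp add: algebra_simps)
    have 2: "cmult A k (l - 1) a (cdiff A l b) \<in> elts A (k + l - 1)"
      using mult_closed[of a k "cdiff A l b" "l - 1"] ab by (simp add: algebra_simps)
    show ?thesis
      using ab mult[of "cdiff A k a" "k - 1" b l] mult[of a k "cdiff A l b" "l - 1"] 1 2
      by (simp add: mult diff add smult leibniz algebra_simps)
  qed
  have c4: "linear_between (grade C l) (grade C (k + l)) (\<lambda>y. cmult C k l x y)" if "x \<in> elts C k" for k l x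
    using that mult_linear_right[of _ k l] unfolding linear_between_def surj
    by (auto simp: mult add smult)
  have c5: "linear_between (grade C k) (grade C (k + l)) (\<lambda>x. cmult C k l x y)" if "y \<in> elts C l" for k l y
    using that mult_linear_left[of _ l k] unfolding linear_between_def surj
    by (auto simp: mult add smult)
  have c6: "linear_between (grade C k) (grade C (k - 1)) (cdiff C k)" for k
    using diff_linear[of k] unfolding linear_between_def surj
    by (auto simp: diff add smult)
  have c7: "cunit C \<in> elts C 0" by (auto simp: unit surj)
  have c8: "cmult C 0 k (cunit C) x = x" if x: "x \<in> elts C k" for k x
  proof -
    obtain a where a: "a \<in> elts A k" "x = \<phi> k a" using x unfolding surj by auto
    then show ?thesis using mult[of "cunit A" 0 a k] by (simp add: unit unit_left)
  qed
  have c9: "cmult C k l x y = ((-1) powi (k * l)) \<odot>\<^bsub>grade C (k + l)\<^esub> cmult C l k y x"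
    if xy: "x \<in> elts C k" "y \<in> elts C l" for k l x y
  proof -
    obtain a b where ab: "a \<in> elts A k" "b \<in> elts A l" "x = \<phi> k a" "y = \<phi> l b"
      using xy unfolding surj by auto
    have "cmult A l k b a \<in> elts A (k + l)" using mult_closed[of b l a k] ab by (simp add: add.commute)
    then have "((-1) powi (k * l)) \<odot>\<^bsub>grade C (k + l)\<^esub> \<phi> (k + l) (cmult A l k b a) =
      \<phi> (k + l) (((-1) powi (k * l)) \<odot>\<^bsub>grade A (k + l)\<^esub> cmult A l k b a)"
      by (rule smult)
    moreover have "cmult C l k (\<phi> l b) (\<phi> k a) = \<phi> (k + l) (cmult A l k b a)"
      using mult[of b l a k] ab by (simp add: add.commute)
    ultimately show ?thesis using ab mult_commute[of a k b l] by (simp add: mult)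
  qed
  show ?thesis unfolding is_cdga_def by (intro conjI allI ballI; rule c0 c1 c2 c3 c4 c5 c6 c7 c8 c9; assumption)
qed

subsection \<open>Homology\<close>

definition hclass :: "'a cdga \<Rightarrow> int \<Rightarrow> 'a \<Rightarrow> 'a set" where
  "hclass A k z = (\<lambda>b. b \<oplus>\<^bsub>grade A k\<^esub> z) ` boundaries A k"

lemma r_coset_boundaries: "boundaries A k #>\<^bsub>add_monoid (grade A k)\<^esub> z = hclass A k z"
  by (auto simp: r_coset_def hclass_def)

lemma carrier_homology: "carrier (homology A k) = hclass A k ` cycles A k"
  by (auto simp: homology_def FactGroup_def RCOSETS_def r_coset_def hclass_def)

context cdga
begin

lemma boundary_elt: "b \<in> boundaries A k \<Longrightarrow> b \<in> elts A k"
  using diff_closed[of _ "k + 1"] by (auto simp: boundaries_def)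

lemma boundaries_zero: "\<zero>\<^bsub>grade A k\<^esub> \<in> boundaries A k"
proof -
  have "cdiff A (k + 1) \<zero>\<^bsub>grade A (k + 1)\<^esub> = \<zero>\<^bsub>grade A (k + 1 - 1)\<^esub>"
    by (rule linear_between_zero[OF diff_linear mod mod])
  then show ?thesis unfolding boundaries_def by (metis M.zero_closed add_diff_cancel_right' imageI)
qed

lemma boundaries_add: "a \<in> boundaries A k \<Longrightarrow> b \<in> boundaries A k \<Longrightarrow> a \<oplus>\<^bsub>grade A k\<^esub> b \<in> boundaries A k"
  using diff_plus[of _ "k + 1"] by (auto simp: boundaries_def) (metis M.a_closed imageI)

lemma boundaries_minus:
  assumes "a \<in> boundaries A k" shows "\<ominus>\<^bsub>grade A k\<^esub> a \<in> boundaries A k"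
proof -
  obtain c where c: "c \<in> elts A (k + 1)" "a = cdiff A (k + 1) c" using assms by (auto simp: boundaries_def)
  have "cdiff A (k + 1) ((-1) \<odot>\<^bsub>grade A (k + 1)\<^esub> c) = (-1) \<odot>\<^bsub>grade A k\<^esub> a"
    using diff_linear[of "k + 1"] c by (auto simp: linear_between_def)
  then have "\<ominus>\<^bsub>grade A k\<^esub> a = cdiff A (k + 1) ((-1) \<odot>\<^bsub>grade A (k + 1)\<^esub> c)"
    using uminus_smult[OF boundary_elt[OF assms]] by simp
  then show ?thesis unfolding boundaries_def using c(1) smult_closed by blast
qed

lemma hclass_boundary: "b \<in> boundaries A k \<Longrightarrow> z \<in> elts A k \<Longrightarrow> hclass A k (b \<oplus>\<^bsub>grade A k\<^esub> z) = hclass A k z"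
proof -
  assume b: "b \<in> boundaries A k" and z: "z \<in> elts A k"
  have "c \<oplus>\<^bsub>grade A k\<^esub> z = (c \<oplus>\<^bsub>grade A k\<^esub> \<ominus>\<^bsub>grade A k\<^esub> b) \<oplus>\<^bsub>grade A k\<^esub> (b \<oplus>\<^bsub>grade A k\<^esub> z)"
    if "c \<in> boundaries A k" for c
    using boundary_elt[OF b] boundary_elt[OF that] z by (simp add: M.a_assoc M.r_neg1)
  then have "hclass A k z \<subseteq> hclass A k (b \<oplus>\<^bsub>grade A k\<^esub> z)"
    unfolding hclass_def using boundaries_add boundaries_minus[OF b] by blast
  moreover have "c \<oplus>\<^bsub>grade A k\<^esub> (b \<oplus>\<^bsub>grade A k\<^esub> z) = (c \<oplus>\<^bsub>grade A k\<^esub> b) \<oplus>\<^bsub>grade A k\<^esub> z"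
    if "c \<in> boundaries A k" for c
    using boundary_elt[OF b] boundary_elt[OF that] z by (simp add: M.a_assoc)
  then have "hclass A k (b \<oplus>\<^bsub>grade A k\<^esub> z) \<subseteq> hclass A k z"
    unfolding hclass_def using boundaries_add[OF _ b] by auto
  ultimately show ?thesis by blast
qed

lemma hclass_eqD: "hclass A k z = hclass A k w \<Longrightarrow> z \<in> elts A k \<Longrightarrow> \<exists>b\<in>boundaries A k. z = b \<oplus>\<^bsub>grade A k\<^esub> w"
  using boundaries_zero[of k] M.l_zero[of z k] unfolding hclass_def by (metis (no_types, lifting) image_iff)

end

lemma hom_boundary:
  "f \<in> cdga_hom A B \<Longrightarrow> b \<in> boundaries A k \<Longrightarrow> f k b \<in> boundaries B k"
  using cdga_homD(3,8)[of f A B _ "k + 1"] by (fastforce simp: boundaries_def)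

lemma hom_cycle:
  "is_cdga A \<Longrightarrow> is_cdga B \<Longrightarrow> f \<in> cdga_hom A B \<Longrightarrow> z \<in> cycles A k \<Longrightarrow> f k z \<in> cycles B k"
  using cdga_homD(3,8)[of f A B z "k"] cdga_hom_zero[of A B f "k - 1"] by (auto simp: cycles_def)

lemma homology_map_hclass:
  assumes "is_cdga A" "is_cdga B" "f \<in> cdga_hom A B" "z \<in> cycles A k"
  shows "homology_map B f k (hclass A k z) = hclass B k (f k z)"
proof -
  interpret A: cdga A by unfold_locales fact
  interpret B: cdga B by unfold_locales fact
  have z: "z \<in> elts A k" using assms(4) by (simp add: cycles_def)
  have "hclass B k (f k w) = hclass B k (f k z)" if w: "w \<in> hclass A k z" for w
  proof -
    obtain b where b: "b \<in> boundaries A k" "w = b \<oplus>\<^bsub>grade A k\<^esub> z" using w by (auto simp: hclass_def)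
    then have "f k w = f k b \<oplus>\<^bsub>grade B k\<^esub> f k z"
      using cdga_homD(4)[OF assms(3)] A.boundary_elt z by blast
    then show ?thesis
      using B.hclass_boundary hom_boundary[OF assms(3) b(1)] cdga_homD(3)[OF assms(3) z] by simp
  qed
  moreover have "hclass A k z \<noteq> {}" using A.boundaries_zero by (auto simp: hclass_def)
  ultimately show ?thesis unfolding homology_map_def r_coset_boundaries by blast
qed

text \<open>Together with \<open>quasi_iso_surj\<close> this turns bijectivity on cosets into
  statements about cycles and boundaries, the form in which lifting uses it.\<close>

lemma quasi_iso_inj:
  assumes "is_cdga A" "is_cdga B" "quasi_iso A B f" "z \<in> cycles A k" "f k z \<in> boundaries B k"
  shows "z \<in> boundaries A k"
proof -
  interpret A: cdga A by unfold_locales fact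
  interpret B: cdga B by unfold_locales fact
  have f: "f \<in> cdga_hom A B" and bij: "bij_betw (homology_map B f k) (carrier (homology A k)) (carrier (homology B k))"
    using assms(3) by (auto simp: quasi_iso_def)
  have z0: "\<zero>\<^bsub>grade A k\<^esub> \<in> cycles A k"
    using linear_between_zero[OF A.diff_linear A.mod A.mod] by (simp add: cycles_def)
  have "hclass B k (f k z) = hclass B k \<zero>\<^bsub>grade B k\<^esub>"
    using B.hclass_boundary[OF assms(5) B.M.zero_closed] B.boundary_elt[OF assms(5)] by simp
  then have "homology_map B f k (hclass A k z) = homology_map B f k (hclass A k \<zero>\<^bsub>grade A k\<^esub>)"
    using homology_map_hclass[OF assms(1,2) f] assms(4) z0 cdga_hom_zero[OF assms(1,2) f] by simp
  then have "hclass A k z = hclass A k \<zero>\<^bsub>grade A k\<^esub>"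
    using bij assms(4) z0 unfolding bij_betw_def inj_on_def carrier_homology by blast
  then obtain b where "b \<in> boundaries A k" "z = b \<oplus>\<^bsub>grade A k\<^esub> \<zero>\<^bsub>grade A k\<^esub>"
    using A.hclass_eqD[of k z] assms(4) unfolding cycles_def by blast
  then show ?thesis using A.boundary_elt by simp
qed

lemma quasi_iso_surj:
  assumes "is_cdga A" "is_cdga B" "quasi_iso A B f" "y \<in> cycles B k"
  shows "\<exists>z\<in>cycles A k. \<exists>b\<in>boundaries B k. y = b \<oplus>\<^bsub>grade B k\<^esub> f k z"
proof -
  interpret B: cdga B by unfold_locales fact
  have f: "f \<in> cdga_hom A B" and bij: "bij_betw (homology_map B f k) (carrier (homology A k)) (carrier (homology B k))"
    using assms(3) by (auto simp: quasi_iso_def)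
  have "hclass B k y \<in> homology_map B f k ` carrier (homology A k)"
    using bij assms(4) by (auto simp: bij_betw_def carrier_homology)
  then obtain z where z: "z \<in> cycles A k" "hclass B k y = homology_map B f k (hclass A k z)"
    by (auto simp: carrier_homology)
  then have "hclass B k y = hclass B k (f k z)" using homology_map_hclass[OF assms(1,2) f] by simp
  then show ?thesis using B.hclass_eqD assms(4) z(1) by (auto simp: cycles_def)
qed

lemma iso_quasi_iso:
  assumes "is_cdga A" "is_cdga B" and f: "f \<in> cdga_hom A B"
    and bij: "\<And>k. bij_betw (f k) (elts A k) (elts B k)"
  shows "quasi_iso A B f"
proof -
  interpret A: cdga A by unfold_locales fact
  interpret B: cdga B by unfold_locales fact
  note hm = homology_map_hclass[OF assms(1,2) f]
  have surj: "f k ` elts A k = elts B k" for k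
    using bij[of k] by (rule bij_betw_imp_surj_on)
  have inj: "x \<in> elts A k \<Longrightarrow> y \<in> elts A k \<Longrightarrow> f k x = f k y \<Longrightarrow> x = y" for k x y
    using inj_onD[OF bij_betw_imp_inj_on[OF bij[of k]]] by blast
  have bd: "\<exists>c\<in>boundaries A k. f k c = b" if b: "b \<in> boundaries B k" for b k
  proof -
    obtain y where y: "y \<in> elts B (k + 1)" "b = cdiff B (k + 1) y" using b unfolding boundaries_def by blast
    obtain x where x: "x \<in> elts A (k + 1)" "f (k + 1) x = y"
      using y(1) surj[of "k + 1"] by (metis imageE)
    then show ?thesis
      using cdga_homD(8)[OF f x(1)] y x by (intro bexI[of _ "cdiff A (k + 1) x"]) (auto simp: boundaries_def)
  qed
  have "bij_betw (homology_map B f k) (carrier (homology A k)) (carrier (homology B k))" for k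
    unfolding bij_betw_def
  proof
    show "inj_on (homology_map B f k) (carrier (homology A k))"
    proof (rule inj_onI)
      fix C C' assume "C \<in> carrier (homology A k)" "C' \<in> carrier (homology A k)"
        and e: "homology_map B f k C = homology_map B f k C'"
      then obtain z w where zw: "z \<in> cycles A k" "w \<in> cycles A k" "C = hclass A k z" "C' = hclass A k w"
        by (auto simp: carrier_homology)
      then have el: "z \<in> elts A k" "w \<in> elts A k" by (auto simp: cycles_def)
      have "hclass B k (f k z) = hclass B k (f k w)" using e zw hm by simp
      then obtain b where b: "b \<in> boundaries B k" "f k z = b \<oplus>\<^bsub>grade B k\<^esub> f k w"
        using B.hclass_eqD cdga_homD(3)[OF f] el by blast
      then obtain c where c: "c \<in> boundaries A k" "f k c = b" using bd by blast
      then have "f k z = f k (c \<oplus>\<^bsub>grade A k\<^esub> w)"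
        using b cdga_homD(4)[OF f] A.boundary_elt el by simp
      then have "z = c \<oplus>\<^bsub>grade A k\<^esub> w"
        using el A.boundary_elt[OF c(1)] by (intro inj[of _ k]) auto
      then show "C = C'" using zw A.hclass_boundary[OF c(1)] el by simp
    qed
    show "homology_map B f k ` carrier (homology A k) = carrier (homology B k)"
    proof -
      have "f k ` cycles A k = cycles B k"
      proof (intro equalityI subsetI)
        fix y assume y: "y \<in> cycles B k"
        then have "y \<in> f k ` elts A k" unfolding surj by (simp add: cycles_def)
        then obtain x where x: "x \<in> elts A k" "f k x = y" by blast
        have "cdiff B k y = \<zero>\<^bsub>grade B (k - 1)\<^esub>" using y by (simp add: cycles_def)
        then have "f (k - 1) (cdiff A k x) = f (k - 1) \<zero>\<^bsub>grade A (k - 1)\<^esub>"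
          by (simp only: cdga_homD(8)[OF f x(1)] x(2) cdga_hom_zero[OF assms(1-3)])
        then have "cdiff A k x = \<zero>\<^bsub>grade A (k - 1)\<^esub>"
          using A.diff_closed[OF x(1)] A.M.zero_closed inj by blast
        then show "y \<in> f k ` cycles A k" using x by (auto simp: cycles_def)
      next
        fix y assume "y \<in> f k ` cycles A k"
        then show "y \<in> cycles B k" using hom_cycle[OF assms(1,2) f] by blast
      qed
      then have "hclass B k ` cycles B k = (\<lambda>z. hclass B k (f k z)) ` cycles A k" by (metis image_image)
      also have "\<dots> = (\<lambda>z. homology_map B f k (hclass A k z)) ` cycles A k"
        using hm by (intro image_cong) auto
      finally show ?thesis unfolding carrier_homology by (simp add: image_image)
    qed
  qed
  then show ?thesis using f by (simp add: quasi_iso_def)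
qed

text \<open>This is the extension over one new generator with boundary \<open>z\<close>. Injectivity
  on homology yields some \<open>e0\<close> with boundary \<open>z\<close>. The error
  \<open>y1\<close> is then a cycle, so by surjectivity on homology it is the image of a cycle
  \<open>w\<close> up to a boundary, and that boundary lifts because \<open>p\<close> is onto.
  Adding both corrections to \<open>e0\<close> leaves its differential unchanged.\<close>

lemma trivial_fibration_lift:
  assumes "is_cdga E" "is_cdga F" "fibration E F p" "quasi_iso E F p"
    and z: "z \<in> cycles E (k - 1)" and y: "y \<in> elts F k" and dy: "cdiff F k y = p (k - 1) z"
  shows "\<exists>e\<in>elts E k. cdiff E k e = z \<and> p k e = y"
proof -
  interpret E: cdga E by unfold_locales fact
  interpret F: cdga F by unfold_locales fact
  have p: "p \<in> cdga_hom E F" and surj: "\<And>k. p k ` elts E k = elts F k"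
    using assms(3) by (auto simp: fibration_def)
  note ph = cdga_homD[OF p]
  have "p (k - 1) z \<in> boundaries F (k - 1)"
    unfolding boundaries_def using dy y by (metis diff_add_cancel imageI)
  then have "z \<in> boundaries E (k - 1)" using quasi_iso_inj[OF assms(1,2,4) z] by blast
  then obtain e0 where e0: "e0 \<in> elts E k" "cdiff E k e0 = z" by (auto simp: boundaries_def)
  have pe0: "p k e0 \<in> elts F k" using ph(3) e0 by blast
  define y1 where "y1 = y \<ominus>\<^bsub>grade F k\<^esub> p k e0"
  have "cdiff F k y1 = cdiff F k y \<oplus>\<^bsub>grade F (k - 1)\<^esub> cdiff F k ((-1) \<odot>\<^bsub>grade F k\<^esub> p k e0)"
    unfolding y1_def a_minus_def using F.diff_plus pe0 y by (simp add: F.uminus_smult)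
  also have "cdiff F k ((-1) \<odot>\<^bsub>grade F k\<^esub> p k e0) = (-1) \<odot>\<^bsub>grade F (k - 1)\<^esub> cdiff F k (p k e0)"
    using F.diff_linear[of k] pe0 by (auto simp: linear_between_def)
  also have "cdiff F k (p k e0) = cdiff F k y" using ph(8)[OF e0(1)] e0 dy by simp
  finally have "cdiff F k y1 = \<zero>\<^bsub>grade F (k - 1)\<^esub>" using y by (simp add: F.uminus_smult F.M.r_neg)
  then have "y1 \<in> cycles F k" using pe0 y by (simp add: cycles_def y1_def)
  then obtain w b where w: "w \<in> cycles E k" and b: "b \<in> boundaries F k" and y1: "y1 = b \<oplus>\<^bsub>grade F k\<^esub> p k w"
    using quasi_iso_surj[OF assms(1,2,4)] by blast
  obtain v where v: "v \<in> elts F (k + 1)" "b = cdiff F (k + 1) v" using b by (auto simp: boundaries_def)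
  have "v \<in> p (k + 1) ` elts E (k + 1)" unfolding surj by (rule v(1))
  then obtain v' where v': "v' \<in> elts E (k + 1)" "p (k + 1) v' = v" by blast
  have dv': "cdiff E (k + 1) v' \<in> elts E k" using E.diff_closed[OF v'(1)] by simp
  have pdv': "p k (cdiff E (k + 1) v') = b" using ph(8)[OF v'(1)] v v' by simp
  have w': "w \<in> elts E k" "cdiff E k w = \<zero>\<^bsub>grade E (k - 1)\<^esub>" using w by (auto simp: cycles_def)
  have ddv: "cdiff E k (cdiff E (k + 1) v') = \<zero>\<^bsub>grade E (k - 1)\<^esub>"
    using E.diff_diff[OF v'(1)] by simp
  define e where "e = e0 \<oplus>\<^bsub>grade E k\<^esub> (cdiff E (k + 1) v' \<oplus>\<^bsub>grade E k\<^esub> w)"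
  have "e \<in> elts E k" using e0 dv' w' by (simp add: e_def)
  moreover have "cdiff E k e = z"
    using e0 dv' w' ddv E.diff_closed[OF e0(1)] by (simp add: e_def E.diff_plus)
  moreover have "p k e = p k e0 \<oplus>\<^bsub>grade F k\<^esub> y1"
    using e0 dv' w' by (simp add: e_def ph(4) pdv' y1)
  then have "p k e = y"
    using pe0 y by (simp add: y1_def a_minus_def F.M.a_lcomm F.M.r_neg)
  ultimately show ?thesis by blast
qed

section \<open>Free algebras as CDGAs, and subalgebras generated by fewer generators\<close>

lemma free_cdga_simps [simp]:
  "x \<oplus>\<^bsub>grade (free_cdga deg G \<delta>) k\<^esub> y = x + y"
  "\<zero>\<^bsub>grade (free_cdga deg G \<delta>) k\<^esub> = 0"
  "c \<odot>\<^bsub>grade (free_cdga deg G \<delta>) k\<^esub> x = c \<cdot> x"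
  "cunit (free_cdga deg G \<delta>) = pmono {#}"
  "cmult (free_cdga deg G \<delta>) k l = pmul deg G"
  by (simp_all add: free_cdga_def fun_eq_iff)

context graded_gens
begin

lemma elts_free [simp]: "elts (free_cdga deg G \<delta>) k = homog k"
  by (simp add: free_cdga_def homog_def)

end

context free_derivation
begin

lemma cdiff_free [simp]: "cdiff (free_cdga deg G \<delta>) k = D"
  by (simp add: free_cdga_def D_def fun_eq_iff)

lemma is_cdga_free:
  assumes dd: "\<And>g. g \<in> G \<Longrightarrow> D (\<delta> g) = 0"
  shows "is_cdga (free_cdga deg G \<delta>)"
proof -
  have "Module.module RAT (grade (free_cdga deg G \<delta>) k)" for k
    by (rule RAT_moduleI) (auto intro: homog_add homog_scal simp: add_ac scal_add)
  moreover have "linear_between (grade (free_cdga deg G \<delta>) k) (grade (free_cdga deg G \<delta>) (k - 1)) D" for k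
    unfolding linear_between_def by (auto intro: D_homog D_add_homog D_scal)
  moreover have "pmono {#} \<star> f = f" if "f \<in> homog k" for f k
    using homogD(2)[OF that] by (rule mul_unit_left)
  ultimately show ?thesis
    unfolding is_cdga_def
    by (auto simp: linear_between_def mul_add mul_scal mul_assoc D_mul D_D[OF dd]
        intro: homog_mul homog_pmono mul_commute)
qed

end

context graded_gens
begin

lemma monomials_subset: "H \<subseteq> G \<Longrightarrow> K \<in> monomials deg H \<longleftrightarrow> K \<in> mons \<and> set_mset K \<subseteq> H"
  unfolding monomials_def by blast

lemma homog_subset: "H \<subseteq> G \<Longrightarrow> f \<in> graded_gens.homog deg H k \<longleftrightarrow>
    f \<in> homog k \<and> (\<forall>K. f K \<noteq> 0 \<longrightarrow> set_mset K \<subseteq> H)"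
  unfolding graded_gens.homog_def monomials_subset by blast

text \<open>\<open>pmul\<close> cuts off at the monomials of its own generating set. A monomial
  outside \<open>H\<close> does not split into two monomials over \<open>H\<close>, so the larger
  set adds no term.\<close>

lemma pmul_subset:
  assumes H: "H \<subseteq> G" and f: "f \<in> graded_gens.homog deg H k" and g: "g \<in> graded_gens.homog deg H l"
  shows "pmul deg H f g = pmul deg G f g"
proof
  fix K
  show "pmul deg H f g K = pmul deg G f g K"
  proof (cases "K \<in> mons \<and> K \<notin> monomials deg H")
    case True
    have "mon_sign deg M (K - M) * f M * g (K - M) = 0" if M: "M \<subseteq># K" for M
    proof (rule ccontr)
      assume "mon_sign deg M (K - M) * f M * g (K - M) \<noteq> 0"
      then have "set_mset M \<subseteq> H" "set_mset (K - M) \<subseteq> H" using f g homog_subset[OF H] by auto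
      then have "set_mset (M + (K - M)) \<subseteq> H" by simp
      then show False using True M monomials_subset[OF H] by simp
    qed
    then have "(\<Sum>M | M \<subseteq># K. mon_sign deg M (K - M) * f M * g (K - M)) = 0"
      by (intro sum.neutral) blast
    then show ?thesis using True by (simp only: pmul_def if_True if_False)
  qed (use monomials_subset[OF H] in \<open>auto simp: pmul_def\<close>)
qed

end

lemma (in free_derivation) D_subset:
  assumes H: "H \<subseteq> G" and dH: "free_derivation deg H \<delta>" and f: "f \<in> graded_gens.homog deg H k"
  shows "free_derivation.D deg H \<delta> f = D f"
proof -
  interpret H: free_derivation deg H \<delta> by fact
  have "H.dm K = dm K" if "K \<in> H.mons" for K
    using that
  proof (induction K rule: multiset_induct_min)
    case (add h K)
    have min: "\<forall>x\<in>#K. h \<le> x" using add.hyps by auto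
    have K: "K \<in> H.mons" "h \<in> H" using add.prems by (auto simp: H.mons_add_mset)
    have "add_mset h K \<in> mons" using add.prems monomials_subset[OF H] by blast
    note pG = prepend_minimal(2)[OF min this]
    note pH = H.prepend_minimal(2)[OF min add.prems]
    have IH: "H.dm K = dm K" by (rule add.IH[OF K(1)])
    have "H.dm (add_mset h K) = dm (add_mset h K)"
      unfolding pG pH IH[symmetric]
      using pmul_subset[OF H H.delta_homog[OF K(2)] H.homog_pmono[OF K(1) refl]]
        pmul_subset[OF H H.homog_pvar[OF K(2)] H.dm_homog[OF K(1)]] by simp
    then show ?case .
  qed simp
  then show ?thesis using H.homogD(2)[OF f]
    unfolding D_def H.D_def by (intro ext sum.cong) auto
qed

lemma free_cdga_inclusion:
  assumes "H \<subseteq> G" "free_derivation deg G \<delta>" "free_derivation deg H \<delta>"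
  shows "(\<lambda>k. restrict (\<lambda>x. x) (elts (free_cdga deg H \<delta>) k)) \<in> cdga_hom (free_cdga deg H \<delta>) (free_cdga deg G \<delta>)"
proof -
  interpret G: free_derivation deg G \<delta> by fact
  interpret H: free_derivation deg H \<delta> by fact
  have sub: "f \<in> H.homog k \<Longrightarrow> f \<in> G.homog k" for f k using G.homog_subset[OF assms(1)] by simp
  show ?thesis
    unfolding cdga_hom_def linear_between_def
    by (auto simp: G.pmul_subset[OF assms(1)] G.D_subset[OF assms(1,3)] sub
        intro: H.homog_add H.homog_scal H.homog_pmono H.homog_mul H.D_homog)
      (metis G.pmul_subset[OF assms(1)] H.homog_mul, metis G.D_subset[OF assms(1,3)] H.D_homog)
qed

subsection \<open>The universal property\<close>

fun evword :: "('g \<Rightarrow> int) \<Rightarrow> 'b cdga \<Rightarrow> ('g \<Rightarrow> 'b) \<Rightarrow> 'g list \<Rightarrow> 'b" where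
  "evword deg E e [] = cunit E"
| "evword deg E e (g # w) = cmult E (deg g) (mdeg deg (mset w)) (e g) (evword deg E e w)"

definition evmon :: "('g::linorder \<Rightarrow> int) \<Rightarrow> 'b cdga \<Rightarrow> ('g \<Rightarrow> 'b) \<Rightarrow> 'g multiset \<Rightarrow> 'b" where
  "evmon deg E e K = evword deg E e (sorted_list_of_multiset K)"

definition ev :: "('g::linorder \<Rightarrow> int) \<Rightarrow> 'b cdga \<Rightarrow> ('g \<Rightarrow> 'b) \<Rightarrow> int \<Rightarrow> ('g multiset \<Rightarrow> rat) \<Rightarrow> 'b" where
  "ev deg E e k f = (\<Oplus>\<^bsub>grade E k\<^esub>K\<in>{K. f K \<noteq> 0}. f K \<odot>\<^bsub>grade E k\<^esub> evmon deg E e K)"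

lemma evmon_empty [simp]: "evmon deg E e {#} = cunit E"
  by (simp add: evmon_def)

lemma evmon_minimal:
  assumes "\<forall>x\<in>#K. h \<le> x"
  shows "evmon deg E e (add_mset h K) = cmult E (deg h) (mdeg deg K) (e h) (evmon deg E e K)"
proof -
  have "insort h (sorted_list_of_multiset K) = h # sorted_list_of_multiset K"
    using assms(1) by (intro insort_is_Cons) auto
  then show ?thesis unfolding evmon_def by simp
qed

context cdga
begin

lemma mult_smult_right: "x \<in> elts A k \<Longrightarrow> y \<in> elts A l \<Longrightarrow>
    cmult A k l x (c \<odot>\<^bsub>grade A l\<^esub> y) = c \<odot>\<^bsub>grade A (k + l)\<^esub> cmult A k l x y"
  using mult_linear_right[of x k l] by (auto simp: linear_between_def)

lemma mult_smult_left: "x \<in> elts A k \<Longrightarrow> y \<in> elts A l \<Longrightarrow>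
    cmult A k l (c \<odot>\<^bsub>grade A k\<^esub> x) y = c \<odot>\<^bsub>grade A (k + l)\<^esub> cmult A k l x y"
  using mult_linear_left[of y l k] by (auto simp: linear_between_def)

lemma mult_zero_right: "x \<in> elts A k \<Longrightarrow> cmult A k l x \<zero>\<^bsub>grade A l\<^esub> = \<zero>\<^bsub>grade A (k + l)\<^esub>"
  using linear_between_zero[OF mult_linear_right mod mod] by simp

lemma mult_zero_left: "y \<in> elts A l \<Longrightarrow> cmult A k l \<zero>\<^bsub>grade A k\<^esub> y = \<zero>\<^bsub>grade A (k + l)\<^esub>"
  using linear_between_zero[OF mult_linear_left mod mod] by simp

text \<open>Graded commutativity makes the square its own negative, and 2 is invertible in
  \<open>rat\<close>. This matches the rule that odd generators occur at most once in a
  monomial.\<close>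

lemma odd_square:
  assumes "odd k" "x \<in> elts A k" shows "cmult A k k x x = \<zero>\<^bsub>grade A (k + k)\<^esub>"
proof -
  let ?y = "cmult A k k x x"
  have y: "?y \<in> elts A (k + k)" by (rule mult_closed[OF assms(2,2)])
  have "?y = (-1) \<odot>\<^bsub>grade A (k + k)\<^esub> ?y"
    using mult_commute[OF assms(2,2)] assms(1) by simp
  then have "?y \<oplus>\<^bsub>grade A (k + k)\<^esub> ?y = \<zero>\<^bsub>grade A (k + k)\<^esub>"
    using uminus_smult[OF y] y by (metis M.r_neg)
  then have "2 \<odot>\<^bsub>grade A (k + k)\<^esub> ?y = \<zero>\<^bsub>grade A (k + k)\<^esub>"
    using smult_add[OF y, of 1 1] y by simp
  then have "(1/2) \<odot>\<^bsub>grade A (k + k)\<^esub> (2 \<odot>\<^bsub>grade A (k + k)\<^esub> ?y) = \<zero>\<^bsub>grade A (k + k)\<^esub>" by simp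
  then show ?thesis using smult_smult[OF y, of "1/2" 2] y by simp
qed

lemma mult_left_commute:
  assumes "x \<in> elts A j" "y \<in> elts A k" "z \<in> elts A l"
  shows "cmult A j (k + l) x (cmult A k l y z) =
    ((-1) powi (j * k)) \<odot>\<^bsub>grade A (j + (k + l))\<^esub> cmult A k (j + l) y (cmult A j l x z)"
proof -
  have "cmult A j (k + l) x (cmult A k l y z) = cmult A (j + k) l (cmult A j k x y) z"
    using mult_assoc assms by simp
  also have "cmult A j k x y = ((-1) powi (j * k)) \<odot>\<^bsub>grade A (j + k)\<^esub> cmult A k j y x"
    by (rule mult_commute) fact+
  also have "cmult A (j + k) l (((-1) powi (j * k)) \<odot>\<^bsub>grade A (j + k)\<^esub> cmult A k j y x) z =
    ((-1) powi (j * k)) \<odot>\<^bsub>grade A (j + k + l)\<^esub> cmult A (j + k) l (cmult A k j y x) z"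
    using assms mult_closed[of y k x j] by (intro mult_smult_left) (auto simp: add.commute)
  also have "cmult A (j + k) l (cmult A k j y x) z = cmult A k (j + l) y (cmult A j l x z)"
    using mult_assoc[of y k x j z l] assms by (simp add: add.commute)
  finally show ?thesis by (simp add: add.assoc)
qed

end

section \<open>Substituting elements of a CDGA into polynomials\<close>

locale evaluation = graded_gens deg G + E: cdga E
  for deg :: "'g::linorder \<Rightarrow> int" and G and E :: "'b cdga" +
  fixes e :: "'g \<Rightarrow> 'b"
  assumes e_closed: "g \<in> G \<Longrightarrow> e g \<in> elts E (deg g)"
begin

abbreviation "em \<equiv> evmon deg E e"

lemma em_closed: "K \<in> mons \<Longrightarrow> em K \<in> elts E (mdeg deg K)"
proof (induction K rule: multiset_induct_min)
  case (add h K)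
  have K: "K \<in> mons" "h \<in> G" using add.prems by (auto simp: mons_add_mset)
  have min: "\<forall>x\<in>#K. h \<le> x" using add.hyps by auto
  show ?case using E.mult_closed[OF e_closed[OF K(2)] add.IH[OF K(1)]] by (simp add: evmon_minimal[OF min])
qed simp

text \<open>The sorting argument of \<open>D_pvar_mono\<close>, now carried out in \<open>E\<close>:
  graded commutativity moves \<open>e g\<close> past smaller generators at the cost of
  \<open>mon_sign\<close>, and a repeated odd generator gives zero by
  \<open>odd_square\<close>.\<close>

lemma em_insert:
  assumes g: "g \<in> G" and "N \<in> mons"
  shows "cmult E (deg g) (mdeg deg N) (e g) (em N) =
    (if add_mset g N \<in> mons then mon_sign deg {#g#} N \<odot>\<^bsub>grade E (deg g + mdeg deg N)\<^esub> em (add_mset g N)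
     else \<zero>\<^bsub>grade E (deg g + mdeg deg N)\<^esub>)"
  using assms(2)
proof (induction N rule: multiset_induct_min)
  case empty
  have "em {#g#} = cmult E (deg g) 0 (e g) (cunit E)" using evmon_minimal[of "{#}" g deg E e] by simp
  moreover have "em {#g#} \<in> elts E (deg g)" using em_closed[of "{#g#}"] g by simp
  ultimately show ?case using g by simp
next
  case (add h W)
  have h: "h \<in> G" and W: "W \<in> mons" and hW: "\<not> (h \<in># W \<and> odd (deg h))"
    using add.prems by (auto simp: mons_add_mset)
  have min: "\<forall>x\<in>#W. h \<le> x" using add.hyps by auto
  let ?k = "deg g + (deg h + mdeg deg W)"
  have eW: "em (add_mset h W) = cmult E (deg h) (mdeg deg W) (e h) (em W)" by (rule evmon_minimal[OF min])
  consider "g < h \<or> g = h \<and> even (deg g)" | "g = h" "odd (deg g)" | "h < g" by fastforce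
  then have "cmult E (deg g) (deg h + mdeg deg W) (e g) (em (add_mset h W)) =
    (if add_mset g (add_mset h W) \<in> mons then mon_sign deg {#g#} (add_mset h W) \<odot>\<^bsub>grade E ?k\<^esub> em (add_mset g (add_mset h W))
     else \<zero>\<^bsub>grade E ?k\<^esub>)"
  proof cases
    case 1
    have *: "\<forall>x\<in>#add_mset h W. g \<le> x" using 1 min by auto
    have m: "add_mset g (add_mset h W) \<in> mons"
      using 1 g add.prems min by (auto simp: mons_add_mset)
    show ?thesis using m evmon_minimal[OF *, of deg E e] mon_sign_minimal[OF *, of deg] em_closed[OF m] by simp
  next
    case 2
    have "cmult E (deg h) (deg h + mdeg deg W) (e h) (cmult E (deg h) (mdeg deg W) (e h) (em W)) =
      cmult E (deg h + deg h) (mdeg deg W) (cmult E (deg h) (deg h) (e h) (e h)) (em W)"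
      by (rule E.mult_assoc[OF e_closed[OF h] e_closed[OF h] em_closed[OF W], symmetric])
    also have "cmult E (deg h) (deg h) (e h) (e h) = \<zero>\<^bsub>grade E (deg h + deg h)\<^esub>"
      using 2 by (intro E.odd_square e_closed h) simp
    also have "cmult E (deg h + deg h) (mdeg deg W) \<dots> (em W) = \<zero>\<^bsub>grade E (deg h + deg h + mdeg deg W)\<^esub>"
      by (rule E.mult_zero_left[OF em_closed[OF W]])
    finally show ?thesis using 2 eW by (simp add: mons_add_mset add.assoc)
  next
    case 3
    have iff: "add_mset g (add_mset h W) \<in> mons \<longleftrightarrow> add_mset g W \<in> mons"
      using 3 add.prems by (auto simp: mons_add_mset)
    have s: "(-1) powi (deg g * deg h) = mon_sign deg {#g#} {#h#}"
      using 3 by (auto simp: mon_sign_single)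
    have IH: "cmult E (deg g) (mdeg deg W) (e g) (em W) =
      (if add_mset g W \<in> mons then mon_sign deg {#g#} W \<odot>\<^bsub>grade E (deg g + mdeg deg W)\<^esub> em (add_mset g W)
       else \<zero>\<^bsub>grade E (deg g + mdeg deg W)\<^esub>)"
      by (rule add.IH[OF W])
    have "cmult E (deg g) (deg h + mdeg deg W) (e g) (em (add_mset h W)) =
       mon_sign deg {#g#} {#h#} \<odot>\<^bsub>grade E ?k\<^esub>
         cmult E (deg h) (deg g + mdeg deg W) (e h) (cmult E (deg g) (mdeg deg W) (e g) (em W))"
      unfolding eW s[symmetric]
      by (rule E.mult_left_commute[OF e_closed[OF g] e_closed[OF h] em_closed[OF W]])
    also have "\<dots> = (if add_mset g (add_mset h W) \<in> mons then mon_sign deg {#g#} (add_mset h W) \<odot>\<^bsub>grade E ?k\<^esub> em (add_mset g (add_mset h W))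
     else \<zero>\<^bsub>grade E ?k\<^esub>)"
    proof (cases "add_mset g W \<in> mons")
      case True
      then have m: "add_mset h (add_mset g W) \<in> mons" using iff by (simp add: add_mset_commute)
      have *: "\<forall>x\<in>#add_mset g W. h \<le> x" using 3 min by auto
      have c: "em (add_mset g W) \<in> elts E (deg g + mdeg deg W)" using em_closed[OF True] by simp
      have ce: "cmult E (deg h) (deg g + mdeg deg W) (e h) (em (add_mset g W)) = em (add_mset g (add_mset h W))"
        using evmon_minimal[OF *, of deg E e] by (simp add: add_mset_commute)
      have c2: "em (add_mset g (add_mset h W)) \<in> elts E ?k"
        using em_closed[OF m] by (simp add: add_mset_commute algebra_simps)
      have "cmult E (deg h) (deg g + mdeg deg W) (e h) (cmult E (deg g) (mdeg deg W) (e g) (em W)) =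
        mon_sign deg {#g#} W \<odot>\<^bsub>grade E (deg h + (deg g + mdeg deg W))\<^esub> em (add_mset g (add_mset h W))"
        unfolding IH using True E.mult_smult_right[OF e_closed[OF h] c] ce by simp
      moreover have "deg h + (deg g + mdeg deg W) = ?k" by simp
      ultimately show ?thesis using True iff c2 E.smult_smult[OF c2]
        by (simp add: mon_sign_add_mset(2)[of deg "{#g#}" h W])
    next
      case False
      then show ?thesis unfolding IH using iff E.mult_zero_right[OF e_closed[OF h], of "deg g + mdeg deg W"]
        by (simp add: add.left_commute)
    qed
    finally show ?thesis .
  qed
  then show ?case by simp
qed

lemma em_mult:
  assumes "M \<in> mons" and N: "N \<in> mons"
  shows "cmult E (mdeg deg M) (mdeg deg N) (em M) (em N) =
    (if M + N \<in> mons then mon_sign deg M N \<odot>\<^bsub>grade E (mdeg deg M + mdeg deg N)\<^esub> em (M + N)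
     else \<zero>\<^bsub>grade E (mdeg deg M + mdeg deg N)\<^esub>)"
  using assms(1)
proof (induction M rule: multiset_induct_min)
  case empty
  then show ?case using N E.unit_left[OF em_closed[OF N]] em_closed[OF N] by simp
next
  case (add h M)
  have h: "h \<in> G" and M: "M \<in> mons" using add.prems by (auto simp: mons_add_mset)
  have min: "\<forall>x\<in>#M. h \<le> x" using add.hyps by auto
  let ?k = "deg h + (mdeg deg M + mdeg deg N)"
  have IH: "cmult E (mdeg deg M) (mdeg deg N) (em M) (em N) =
    (if M + N \<in> mons then mon_sign deg M N \<odot>\<^bsub>grade E (mdeg deg M + mdeg deg N)\<^esub> em (M + N)
     else \<zero>\<^bsub>grade E (mdeg deg M + mdeg deg N)\<^esub>)"
    by (rule add.IH[OF M])
  have "cmult E (deg h + mdeg deg M) (mdeg deg N) (em (add_mset h M)) (em N) =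
    cmult E (deg h) (mdeg deg M + mdeg deg N) (e h) (cmult E (mdeg deg M) (mdeg deg N) (em M) (em N))"
    unfolding evmon_minimal[OF min] by (rule E.mult_assoc[OF e_closed[OF h] em_closed[OF M] em_closed[OF N]])
  also have "\<dots> = (if add_mset h (M + N) \<in> mons then mon_sign deg (add_mset h M) N \<odot>\<^bsub>grade E ?k\<^esub> em (add_mset h (M + N))
     else \<zero>\<^bsub>grade E ?k\<^esub>)"
  proof (cases "M + N \<in> mons")
    case True
    have c: "em (M + N) \<in> elts E (mdeg deg M + mdeg deg N)" using em_closed[OF True] by simp
    have "cmult E (deg h) (mdeg deg M + mdeg deg N) (e h) (cmult E (mdeg deg M) (mdeg deg N) (em M) (em N)) =
      mon_sign deg M N \<odot>\<^bsub>grade E ?k\<^esub> cmult E (deg h) (mdeg deg (M + N)) (e h) (em (M + N))"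
      unfolding IH using True E.mult_smult_right[OF e_closed[OF h] c] by simp
    also have "\<dots> = (if add_mset h (M + N) \<in> mons then mon_sign deg (add_mset h M) N \<odot>\<^bsub>grade E ?k\<^esub> em (add_mset h (M + N))
     else \<zero>\<^bsub>grade E ?k\<^esub>)"
    proof (cases "add_mset h (M + N) \<in> mons")
      case True': True
      have "mon_sign deg {#h#} (M + N) = mon_sign deg {#h#} N"
        using mon_sign_minimal[OF min] by (simp add: mon_sign_add_right)
      moreover have "em (add_mset h (M + N)) \<in> elts E ?k" using em_closed[OF True'] by simp
      ultimately show ?thesis unfolding em_insert[OF h True]
        using True' by (simp add: E.smult_smult mon_sign_add_mset(1)[of deg h M N] mult.commute)
    next
      case False
      then show ?thesis unfolding em_insert[OF h True] by simp
    qed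
    finally show ?thesis .
  next
    case False
    then have "add_mset h (M + N) \<notin> mons" by (auto simp: mons_add_mset)
    then show ?thesis unfolding IH using False E.mult_zero_right[OF e_closed[OF h]] by simp
  qed
  finally show ?case by (simp add: add.assoc)
qed

abbreviation "eval \<equiv> ev deg E e"

lemma eval_eq:
  assumes "finite S" "{K. f K \<noteq> 0} \<subseteq> S" "\<And>K. K \<in> S \<Longrightarrow> K \<in> mons \<and> mdeg deg K = k"
  shows "eval k f = (\<Oplus>\<^bsub>grade E k\<^esub>K\<in>S. f K \<odot>\<^bsub>grade E k\<^esub> em K)"
proof -
  have em: "em K \<in> elts E k" if "K \<in> S" for K using em_closed assms(3)[OF that] by metis
  show ?thesis unfolding ev_def
  proof (rule E.M.add.finprod_mono_neutral_cong_left[OF assms(1,2)])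
    fix K assume "K \<in> S - {K. f K \<noteq> 0}"
    then show "f K \<odot>\<^bsub>grade E k\<^esub> em K = \<zero>\<^bsub>grade E k\<^esub>" using em by simp
  qed (use em in auto)
qed

lemma eval_zero: "eval k 0 = \<zero>\<^bsub>grade E k\<^esub>"
  by (simp add: ev_def)

lemma homog_term: "f \<in> homog k \<Longrightarrow> K \<in> {K. f K \<noteq> 0} \<Longrightarrow> K \<in> mons \<and> mdeg deg K = k"
  by (auto simp: homog_def)

lemma eval_closed: assumes f: "f \<in> homog k" shows "eval k f \<in> elts E k"
proof -
  have "em K \<in> elts E k" if "f K \<noteq> 0" for K using em_closed homog_term[OF f] that by auto
  then show ?thesis unfolding ev_def by (auto intro!: E.M.finsum_closed)
qed

lemma eval_add:
  assumes f: "f \<in> homog k" and g: "g \<in> homog k"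
  shows "eval k (f + g) = eval k f \<oplus>\<^bsub>grade E k\<^esub> eval k g"
proof -
  let ?S = "{K. f K \<noteq> 0} \<union> {K. g K \<noteq> 0}"
  have S: "finite ?S" "\<And>K. K \<in> ?S \<Longrightarrow> K \<in> mons \<and> mdeg deg K = k"
    using homogD[OF f] homogD[OF g] by auto
  have em: "em K \<in> elts E k" if "K \<in> ?S" for K using em_closed S(2)[OF that] by metis
  have "eval k (f + g) = (\<Oplus>\<^bsub>grade E k\<^esub>K\<in>?S. (f + g) K \<odot>\<^bsub>grade E k\<^esub> em K)"
    by (rule eval_eq) (use S in auto)
  also have "\<dots> = (\<Oplus>\<^bsub>grade E k\<^esub>K\<in>?S. f K \<odot>\<^bsub>grade E k\<^esub> em K \<oplus>\<^bsub>grade E k\<^esub> g K \<odot>\<^bsub>grade E k\<^esub> em K)"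
    by (rule E.M.finsum_cong') (use em in \<open>auto simp: E.smult_add\<close>)
  also have "\<dots> = (\<Oplus>\<^bsub>grade E k\<^esub>K\<in>?S. f K \<odot>\<^bsub>grade E k\<^esub> em K) \<oplus>\<^bsub>grade E k\<^esub> (\<Oplus>\<^bsub>grade E k\<^esub>K\<in>?S. g K \<odot>\<^bsub>grade E k\<^esub> em K)"
    by (rule E.M.finsum_addf) (use em in auto)
  also have "(\<Oplus>\<^bsub>grade E k\<^esub>K\<in>?S. f K \<odot>\<^bsub>grade E k\<^esub> em K) = eval k f"
    by (rule eval_eq[symmetric]) (use S in auto)
  also have "(\<Oplus>\<^bsub>grade E k\<^esub>K\<in>?S. g K \<odot>\<^bsub>grade E k\<^esub> em K) = eval k g"
    by (rule eval_eq[symmetric]) (use S in auto)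
  finally show ?thesis .
qed

lemma eval_pmono: "K \<in> mons \<Longrightarrow> mdeg deg K = k \<Longrightarrow> eval k (pmono K) = em K"
  using eval_eq[of "{K}" "pmono K" k] em_closed[of K] by (auto simp: E.M.finsum_insert)

lemma eval_scal:
  assumes f: "f \<in> homog k"
  shows "eval k (c \<cdot> f) = c \<odot>\<^bsub>grade E k\<^esub> eval k f"
proof -
  let ?S = "{K. f K \<noteq> 0}"
  have em: "em K \<in> elts E k" if "K \<in> ?S" for K using em_closed homog_term[OF f that] by metis
  have "eval k (c \<cdot> f) = (\<Oplus>\<^bsub>grade E k\<^esub>K\<in>?S. (c \<cdot> f) K \<odot>\<^bsub>grade E k\<^esub> em K)"
    by (rule eval_eq) (use homogD[OF f] in auto)
  also have "\<dots> = (\<Oplus>\<^bsub>grade E k\<^esub>K\<in>?S. c \<odot>\<^bsub>grade E k\<^esub> (f K \<odot>\<^bsub>grade E k\<^esub> em K))"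
    by (rule E.M.finsum_cong') (use em in \<open>auto simp: E.smult_smult\<close>)
  also have "\<dots> = c \<odot>\<^bsub>grade E k\<^esub> eval k f"
    unfolding ev_def
    by (rule linear_between_finsum[OF _ E.mod E.mod, symmetric])
      (use em homogD(1)[OF f] in \<open>auto simp: linear_between_def E.smult_plus E.smult_smult mult.commute\<close>)
  finally show ?thesis .
qed

lemma eval_lin:
  assumes "f \<in> homog k" "K \<in> mons" "mdeg deg K = k"
  shows "eval k (c \<cdot> pmono K + f) = c \<odot>\<^bsub>grade E k\<^esub> em K \<oplus>\<^bsub>grade E k\<^esub> eval k f"
  using assms by (simp add: eval_add homog_scal homog_pmono eval_scal eval_pmono)

lemma mult_plus_left: "x \<in> elts E k \<Longrightarrow> x' \<in> elts E k \<Longrightarrow> y \<in> elts E l \<Longrightarrow>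
  cmult E k l (x \<oplus>\<^bsub>grade E k\<^esub> x') y = cmult E k l x y \<oplus>\<^bsub>grade E (k + l)\<^esub> cmult E k l x' y"
  using E.mult_linear_left[of y l k] by (auto simp: linear_between_def)

lemma mult_plus_right: "x \<in> elts E k \<Longrightarrow> y \<in> elts E l \<Longrightarrow> y' \<in> elts E l \<Longrightarrow>
  cmult E k l x (y \<oplus>\<^bsub>grade E l\<^esub> y') = cmult E k l x y \<oplus>\<^bsub>grade E (k + l)\<^esub> cmult E k l x y'"
  using E.mult_linear_right[of x k l] by (auto simp: linear_between_def)

lemma eval_mul:
  assumes f: "f \<in> homog k" and g: "g \<in> homog l"
  shows "eval (k + l) (f \<star> g) = cmult E k l (eval k f) (eval l g)"
proof -
  have *: "eval (k + l) (pmono M \<star> g) = cmult E k l (em M) (eval l g)"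
    if M: "M \<in> mons" "mdeg deg M = k" for M
    using g
  proof (induction g rule: homog_induct)
    case zero
    have "eval (k + l) (pmono M \<star> 0) = cmult E k l (em M) (eval l 0)"
      using E.mult_zero_right[of "em M" k l] em_closed[OF M(1)] M(2) by (simp add: eval_zero)
    then show ?case .
  next
    case (add c N g)
    have cl: "em M \<in> elts E k" "em N \<in> elts E l" "eval l g \<in> elts E l"
      using em_closed[OF M(1)] em_closed[OF add(2)] M add eval_closed by auto
    have IH: "eval (k + l) (pmono M \<star> g) = cmult E k l (em M) (eval l g)" by (rule add.IH)
    have mm: "eval (k + l) (pmono M \<star> pmono N) = cmult E k l (em M) (em N)"
      unfolding mul_pmono using em_mult[OF M(1) add(2)] M add
      by (auto simp: eval_zero eval_scal eval_pmono homog_pmono)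
    have "eval (k + l) (pmono M \<star> (c \<cdot> pmono N + g)) =
      c \<odot>\<^bsub>grade E (k + l)\<^esub> eval (k + l) (pmono M \<star> pmono N) \<oplus>\<^bsub>grade E (k + l)\<^esub> eval (k + l) (pmono M \<star> g)"
    proof -
      have "pmono M \<star> pmono N \<in> homog (k + l)" "pmono M \<star> g \<in> homog (k + l)"
        using M add by (auto intro!: homog_mul homog_pmono)
      then show ?thesis unfolding mul_add mul_scal by (simp only: eval_add eval_scal homog_scal)
    qed
    also have "\<dots> = cmult E k l (em M) (c \<odot>\<^bsub>grade E l\<^esub> em N \<oplus>\<^bsub>grade E l\<^esub> eval l g)"
      unfolding IH mm using cl by (simp add: mult_plus_right E.mult_smult_right)
    also have "\<dots> = cmult E k l (em M) (eval l (c \<cdot> pmono N + g))"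
      using eval_lin add by simp
    finally show ?case .
  qed
  show ?thesis using f
  proof (induction f rule: homog_induct)
    case zero
    have "eval (k + l) (0 \<star> g) = cmult E k l (eval k 0) (eval l g)"
      using E.mult_zero_left[of "eval l g" l k] eval_closed[OF g] by (simp add: eval_zero)
    then show ?case .
  next
    case (add c M f)
    have cl: "em M \<in> elts E k" "eval k f \<in> elts E k" "eval l g \<in> elts E l"
      using em_closed[OF add(2)] add eval_closed g by auto
    have IH: "eval (k + l) (f \<star> g) = cmult E k l (eval k f) (eval l g)" by (rule add.IH)
    have "eval (k + l) ((c \<cdot> pmono M + f) \<star> g) =
      c \<odot>\<^bsub>grade E (k + l)\<^esub> eval (k + l) (pmono M \<star> g) \<oplus>\<^bsub>grade E (k + l)\<^esub> eval (k + l) (f \<star> g)"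
    proof -
      have "pmono M \<star> g \<in> homog (k + l)" "f \<star> g \<in> homog (k + l)"
        using g add by (auto intro!: homog_mul homog_pmono)
      then show ?thesis unfolding mul_add mul_scal by (simp only: eval_add eval_scal homog_scal)
    qed
    also have "\<dots> = cmult E k l (c \<odot>\<^bsub>grade E k\<^esub> em M \<oplus>\<^bsub>grade E k\<^esub> eval k f) (eval l g)"
      unfolding IH *[OF add(2,3)] using cl by (simp add: mult_plus_left E.mult_smult_left)
    also have "\<dots> = cmult E k l (eval k (c \<cdot> pmono M + f)) (eval l g)"
      using eval_lin add by simp
    finally show ?case .
  qed
qed

lemma eval_pvar: "g \<in> G \<Longrightarrow> eval (deg g) (pvar g) = e g"
proof -
  assume g: "g \<in> G"
  have "em {#g#} = cmult E (deg g) 0 (e g) (cunit E)"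
    using evmon_minimal[of "{#}" g deg E e] by simp
  also have "\<dots> = cmult E 0 (deg g) (cunit E) (e g)"
    unfolding E.mult_commute[OF e_closed[OF g] E.unit_closed]
    using E.mult_closed[OF E.unit_closed e_closed[OF g]] by simp
  also have "\<dots> = e g" by (rule E.unit_left[OF e_closed[OF g]])
  finally have "e g = em {#g#}" by simp
  then show ?thesis using eval_pmono[of "{#g#}"] g by simp
qed

end

locale cdga_evaluation = evaluation deg G E e + free_derivation deg G \<delta>
  for deg :: "'g::linorder \<Rightarrow> int" and G and E :: "'b cdga" and e \<delta> +
  assumes e_diff: "g \<in> G \<Longrightarrow> cdiff E (deg g) (e g) = eval (deg g - 1) (\<delta> g)"
begin

lemma diff_em: "K \<in> mons \<Longrightarrow> cdiff E (mdeg deg K) (em K) = eval (mdeg deg K - 1) (dm K)"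
proof (induction K rule: multiset_induct_min)
  case empty
  have u: "cunit E \<in> elts E 0" by simp
  \<comment> \<open>That the unit is a cycle is not among the axioms. The Leibniz rule for
    \<open>1 = 1 * 1\<close> gives \<open>d 1 = d 1 + d 1\<close>, hence
    \<open>d 1 = 0\<close>.\<close>
  have "cdiff E (0 + 0) (cmult E 0 0 (cunit E) (cunit E)) =
    cmult E (0 - 1) 0 (cdiff E 0 (cunit E)) (cunit E) \<oplus>\<^bsub>grade E (0 + 0 - 1)\<^esub>
      ((-1) powi 0) \<odot>\<^bsub>grade E (0 + 0 - 1)\<^esub> cmult E 0 (0 - 1) (cunit E) (cdiff E 0 (cunit E))"
    by (rule E.leibniz[OF u u])
  moreover have "cdiff E 0 (cunit E) \<in> elts E (-1)" using E.diff_closed[OF u] by simp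
  moreover have "cmult E (-1) 0 (cdiff E 0 (cunit E)) (cunit E) = cdiff E 0 (cunit E)"
    unfolding E.mult_commute[OF calculation(2) u] using E.unit_left[OF calculation(2)] calculation(2) by simp
  ultimately have "cdiff E 0 (cunit E) = cdiff E 0 (cunit E) \<oplus>\<^bsub>grade E (-1)\<^esub> cdiff E 0 (cunit E)"
    and "cdiff E 0 (cunit E) \<in> elts E (-1)"
    by (simp_all add: E.unit_left)
  then have "cdiff E 0 (cunit E) = \<zero>\<^bsub>grade E (-1)\<^esub>"
    by (metis E.M.add.r_cancel_one')
  then have "cdiff E (mdeg deg {#}) (em {#}) = eval (mdeg deg {#} - 1) (dm {#})"
    by (simp add: eval_zero)
  then show ?case .
next
  case (add h K)
  have K: "K \<in> mons" and h: "h \<in> G" using add.prems by (auto simp: mons_add_mset)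
  have min: "\<forall>x\<in>#K. h \<le> x" using add.hyps by auto
  let ?k = "deg h + mdeg deg K"
  have IH: "cdiff E (mdeg deg K) (em K) = eval (mdeg deg K - 1) (dm K)" by (rule add.IH[OF K])
  have 1: "eval (?k - 1) (\<delta> h \<star> pmono K) = cmult E (deg h - 1) (mdeg deg K) (eval (deg h - 1) (\<delta> h)) (em K)"
    using eval_mul[OF delta_homog[OF h] homog_pmono[OF K refl]] eval_pmono[OF K refl]
    by (simp add: algebra_simps)
  have 2: "eval (?k - 1) (pvar h \<star> dm K) = cmult E (deg h) (mdeg deg K - 1) (e h) (eval (mdeg deg K - 1) (dm K))"
    using eval_mul[OF homog_pvar[OF h] dm_homog[OF K]] eval_pvar[OF h] by (simp add: algebra_simps)
  have "cdiff E ?k (em (add_mset h K)) =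
     cmult E (deg h - 1) (mdeg deg K) (cdiff E (deg h) (e h)) (em K) \<oplus>\<^bsub>grade E (?k - 1)\<^esub>
     ((-1) powi (deg h)) \<odot>\<^bsub>grade E (?k - 1)\<^esub> cmult E (deg h) (mdeg deg K - 1) (e h) (cdiff E (mdeg deg K) (em K))"
    unfolding evmon_minimal[OF min] by (rule E.leibniz[OF e_closed[OF h] em_closed[OF K]])
  also have "\<dots> = eval (?k - 1) (\<delta> h \<star> pmono K) \<oplus>\<^bsub>grade E (?k - 1)\<^esub>
     ((-1) powi (deg h)) \<odot>\<^bsub>grade E (?k - 1)\<^esub> eval (?k - 1) (pvar h \<star> dm K)"
    unfolding 1 2 IH e_diff[OF h] ..
  also have "\<dots> = eval (?k - 1) (dm (add_mset h K))"
  proof -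
    have h1: "\<delta> h \<star> pmono K \<in> homog (?k - 1)"
      by (rule homog_mul'[OF delta_homog[OF h] homog_pmono[OF K refl]]) simp
    have h2: "pvar h \<star> dm K \<in> homog (?k - 1)"
      by (rule homog_mul'[OF homog_pvar[OF h] dm_homog[OF K]]) simp
    show ?thesis unfolding prepend_minimal(2)[OF min add.prems]
      by (simp only: eval_add[OF h1 homog_scal[OF h2]] eval_scal[OF h2])
  qed
  finally show ?case by simp
qed

lemma diff_eval: assumes "f \<in> homog k" shows "eval (k - 1) (D f) = cdiff E k (eval k f)"
  using assms
proof (induction f rule: homog_induct)
  case zero
  have "eval (k - 1) (D 0) = cdiff E k (eval k 0)"
    using linear_between_zero[OF E.diff_linear E.mod E.mod, of k] by (simp add: eval_zero)
  then show ?case .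
next
  case (add c K f)
  have cl: "em K \<in> elts E k" "eval k f \<in> elts E k"
    using em_closed[OF add(2)] add eval_closed by auto
  have IH: "eval (k - 1) (D f) = cdiff E k (eval k f)" by (rule add.IH)
  have dK: "dm K \<in> homog (k - 1)" using dm_homog[OF add(2)] add(3) by simp
  have "D (c \<cdot> pmono K + f) = c \<cdot> dm K + D f"
    using add by (subst D_add_homog[of _ k _ k]) (auto intro!: homog_scal homog_pmono simp: D_scal)
  then have "eval (k - 1) (D (c \<cdot> pmono K + f)) = c \<odot>\<^bsub>grade E (k - 1)\<^esub> eval (k - 1) (dm K) \<oplus>\<^bsub>grade E (k - 1)\<^esub> eval (k - 1) (D f)"
    using dK D_homog[OF add(1)] by (simp add: eval_add homog_scal eval_scal)
  also have "\<dots> = cdiff E k (c \<odot>\<^bsub>grade E k\<^esub> em K \<oplus>\<^bsub>grade E k\<^esub> eval k f)"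
    unfolding IH using diff_em[OF add(2)] add(3) cl E.diff_linear[of k]
    by (auto simp: linear_between_def E.diff_plus)
  also have "\<dots> = cdiff E k (eval k (c \<cdot> pmono K + f))"
    using eval_lin add by simp
  finally show ?case .
qed

lemma eval_hom:
  "(\<lambda>k. restrict (eval k) (elts (free_cdga deg G \<delta>) k)) \<in> cdga_hom (free_cdga deg G \<delta>) E"
  unfolding cdga_hom_def linear_between_def
  using eval_pmono[of "{#}" 0]
  by (auto simp: eval_closed eval_add eval_scal eval_mul diff_eval homog_add homog_scal homog_mul D_homog homog_pmono)

end

lemma evmon_natural:
  assumes "evaluation deg G E e" "is_cdga F" and p: "p \<in> cdga_hom E F" and "K \<in> monomials deg G"
  shows "p (mdeg deg K) (evmon deg E e K) = evmon deg F (\<lambda>g. p (deg g) (e g)) K"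
proof -
  interpret evaluation deg G E e by fact
  show ?thesis using assms(4)
  proof (induction K rule: multiset_induct_min)
    case empty
    then show ?case using cdga_homD(6)[OF p] by simp
  next
    case (add h K)
    have K: "K \<in> mons" and h: "h \<in> G" using add.prems by (auto simp: mons_add_mset)
    have min: "\<forall>x\<in>#K. h \<le> x" using add.hyps by auto
    show ?case
      using cdga_homD(7)[OF p e_closed[OF h] em_closed[OF K]] add.IH[OF K]
      by (simp add: evmon_minimal[OF min])
  qed
qed

lemma ev_natural:
  assumes "evaluation deg G E e" "is_cdga F" and p: "p \<in> cdga_hom E F"
    and f: "f \<in> graded_gens.homog deg G k"
  shows "p k (ev deg E e k f) = ev deg F (\<lambda>g. p (deg g) (e g)) k f"
proof -
  interpret evaluation deg G E e by fact
  interpret F: cdga F by unfold_locales fact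
  have em: "em K \<in> elts E k" "p k (em K) = evmon deg F (\<lambda>g. p (deg g) (e g)) K" if "f K \<noteq> 0" for K
    using em_closed homog_term[OF f] evmon_natural[OF assms(1-3)] that by auto
  show ?thesis unfolding ev_def
    using em homogD(1)[OF f] cdga_homD(5)[OF p] cdga_homD(3)[OF p]
    by (subst linear_between_finsum[OF cdga_homD(2)[OF p] E.mod F.mod])
      (auto intro!: F.M.finsum_cong' simp flip: em(2))
qed

lemma ev_cong:
  assumes "\<And>g. g \<in> G \<Longrightarrow> e g = e' g" "f \<in> graded_gens.homog deg G k" "is_cdga E" "\<And>g. g \<in> G \<Longrightarrow> e g \<in> elts E (deg g)"
  shows "ev deg E e k f = ev deg E e' k f"
proof -
  interpret evaluation deg G E e
    using assms by (auto intro!: evaluation.intro simp: cdga_def evaluation_axioms_def)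
  have "evmon deg E e K = evmon deg E e' K" if "K \<in> mons" for K
    using that
  proof (induction K rule: multiset_induct_min)
    case (add h K)
    have K: "K \<in> mons" and h: "h \<in> G" using add.prems by (auto simp: mons_add_mset)
    have min: "\<forall>x\<in>#K. h \<le> x" using add.hyps by auto
    show ?case using add.IH[OF K] assms(1)[OF h] by (simp add: evmon_minimal[OF min])
  qed simp
  moreover have "evmon deg E e K \<in> elts E k" if "f K \<noteq> 0" for K
    using em_closed homog_term[OF assms(2)] that by auto
  ultimately show ?thesis unfolding ev_def
    using homog_term[OF assms(2)] by (intro E.M.finsum_cong') auto
qed

text \<open>The uniqueness half of the universal property: sorted monomials are products of
  generators, and a morphism respects products and linear combinations.\<close>

lemma hom_eq_ev:
  assumes "free_derivation deg G \<delta>" "is_cdga F" and g: "g \<in> cdga_hom (free_cdga deg G \<delta>) F"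
    and "is_cdga (free_cdga deg G \<delta>)" and f: "f \<in> graded_gens.homog deg G k"
  shows "g k f = ev deg F (\<lambda>x. g (deg x) (pvar x)) k f"
proof -
  interpret free_derivation deg G \<delta> by fact
  interpret evaluation deg G F "\<lambda>x. g (deg x) (pvar x)"
    by unfold_locales (use assms(2) cdga_homD(3)[OF g] homog_pvar in auto)
  have *: "g (mdeg deg K) (pmono K) = em K" if "K \<in> mons" for K
    using that
  proof (induction K rule: multiset_induct_min)
    case empty
    then show ?case using cdga_homD(6)[OF g] by simp
  next
    case (add h K)
    have K: "K \<in> mons" and h: "h \<in> G" using add.prems by (auto simp: mons_add_mset)
    have min: "\<forall>x\<in>#K. h \<le> x" using add.hyps by auto
    show ?case
      using cdga_homD(7)[OF g, of "pvar h" "deg h" "pmono K" "mdeg deg K"] add.IH[OF K] h K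
      by (simp add: evmon_minimal[OF min] prepend_minimal(1)[OF min add.prems] homog_pvar homog_pmono)
  qed
  show ?thesis using f
  proof (induction f rule: homog_induct)
    case zero
    have "g k 0 = eval k 0" using cdga_hom_zero[OF assms(4,2) g, of k] by (simp add: eval_zero)
    then show ?case .
  next
    case (add c K f)
    have IH: "g k f = eval k f" by (rule add.IH)
    have "g k (c \<cdot> pmono K + f) = c \<odot>\<^bsub>grade F k\<^esub> g k (pmono K) \<oplus>\<^bsub>grade F k\<^esub> g k f"
      using cdga_homD(4)[OF g, of "c \<cdot> pmono K" k f] cdga_homD(5)[OF g, of "pmono K" k c] add
      by (simp add: homog_scal homog_pmono)
    also have "\<dots> = eval k (c \<cdot> pmono K + f)"
      unfolding IH eval_lin[OF add(1-3)] using *[OF add(2)] add(3) by simp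
    finally show ?case .
  qed
qed

subsection \<open>Lifting against trivial fibrations\<close>

text \<open>By \<open>dB_supp\<close> these initial segments generate subalgebras stable under the
  differential. One predicate covers the whole algebra, the stages of the tower, and the part
  already treated when \<open>x_n\<close> is lifted.\<close>

definition lower_gens :: "nat set \<Rightarrow> bool" where
  "lower_gens H \<longleftrightarrow> H \<subseteq> {2..} \<and> (\<forall>n\<in>H. {2..<n} \<subseteq> H)"

lemma lower_gens_intervals [simp]: "lower_gens {2..}" "lower_gens {2..n}" "lower_gens {2..<n}"
  by (auto simp: lower_gens_def)

abbreviation free_B :: "int \<Rightarrow> nat set \<Rightarrow> (nat multiset \<Rightarrow> rat) cdga" where
  "free_B m H \<equiv> free_cdga (degB m) H (dB m)"

lemma free_derivation_B: assumes "lower_gens H" shows "free_derivation (degB m) H (dB m)"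
proof
  fix g assume g: "g \<in> H"
  have H: "H \<subseteq> {2..}" using assms by (simp add: lower_gens_def)
  have "set_mset K \<subseteq> H" if "dB m g K \<noteq> 0" for K
    using dB_supp[OF that] assms g unfolding lower_gens_def by fastforce
  then show "dB m g \<in> graded_gens.homog (degB m) H (degB m g - 1)"
    unfolding B.homog_subset[OF H] using dB_homog[of g m] g H by auto
qed

lemma is_cdga_free_B: assumes "lower_gens H" shows "is_cdga (free_B m H)"
proof -
  interpret H: free_derivation "degB m" H "dB m" by (rule free_derivation_B[OF assms])
  have H: "H \<subseteq> {2..}" using assms by (simp add: lower_gens_def)
  show ?thesis
  proof (rule H.is_cdga_free)
    fix g assume g: "g \<in> H"
    have "H.D (dB m g) = B.D m (dB m g)"
      by (rule B.D_subset[OF H H.free_derivation_axioms H.delta_homog[OF g]])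
    then show "H.D (dB m g) = 0" using D_dB[of g m] g H by auto
  qed
qed

lemma D_pvar_B: assumes "lower_gens H" "n \<in> H" shows "cdiff (free_B m H) k (pvar n) = dB m n"
proof -
  interpret H: free_derivation "degB m" H "dB m" by (rule free_derivation_B[OF assms(1)])
  have "pmul (degB m) H (dB m n) (pmono {#}) = dB m n"
    using H.mul_commute[OF H.delta_homog[OF assms(2)] H.homog_pmono[OF H.mons_empty refl]]
      H.mul_unit_left[OF H.homogD(2)[OF H.delta_homog[OF assms(2)]]] by simp
  then show ?thesis using H.prepend_minimal(2)[of "{#}" n] assms(2) by simp
qed

lemma dB_lower: "n \<ge> 2 \<Longrightarrow> dB m n \<in> graded_gens.homog (degB m) {2..<n} (degB m n - 1)"
proof -
  assume n: "n \<ge> 2"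
  have "set_mset K \<subseteq> {2..<n}" if "dB m n K \<noteq> 0" for K
    using dB_supp[OF that] by fastforce
  moreover have "{2..<n} \<subseteq> {2..}" by auto
  ultimately show ?thesis using B.homog_subset[of "{2..<n}" "dB m n" m] dB_homog[of n m] n by auto
qed

text \<open>The common core of both cofibrancy proofs. The lift of \<open>x_n\<close> is chosen in
  \<open>E n\<close>, the stage where \<open>x_n\<close> first appears, and \<open>T\<close> carries
  it to later stages. A constant tower gives lifts for a single algebra, the general case gives
  lifts of diagrams. The choice is recursive because \<open>dB m n\<close> involves only generators
  of smaller index.\<close>

lemma lifting_generators:
  fixes E F :: "nat \<Rightarrow> 'b cdga" and m :: int
  assumes E: "\<And>n. is_cdga (E n)" and F: "\<And>n. is_cdga (F n)"
    and T: "\<And>i j. i \<le> j \<Longrightarrow> T i j \<in> cdga_hom (E i) (E j)"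
    and TT: "\<And>i j k l x. i \<le> j \<Longrightarrow> j \<le> k \<Longrightarrow> x \<in> elts (E i) l \<Longrightarrow> T j k l (T i j l x) = T i k l x"
    and p: "\<And>n. fibration (E n) (F n) (p n)" "\<And>n. quasi_iso (E n) (F n) (p n)"
    and pT: "\<And>i j l x. i \<le> j \<Longrightarrow> x \<in> elts (E i) l \<Longrightarrow> p j l (T i j l x) = S i j l (p i l x)"
    and y: "\<And>n. 2 \<le> n \<Longrightarrow> y n \<in> elts (F n) (degB m n)"
    and Sy: "\<And>i j. 2 \<le> i \<Longrightarrow> i \<le> j \<Longrightarrow> S i j (degB m i) (y i) \<in> elts (F j) (degB m i)"
    and dy: "\<And>n. 2 \<le> n \<Longrightarrow> cdiff (F n) (degB m n) (y n) =
        ev (degB m) (F n) (\<lambda>q. S q n (degB m q) (y q)) (degB m n - 1) (dB m n)"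
  obtains e where "\<And>n. 2 \<le> n \<Longrightarrow> e n \<in> elts (E n) (degB m n)"
    and "\<And>n. 2 \<le> n \<Longrightarrow> cdiff (E n) (degB m n) (e n) =
        ev (degB m) (E n) (\<lambda>q. T q n (degB m q) (e q)) (degB m n - 1) (dB m n)"
    and "\<And>n. 2 \<le> n \<Longrightarrow> p n (degB m n) (e n) = y n"
proof -
  let ?d = "degB m"
  \<comment> \<open>Values at indices from \<open>n\<close> on are replaced by
    \<open>undefined\<close>, so that \<open>P e n\<close> depends only on earlier choices, as
    \<open>dependent_wellorder_choice\<close> demands.\<close>
  define c where "c e n = (\<lambda>q. if q < n then T q n (?d q) (e q) else undefined)" for e :: "nat \<Rightarrow> 'b" and n
  define P where "P e n r \<longleftrightarrow> (2 \<le> n \<longrightarrow> r \<in> elts (E n) (?d n) \<and>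
      cdiff (E n) (?d n) r = ev ?d (E n) (c e n) (?d n - 1) (dB m n) \<and> p n (?d n) r = y n)"
    for e :: "nat \<Rightarrow> 'b" and n r
  have "\<exists>e. \<forall>n. P e n (e n)"
  proof (rule dependent_wellorder_choice)
    fix r :: 'b and f g :: "nat \<Rightarrow> 'b" and n :: nat assume "\<And>q. q < n \<Longrightarrow> f q = g q"
    then have "c f n = c g n" by (auto simp: c_def)
    then show "P f n r = P g n r" by (simp add: P_def)
  next
    fix n e assume IH: "\<And>q. q < n \<Longrightarrow> P e q (e q)"
    show "\<exists>r. P e n r"
    proof (cases "2 \<le> n")
      case True
      have ph: "p n \<in> cdga_hom (E n) (F n)" using p(1)[of n] by (simp add: fibration_def)
      have e: "e q \<in> elts (E q) (?d q)" "cdiff (E q) (?d q) (e q) = ev ?d (E q) (c e q) (?d q - 1) (dB m q)"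
        "p q (?d q) (e q) = y q" if "q \<in> {2..<n}" for q
        using IH[of q] that by (auto simp: P_def)
      have cl: "c e j q \<in> elts (E j) (?d q)" if "q \<in> {2..<j}" "j \<le> n" for q j
        using that cdga_homD(3)[OF T e(1)[of q]] by (auto simp: c_def)
      have evl: "evaluation ?d {2..<j} (E j) (c e j)" if "j \<le> n" for j
        using that cl E by (auto intro!: evaluation.intro simp: cdga_def evaluation_axioms_def)
      interpret free_derivation ?d "{2..<n}" "dB m" by (rule free_derivation_B) simp
      interpret En: evaluation ?d "{2..<n}" "E n" "c e n" by (rule evl) simp
      \<comment> \<open>The lifts chosen so far define a morphism from the subalgebra on the
        generators below \<open>n\<close> to \<open>E n\<close>: the equation for the differential
        of \<open>e q\<close> holds in \<open>E q\<close> and is carried to \<open>E n\<close> by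
        naturality of evaluation.\<close>
      interpret cdga_evaluation ?d "{2..<n}" "E n" "c e n" "dB m"
      proof unfold_locales
        fix q assume q: "q \<in> {2..<n}"
        have "cdiff (E n) (?d q) (c e n q) = T q n (?d q - 1) (ev ?d (E q) (c e q) (?d q - 1) (dB m q))"
          using cdga_homD(8)[OF T e(1)[OF q]] q e(2)[OF q] by (simp add: c_def)
        also have "\<dots> = ev ?d (E n) (\<lambda>r. T q n (?d r) (c e q r)) (?d q - 1) (dB m q)"
          using q by (intro ev_natural[OF evl E T] dB_lower) auto
        also have "\<dots> = ev ?d (E n) (c e n) (?d q - 1) (dB m q)"
        proof (rule ev_cong[where G="{2..<q}"])
          fix r assume r: "r \<in> {2..<q}"
          then show "T q n (?d r) (c e q r) = c e n r" using q e(1)[of r] by (simp add: c_def TT)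
          show "T q n (?d r) (c e q r) \<in> elts (E n) (?d r)"
            using cdga_homD(3)[OF T cl[OF r]] q by simp
        qed (use q dB_lower E in auto)
        finally show "cdiff (E n) (?d q) (c e n q) = ev ?d (E n) (c e n) (?d q - 1) (dB m q)" .
      qed
      \<comment> \<open>The boundary that the lift of \<open>x_n\<close> must have. It is a cycle
        since d^2 is zero on \<open>x_n\<close>, and \<open>p n\<close> maps it to the differential
        of \<open>y n\<close>; so \<open>trivial_fibration_lift\<close> applies.\<close>
      let ?z = "ev ?d (E n) (c e n) (?d n - 1) (dB m n)"
      have dn: "dB m n \<in> homog (?d n - 1)" by (rule dB_lower[OF True])
      have "D (dB m n) = B.D m (dB m n)"
        by (rule B.D_subset[OF _ free_derivation_axioms dn]) auto
      then have "D (dB m n) = 0" using D_dB[of n m] True by simp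
      then have "cdiff (E n) (?d n - 1) ?z = \<zero>\<^bsub>grade (E n) (?d n - 1 - 1)\<^esub>"
        using diff_eval[OF dn] by (simp only: En.eval_zero)
      then have z: "?z \<in> cycles (E n) (?d n - 1)" using En.eval_closed[OF dn] by (simp add: cycles_def)
      have "p n (?d n - 1) ?z = ev ?d (F n) (\<lambda>q. p n (?d q) (c e n q)) (?d n - 1) (dB m n)"
        by (rule ev_natural[OF evl F ph dn]) simp
      also have "\<dots> = ev ?d (F n) (\<lambda>q. S q n (?d q) (y q)) (?d n - 1) (dB m n)"
      proof (rule ev_cong[where G="{2..<n}", OF _ dn F])
        fix q assume q: "q \<in> {2..<n}"
        then show "p n (?d q) (c e n q) = S q n (?d q) (y q)" using pT e(1,3)[OF q] by (simp add: c_def)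
        then show "p n (?d q) (c e n q) \<in> elts (F n) (?d q)" using Sy q by simp
      qed
      also have "\<dots> = cdiff (F n) (?d n) (y n)" using dy[OF True] by simp
      finally have "cdiff (F n) (?d n) (y n) = p n (?d n - 1) ?z" by simp
      from trivial_fibration_lift[OF E F p z y[OF True] this] show ?thesis
        by (auto simp: P_def)
    qed (simp add: P_def)
  qed
  then obtain e where e: "\<And>n. P e n (e n)" by blast
  show ?thesis
  proof (rule that)
    fix n :: nat assume n: "2 \<le> n"
    show "e n \<in> elts (E n) (?d n)" "p n (?d n) (e n) = y n" using e[of n] n by (auto simp: P_def)
    have "ev ?d (E n) (c e n) (?d n - 1) (dB m n) = ev ?d (E n) (\<lambda>q. T q n (?d q) (e q)) (?d n - 1) (dB m n)"
    proof (rule ev_cong[OF _ dB_lower[OF n] E])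
      fix q assume q: "q \<in> {2..<n}"
      then show "c e n q = T q n (?d q) (e q)" by (simp add: c_def)
      show "c e n q \<in> elts (E n) (?d q)"
        using q cdga_homD(3)[OF T, of q n "e q" "?d q"] e[of q] by (auto simp: c_def P_def)
    qed
    then show "cdiff (E n) (?d n) (e n) = ev ?d (E n) (\<lambda>q. T q n (?d q) (e q)) (?d n - 1) (dB m n)"
      using e[of n] n by (auto simp: P_def)
  qed
qed

text \<open>On stage \<open>n\<close> the lift is evaluation at the chosen lifts of the generators
  up to \<open>n\<close>, pushed forward to \<open>E n\<close>. Compatibility between stages is
  automatic because all stages use the same choices.\<close>

lemma lifting_tower:
  fixes E F :: "nat \<Rightarrow> 'b cdga" and m :: int
  assumes E: "\<And>n. is_cdga (E n)" and F: "\<And>n. is_cdga (F n)"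
    and T: "\<And>i j. i \<le> j \<Longrightarrow> T i j \<in> cdga_hom (E i) (E j)"
    and TT: "\<And>i j k l x. i \<le> j \<Longrightarrow> j \<le> k \<Longrightarrow> x \<in> elts (E i) l \<Longrightarrow> T j k l (T i j l x) = T i k l x"
    and p: "\<And>n. fibration (E n) (F n) (p n)" "\<And>n. quasi_iso (E n) (F n) (p n)"
    and pT: "\<And>i j l x. i \<le> j \<Longrightarrow> x \<in> elts (E i) l \<Longrightarrow> p j l (T i j l x) = S i j l (p i l x)"
    and g: "\<And>n. g n \<in> cdga_hom (free_B m {2..n}) (F n)"
    and Sg: "\<And>i j l x. i \<le> j \<Longrightarrow> x \<in> elts (free_B m {2..i}) l \<Longrightarrow> S i j l (g i l x) = g j l x"
  obtains h where "\<And>n. h n \<in> cdga_hom (free_B m {2..n}) (E n)"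
    and "\<And>i j l x. i \<le> j \<Longrightarrow> x \<in> elts (free_B m {2..i}) l \<Longrightarrow> T i j l (h i l x) = h j l x"
    and "\<And>n l x. x \<in> elts (free_B m {2..n}) l \<Longrightarrow> p n l (h n l x) = g n l x"
proof -
  let ?d = "degB m"
  have pv: "pvar q \<in> elts (free_B m {2..n}) (?d q)" if "q \<in> {2..n}" for q n
    using that by (simp add: graded_gens.elts_free graded_gens.homog_pvar)
  have gel: "g n (?d q) (pvar q) \<in> elts (F n) (?d q)" if "q \<in> {2..n}" for q n
    using cdga_homD(3)[OF g pv[OF that]] .
  have Sgp: "S q n (?d q) (g q (?d q) (pvar q)) = g n (?d q) (pvar q)" if "q \<in> {2..n}" for q n
    using Sg[of q n "pvar q" "?d q"] pv[of q q] that by auto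
  have cd: "is_cdga (free_B m {2..n})" for n by (rule is_cdga_free_B) simp
  have fd: "free_derivation ?d {2..n} (dB m)" for n by (rule free_derivation_B) simp
  have dBn: "dB m n \<in> graded_gens.homog ?d {2..n} (?d n - 1)" if "2 \<le> n" for n
    using free_derivation.delta_homog[OF fd[of n], of n] that by simp
  have gev: "g n k f = ev ?d (F n) (\<lambda>q. S q n (?d q) (g q (?d q) (pvar q))) k f"
    if f: "f \<in> graded_gens.homog ?d {2..n} k" for n k f
  proof -
    have "g n k f = ev ?d (F n) (\<lambda>q. g n (?d q) (pvar q)) k f"
      by (rule hom_eq_ev[OF fd F g cd f])
    also have "\<dots> = ev ?d (F n) (\<lambda>q. S q n (?d q) (g q (?d q) (pvar q))) k f"
      by (rule ev_cong[OF _ f F]) (use Sgp gel in auto)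
    finally show ?thesis .
  qed
  obtain e where e: "\<And>n. 2 \<le> n \<Longrightarrow> e n \<in> elts (E n) (?d n)"
    and de: "\<And>n. 2 \<le> n \<Longrightarrow> cdiff (E n) (?d n) (e n) =
        ev ?d (E n) (\<lambda>q. T q n (?d q) (e q)) (?d n - 1) (dB m n)"
    and pe: "\<And>n. 2 \<le> n \<Longrightarrow> p n (?d n) (e n) = g n (?d n) (pvar n)"
  proof (rule lifting_generators[OF E F T TT p pT, where y="\<lambda>n. g n (degB m n) (pvar n)" and m=m])
    fix n :: nat assume n: "2 \<le> n"
    show "g n (?d n) (pvar n) \<in> elts (F n) (?d n)" using gel[of n n] n by simp
    have "cdiff (F n) (?d n) (g n (?d n) (pvar n)) = g n (?d n - 1) (dB m n)"
      using cdga_homD(8)[OF g pv[of n n]] n D_pvar_B[of "{2..n}" n m] by simp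
    then show "cdiff (F n) (?d n) (g n (?d n) (pvar n)) =
        ev ?d (F n) (\<lambda>q. S q n (?d q) (g q (?d q) (pvar q))) (?d n - 1) (dB m n)"
      using gev[OF dBn[OF n]] by simp
  next
    fix i j :: nat assume "2 \<le> i" "i \<le> j"
    then show "S i j (?d i) (g i (?d i) (pvar i)) \<in> elts (F j) (?d i)" using Sgp[of i j] gel[of i j] by simp
  qed auto
  \<comment> \<open>The lift of \<open>x_q\<close>, chosen at stage \<open>q\<close> and transported
    to stage \<open>n\<close>.\<close>
  define e' where "e' n = (\<lambda>q. T q n (?d q) (e q))" for n
  have e'cl: "e' n q \<in> elts (E n) (?d q)" if "q \<in> {2..n}" for n q
    using cdga_homD(3)[OF T[of q n] e[of q]] that by (simp add: e'_def)
  have evl: "evaluation ?d {2..n} (E n) (e' n)" for n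
    using e'cl E by (auto intro!: evaluation.intro simp: cdga_def evaluation_axioms_def)
  have Te': "T i j (?d q) (e' i q) = e' j q" if "i \<le> j" "q \<in> {2..i}" for i j q
    using TT[of q i j "e q" "?d q"] that e[of q] by (simp add: e'_def)
  have evT: "T i j k (ev ?d (E i) (e' i) k f) = ev ?d (E j) (e' j) k f"
    if "i \<le> j" and f: "f \<in> graded_gens.homog ?d {2..i} k" for i j k f
  proof -
    have "T i j k (ev ?d (E i) (e' i) k f) = ev ?d (E j) (\<lambda>q. T i j (?d q) (e' i q)) k f"
      by (rule ev_natural[OF evl E T[OF that(1)] f])
    also have "\<dots> = ev ?d (E j) (e' j) k f"
      by (rule ev_cong[OF _ f E]) (use that Te' e'cl in auto)
    finally show ?thesis .
  qed
  have cev: "cdga_evaluation ?d {2..n} (E n) (e' n) (dB m)" for n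
  proof (intro cdga_evaluation.intro evl fd cdga_evaluation_axioms.intro)
    fix q assume q: "q \<in> {2..n}"
    have "cdiff (E n) (?d q) (e' n q) = T q n (?d q - 1) (ev ?d (E q) (e' q) (?d q - 1) (dB m q))"
      using cdga_homD(8)[OF T[of q n] e[of q]] de[of q] q by (simp add: e'_def)
    also have "\<dots> = ev ?d (E n) (e' n) (?d q - 1) (dB m q)"
      using q dBn by (intro evT) auto
    finally show "cdiff (E n) (?d q) (e' n q) = ev ?d (E n) (e' n) (?d q - 1) (dB m q)" .
  qed
  define h where "h n = (\<lambda>k. restrict (ev ?d (E n) (e' n) k) (elts (free_B m {2..n}) k))" for n
  have h: "h n l x = ev ?d (E n) (e' n) l x" if "x \<in> elts (free_B m {2..n}) l" for n l x
    using that by (simp add: h_def)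
  show ?thesis
  proof (rule that)
    show "h n \<in> cdga_hom (free_B m {2..n}) (E n)" for n
      unfolding h_def by (rule cdga_evaluation.eval_hom[OF cev])
    have mono: "x \<in> elts (free_B m {2..j}) l" if "i \<le> j" "x \<in> elts (free_B m {2..i}) l" for i j l x
    proof -
      have "{2..i} \<subseteq> {2..j}" using that by auto
      then show ?thesis using that graded_gens.homog_subset[of "{2..i}" "{2..j}" x ?d l]
        by (simp add: graded_gens.elts_free)
    qed
    show "T i j l (h i l x) = h j l x" if "i \<le> j" "x \<in> elts (free_B m {2..i}) l" for i j l x
      using that mono[OF that] by (simp add: h evT graded_gens.elts_free)
    show "p n l (h n l x) = g n l x" if x: "x \<in> elts (free_B m {2..n}) l" for n l x
    proof -
      have x': "x \<in> graded_gens.homog ?d {2..n} l" using x by (simp add: graded_gens.elts_free)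
      have ph: "p n \<in> cdga_hom (E n) (F n)" using p(1)[of n] by (simp add: fibration_def)
      have "p n l (h n l x) = ev ?d (F n) (\<lambda>q. p n (?d q) (e' n q)) l x"
        unfolding h[OF x] by (rule ev_natural[OF evl F ph x'])
      also have "\<dots> = ev ?d (F n) (\<lambda>q. S q n (?d q) (g q (?d q) (pvar q))) l x"
      proof (rule ev_cong[OF _ x' F])
        fix q assume q: "q \<in> {2..n}"
        then show "p n (?d q) (e' n q) = S q n (?d q) (g q (?d q) (pvar q))"
          using pT[of q n "e q" "?d q"] e[of q] pe[of q] by (simp add: e'_def)
        then show "p n (?d q) (e' n q) \<in> elts (F n) (?d q)" using Sgp[OF q] gel[OF q] by simp
      qed
      also have "\<dots> = g n l x" using gev[OF x'] by simp
      finally show ?thesis .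
    qed
  qed
qed

lemma cdga_B_eq: "cdga_B m = free_B m {2..}"
  by (simp add: cdga_B_def)

lemma lifting_B:
  fixes E F :: "'b cdga"
  assumes E: "is_cdga E" and F: "is_cdga F" and p: "fibration E F p" "quasi_iso E F p"
    and g: "g \<in> cdga_hom (cdga_B m) F"
  obtains h where "h \<in> cdga_hom (cdga_B m) E" "\<And>k x. x \<in> elts (cdga_B m) k \<Longrightarrow> p k (h k x) = g k x"
proof -
  let ?d = "degB m"
  \<comment> \<open>A constant tower; its transition maps are identities, restricted because
    morphisms are extensional.\<close>
  let ?T = "\<lambda>i j :: nat. \<lambda>k. restrict (\<lambda>x. x) (elts E k)"
  interpret E: cdga E by unfold_locales fact
  have T: "?T i j \<in> cdga_hom E E" for i j
    by (auto simp: cdga_hom_def linear_between_def)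
  have ph: "p \<in> cdga_hom E F" using p by (simp add: fibration_def)
  note g' = g[unfolded cdga_B_eq]
  have pv: "pvar q \<in> elts (free_B m {2..}) (?d q)" if "2 \<le> q" for q
    using that by (simp add: graded_gens.elts_free graded_gens.homog_pvar)
  have cd: "is_cdga (free_B m {2..})" by (rule is_cdga_free_B) simp
  have fd: "free_derivation ?d {2..} (dB m)" by (rule free_derivation_B) simp
  have gel: "g (?d q) (pvar q) \<in> elts F (?d q)" if "2 \<le> q" for q
    using cdga_homD(3)[OF g' pv[OF that]] .
  have gev: "g k f = ev ?d F (\<lambda>q. g (?d q) (pvar q)) k f" if "f \<in> B.homog m k" for k f
    by (rule hom_eq_ev[OF fd F g' cd that])
  obtain e where e: "\<And>n. 2 \<le> n \<Longrightarrow> e n \<in> elts E (?d n)"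
    and de: "\<And>n. 2 \<le> n \<Longrightarrow> cdiff E (?d n) (e n) =
        ev ?d E (\<lambda>q. ?T q n (?d q) (e q)) (?d n - 1) (dB m n)"
    and pe: "\<And>n. 2 \<le> n \<Longrightarrow> p (?d n) (e n) = g (?d n) (pvar n)"
  proof (rule lifting_generators[where E="\<lambda>_. E" and F="\<lambda>_. F" and p="\<lambda>_. p" and S="\<lambda>_ _ _ x. x"
        and T="?T" and y="\<lambda>n. g (degB m n) (pvar n)" and m=m])
    fix n :: nat assume n: "2 \<le> n"
    have "cdiff F (?d n) (g (?d n) (pvar n)) = g (?d n - 1) (dB m n)"
      using cdga_homD(8)[OF g' pv[OF n]] n D_pvar_B[of "{2..}" n m] by simp
    then show "cdiff F (?d n) (g (?d n) (pvar n)) =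
        ev ?d F (\<lambda>q. g (?d q) (pvar q)) (?d n - 1) (dB m n)"
      using gev[OF dB_homog] n by simp
  qed (use E F p T gel in auto)
  have ecl: "evaluation ?d {2..} E e"
    using e E by (auto intro!: evaluation.intro simp: cdga_def evaluation_axioms_def)
  interpret cdga_evaluation ?d "{2..}" E e "dB m"
  proof (intro cdga_evaluation.intro ecl fd cdga_evaluation_axioms.intro)
    fix n :: nat assume n: "n \<in> {2..}"
    have "ev ?d E (\<lambda>q. ?T q n (?d q) (e q)) (?d n - 1) (dB m n) = ev ?d E e (?d n - 1) (dB m n)"
      by (rule ev_cong[OF _ dB_homog[OF n] E]) (use e in auto)
    then show "cdiff E (?d n) (e n) = ev ?d E e (?d n - 1) (dB m n)" using de[of n] n by simp
  qed
  show ?thesis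
  proof (rule that)
    show "(\<lambda>k. restrict (ev ?d E e k) (elts (cdga_B m) k)) \<in> cdga_hom (cdga_B m) E"
      unfolding cdga_B_eq by (rule eval_hom)
    fix k x assume "x \<in> elts (cdga_B m) k"
    then have x: "x \<in> B.homog m k" unfolding cdga_B_eq B.elts_free .
    have "p k (ev ?d E e k x) = ev ?d F (\<lambda>q. p (?d q) (e q)) k x"
      by (rule ev_natural[OF ecl F ph x])
    also have "\<dots> = ev ?d F (\<lambda>q. g (?d q) (pvar q)) k x"
      by (rule ev_cong[OF _ x F]) (use pe gel in auto)
    finally show "p k (restrict (ev ?d E e k) (elts (cdga_B m) k) x) = g k x"
      using x gev[OF x] unfolding cdga_B_eq B.elts_free by simp
  qed
qed

subsection \<open>Transport of structure\<close>

text \<open>Copies an algebra onto encoded elements, since the model category admits only CDGAs over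
  \<open>'u\<close>. The decoding \<open>\<kappa>\<close> has to invert \<open>\<iota>\<close> only
  on elements of the algebra (\<open>retract\<close>).\<close>

definition transport :: "('a \<Rightarrow> 'b) \<Rightarrow> ('b \<Rightarrow> 'a) \<Rightarrow> 'a cdga \<Rightarrow> 'b cdga" where
  "transport \<iota> \<kappa> A = \<lparr>
     grade = (\<lambda>k. \<lparr>
       carrier = \<iota> ` elts A k,
       monoid.mult = undefined, one = undefined,
       ring.zero = \<iota> \<zero>\<^bsub>grade A k\<^esub>,
       ring.add = (\<lambda>x y. \<iota> (\<kappa> x \<oplus>\<^bsub>grade A k\<^esub> \<kappa> y)),
       smult = (\<lambda>c x. \<iota> (c \<odot>\<^bsub>grade A k\<^esub> \<kappa> x))\<rparr>),
     cunit = \<iota> (cunit A),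
     cmult = (\<lambda>k l x y. \<iota> (cmult A k l (\<kappa> x) (\<kappa> y))),
     cdiff = (\<lambda>k x. \<iota> (cdiff A k (\<kappa> x)))\<rparr>"

lemma transport_simps [simp]:
  "elts (transport \<iota> \<kappa> A) k = \<iota> ` elts A k"
  "\<zero>\<^bsub>grade (transport \<iota> \<kappa> A) k\<^esub> = \<iota> \<zero>\<^bsub>grade A k\<^esub>"
  "x \<oplus>\<^bsub>grade (transport \<iota> \<kappa> A) k\<^esub> y = \<iota> (\<kappa> x \<oplus>\<^bsub>grade A k\<^esub> \<kappa> y)"
  "c \<odot>\<^bsub>grade (transport \<iota> \<kappa> A) k\<^esub> x = \<iota> (c \<odot>\<^bsub>grade A k\<^esub> \<kappa> x)"
  "cunit (transport \<iota> \<kappa> A) = \<iota> (cunit A)"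
  "cmult (transport \<iota> \<kappa> A) k l x y = \<iota> (cmult A k l (\<kappa> x) (\<kappa> y))"
  "cdiff (transport \<iota> \<kappa> A) k x = \<iota> (cdiff A k (\<kappa> x))"
  by (simp_all add: transport_def)

locale transported = cdga A for A :: "'a cdga" +
  fixes \<iota> :: "'a \<Rightarrow> 'b" and \<kappa> :: "'b \<Rightarrow> 'a"
  assumes retract: "x \<in> elts A k \<Longrightarrow> \<kappa> (\<iota> x) = x"
begin

abbreviation "\<T> \<equiv> transport \<iota> \<kappa> A"

definition "incl = (\<lambda>k. restrict \<iota> (elts A k))"

definition "retr = (\<lambda>k. restrict \<kappa> (elts \<T> k))"

lemma is_cdga_transport: "is_cdga \<T>"
  by (rule is_cdga_surj[OF A, where \<phi>="\<lambda>_. \<iota>"]) (simp_all add: retract)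

lemma incl_hom: "incl \<in> cdga_hom A \<T>"
  by (auto simp: cdga_hom_def linear_between_def incl_def retract)

lemma retr_hom: "retr \<in> cdga_hom \<T> A"
  by (auto simp: cdga_hom_def linear_between_def retr_def retract[OF M.zero_closed]
     retract[OF unit_closed] retract[OF smult_closed] retract[OF M.a_closed]
     retract[OF mult_closed] retract[OF diff_closed] retract)

lemma incl_apply [simp]: "x \<in> elts A k \<Longrightarrow> incl k x = \<iota> x"
  by (simp add: incl_def)

lemma retr_apply [simp]: "x \<in> elts A k \<Longrightarrow> retr k (\<iota> x) = x"
  by (auto simp: retr_def retract)

lemma bij_retr: "bij_betw (retr k) (elts \<T> k) (elts A k)"
  by (rule bij_betw_byWitness[where f'=\<iota>]) auto

lemma quasi_iso_retr: "quasi_iso \<T> A retr"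
  by (rule iso_quasi_iso[OF is_cdga_transport A retr_hom bij_retr])

end

lemma cofibrant_transport_B:
  fixes \<iota> :: "(nat multiset \<Rightarrow> rat) \<Rightarrow> 'u"
  assumes "transported (cdga_B m) \<iota> \<kappa>"
  shows "cofibrant (transport \<iota> \<kappa> (cdga_B m))"
  unfolding cofibrant_def
proof (intro conjI allI impI)
  interpret transported "cdga_B m" \<iota> \<kappa> by fact
  show "is_cdga (transport \<iota> \<kappa> (cdga_B m))" by (rule is_cdga_transport)
  fix E F :: "'u cdga" and p g
  assume *: "is_cdga E \<and> is_cdga F \<and> fibration E F p \<and> quasi_iso E F p \<and> g \<in> cdga_hom (transport \<iota> \<kappa> (cdga_B m)) F"
  then have g': "hom_comp (cdga_B m) g incl \<in> cdga_hom (cdga_B m) F"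
    using cdga_hom_comp[OF A incl_hom] by blast
  obtain h where h: "h \<in> cdga_hom (cdga_B m) E"
    "\<And>k x. x \<in> elts (cdga_B m) k \<Longrightarrow> p k (h k x) = hom_comp (cdga_B m) g incl k x"
    by (rule lifting_B[of E F p]) (use * g' in auto)
  show "\<exists>h\<in>cdga_hom \<T> E. \<forall>k. \<forall>x\<in>elts \<T> k. p k (h k x) = g k x"
  proof (intro bexI[of _ "hom_comp \<T> h retr"] allI ballI)
    show "hom_comp \<T> h retr \<in> cdga_hom \<T> E" by (rule cdga_hom_comp[OF is_cdga_transport retr_hom h(1)])
    fix k x assume "x \<in> elts \<T> k"
    then obtain y where "y \<in> elts (cdga_B m) k" "x = \<iota> y" by auto
    then show "p k (hom_comp \<T> h retr k x) = g k x" using h(2) by simp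
  qed
qed

subsection \<open>The tower of subalgebras\<close>

text \<open>
  \<open>\<iota>\<close> encodes polynomials as elements of the universe \<open>'u\<close>, with inverse \<open>\<kappa>\<close>, and \<open>\<nu>\<close> encodes the
  natural numbers; the index category is the poset of natural numbers.
\<close>

locale B_tower =
  fixes m :: int and \<iota> :: "(nat multiset \<Rightarrow> rat) \<Rightarrow> 'u" and \<kappa> :: "'u \<Rightarrow> nat multiset \<Rightarrow> rat" and \<nu> :: "nat \<Rightarrow> 'u"
  assumes \<kappa>\<iota>: "finite {K. f K \<noteq> 0} \<Longrightarrow> \<kappa> (\<iota> f) = f" and inj_\<nu>: "inj \<nu>"
begin

abbreviation "FB n \<equiv> free_B m {2..n}"

lemma is_cdga_FB: "is_cdga (FB n)" by (rule is_cdga_free_B) simp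

lemma is_cdga_B: "is_cdga (cdga_B m)" unfolding cdga_B_eq by (rule is_cdga_free_B) simp

sublocale Q: transported "cdga_B m" \<iota> \<kappa>
  using is_cdga_B by unfold_locales (auto intro!: \<kappa>\<iota> B.homogD simp: cdga_B_eq)

sublocale Z: transported "FB n" \<iota> \<kappa> for n
  using is_cdga_FB by unfold_locales (auto intro!: \<kappa>\<iota> graded_gens.homogD simp: graded_gens.elts_free)

abbreviation "ZZ n \<equiv> transport \<iota> \<kappa> (FB n)"

lemma elts_FB: "f \<in> elts (FB n) k \<longleftrightarrow> f \<in> B.homog m k \<and> (\<forall>K. f K \<noteq> 0 \<longrightarrow> set_mset K \<subseteq> {2..n})"
proof -
  have "{2..n} \<subseteq> {2..}" by auto
  then show ?thesis using B.homog_subset[of "{2..n}" f m k] by (simp add: graded_gens.elts_free)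
qed

lemma elts_B: "elts (cdga_B m) k = B.homog m k"
  unfolding cdga_B_eq by simp

lemma elts_FB_mono: "i \<le> j \<Longrightarrow> f \<in> elts (FB i) k \<Longrightarrow> f \<in> elts (FB j) k"
  unfolding elts_FB by fastforce

lemma elts_FB_B: "f \<in> elts (FB i) k \<Longrightarrow> f \<in> elts (cdga_B m) k"
  unfolding elts_FB elts_B by blast

lemma B_union: assumes "f \<in> elts (cdga_B m) k" shows "\<exists>n. f \<in> elts (FB n) k"
proof -
  have f: "f \<in> B.homog m k" using assms by (simp add: elts_B)
  let ?S = "\<Union>K\<in>{K. f K \<noteq> 0}. set_mset K"
  have fin: "finite ?S" using B.homogD(1)[OF f] by blast
  have "set_mset K \<subseteq> {2..Max ?S}" if "f K \<noteq> 0" for K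
  proof
    fix q assume q: "q \<in># K"
    then have "q \<in> ?S" using that by blast
    then have "q \<le> Max ?S" by (rule Max_ge[OF fin])
    moreover have "q \<ge> 2" using B.homogD(2)[OF f that] q by (auto simp: monomials_def)
    ultimately show "q \<in> {2..Max ?S}" by simp
  qed
  then show ?thesis unfolding elts_FB using f by blast
qed

lemma incl_FB: "i \<le> j \<Longrightarrow> (\<lambda>k. restrict (\<lambda>x. x) (elts (FB i) k)) \<in> cdga_hom (FB i) (FB j)"
  by (rule free_cdga_inclusion) (auto intro: free_derivation_B)

lemma incl_FB_B: "(\<lambda>k. restrict (\<lambda>x. x) (elts (FB i) k)) \<in> cdga_hom (FB i) (cdga_B m)"
  unfolding cdga_B_eq by (rule free_cdga_inclusion) (auto intro: free_derivation_B)

lemma FB_ops: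
  assumes "x \<in> elts (FB i) k"
  shows "y \<in> elts (FB i) l \<Longrightarrow> cmult (FB i) k l x y = cmult (cdga_B m) k l x y"
    and "cdiff (FB i) k x = cdiff (cdga_B m) k x"
  using cdga_homD(7)[OF incl_FB_B, of x i k y l] cdga_homD(8)[OF incl_FB_B, of x i k]
    Z.mult_closed[of x i k y l] Z.diff_closed[of x i k] assms by auto

text \<open>Arrows of the index category are elements of \<open>'u\<close> too, so the pair of end
  points is coded as one natural number.\<close>

definition "arrow i j = \<nu> (prod_encode (i, j))"
definition "idx = inv_into UNIV \<nu>"
definition "src a = fst (prod_decode (idx a))"
definition "tgt a = snd (prod_decode (idx a))"

lemma idx_simps [simp]: "idx (\<nu> n) = n" "src (arrow i j) = i" "tgt (arrow i j) = j"
  using inj_\<nu> by (auto simp: idx_def src_def tgt_def arrow_def)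

definition I :: "'u cat" where
  "I = \<lparr>Obj = range \<nu>, Arr = {arrow i j | i j. i \<le> j}, Dom = (\<lambda>a. \<nu> (src a)), Cod = (\<lambda>a. \<nu> (tgt a)),
     Idn = (\<lambda>x. arrow (idx x) (idx x)), Cmp = (\<lambda>b a. arrow (src a) (tgt b))\<rparr>"

lemma I_simps [simp]:
  "Obj I = range \<nu>" "Arr I = {arrow i j | i j. i \<le> j}" "Dom I a = \<nu> (src a)" "Cod I a = \<nu> (tgt a)"
  "Idn I x = arrow (idx x) (idx x)" "Cmp I b a = arrow (src a) (tgt b)"
  by (simp_all add: I_def)

lemma \<nu>_eq [simp]: "\<nu> i = \<nu> j \<longleftrightarrow> i = j"
  using inj_\<nu> by (auto simp: inj_def)

lemma arrow_Arr: "i \<le> j \<Longrightarrow> arrow i j \<in> Arr I"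
  by auto

lemma filtered: "filtered_category I"
proof -
  have "\<exists>a b. (\<exists>i j. a = arrow i j \<and> i \<le> j) \<and> (\<exists>i j. b = arrow i j \<and> i \<le> j) \<and> src a = i \<and> src b = j \<and> tgt a = tgt b" for i j
  proof -
    have "i \<le> max i j" "j \<le> max i j" by auto
    then show ?thesis
      by (intro exI[of _ "arrow i (max i j)"] exI[of _ "arrow j (max i j)"]) (simp only: idx_simps, blast)
  qed
  then show ?thesis unfolding filtered_category_def is_category_def
    by (auto 0 0 simp: Bex_def) fastforce+
qed

text \<open>All stages are encoded by the same \<open>\<iota>\<close>, so the transition maps are
  literal inclusions. This is what makes germs easy to describe.\<close>

definition Z :: "'u diagram" where
  "Z = \<lparr>dobj = (\<lambda>x. ZZ (idx x)), darr = (\<lambda>a k. restrict (\<lambda>x. x) (elts (ZZ (src a)) k))\<rparr>"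

lemma Z_simps [simp]:
  "dobj Z x = ZZ (idx x)" "darr Z a k = restrict (\<lambda>x. x) (elts (ZZ (src a)) k)"
  by (simp_all add: Z_def)

lemma darr_hom:
  assumes "i \<le> j"
  shows "darr Z (arrow i j) \<in> cdga_hom (ZZ i) (ZZ j)"
proof -
  have "hom_comp (ZZ i) (hom_comp (FB i) (Z.incl j) (\<lambda>k. restrict (\<lambda>x. x) (elts (FB i) k))) (Z.retr i) \<in> cdga_hom (ZZ i) (ZZ j)"
    by (rule cdga_hom_comp[OF Z.is_cdga_transport Z.retr_hom cdga_hom_comp[OF is_cdga_FB incl_FB[OF assms] Z.incl_hom]])
  also have "hom_comp (ZZ i) (hom_comp (FB i) (Z.incl j) (\<lambda>k. restrict (\<lambda>x. x) (elts (FB i) k))) (Z.retr i) = darr Z (arrow i j)"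
    using elts_FB_mono[OF assms] by (auto simp: fun_eq_iff hom_comp_def restrict_def)
  finally show ?thesis .
qed

lemma ZZ_mono: "i \<le> j \<Longrightarrow> x \<in> elts (ZZ i) k \<Longrightarrow> x \<in> elts (ZZ j) k"
  using elts_FB_mono by auto

lemma is_diagram_Z: "is_diagram I Z"
  unfolding is_diagram_def using Z.is_cdga_transport darr_hom ZZ_mono by (auto simp del: transport_simps Z_simps(2)) auto

lemma proj_cofibrant_Z: "proj_cofibrant I Z"
  unfolding proj_cofibrant_def
proof (intro conjI allI impI)
  fix E F :: "'u diagram" and p g
  assume a: "is_diagram I E \<and> is_diagram I F \<and> p \<in> nat_trans I E F \<and>
        (\<forall>i\<in>Obj I. fibration (dobj E i) (dobj F i) (p i) \<and>
                    quasi_iso (dobj E i) (dobj F i) (p i)) \<and>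
        g \<in> nat_trans I Z F"
  have arr: "arrow i j \<in> Arr I" if "i \<le> j" for i j using that by auto
  have E: "is_cdga (dobj E (\<nu> n))" and F: "is_cdga (dobj F (\<nu> n))" for n
    using a by (auto simp: is_diagram_def)
  have T: "darr E (arrow i j) \<in> cdga_hom (dobj E (\<nu> i)) (dobj E (\<nu> j))" if "i \<le> j" for i j
    using a arr[OF that] unfolding is_diagram_def by fastforce
  have TT: "darr E (arrow j k) l (darr E (arrow i j) l x) = darr E (arrow i k) l x"
    if ij: "i \<le> j" "j \<le> k" "x \<in> elts (dobj E (\<nu> i)) l" for i j k l x
  proof -
    have "\<forall>a\<in>Arr I. \<forall>b\<in>Arr I. Cod I a = Dom I b \<longrightarrow>
        (\<forall>k. \<forall>x\<in>elts (dobj E (Dom I a)) k. darr E (Cmp I b a) k x = darr E b k (darr E a k x))"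
      using a unfolding is_diagram_def by (elim conjE) assumption
    from this[rule_format, OF arr[OF ij(1)] arr[OF ij(2)], of x l] show ?thesis using ij by simp
  qed
  have p: "fibration (dobj E (\<nu> n)) (dobj F (\<nu> n)) (p (\<nu> n))" "quasi_iso (dobj E (\<nu> n)) (dobj F (\<nu> n)) (p (\<nu> n))" for n
    using a by auto
  have pT: "p (\<nu> j) l (darr E (arrow i j) l x) = darr F (arrow i j) l (p (\<nu> i) l x)"
    if "i \<le> j" "x \<in> elts (dobj E (\<nu> i)) l" for i j l x
  proof -
    have "\<forall>a\<in>Arr I. \<forall>k. \<forall>x\<in>elts (dobj E (Dom I a)) k. p (Cod I a) k (darr E a k x) = darr F a k (p (Dom I a) k x)"
      using a unfolding nat_trans_def mem_Collect_eq by (elim conjE) assumption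
    from this[rule_format, OF arr[OF that(1)], of x l] show ?thesis using that by simp
  qed
  have gh: "g (\<nu> n) \<in> cdga_hom (ZZ n) (dobj F (\<nu> n))" for n
    using a by (auto simp: nat_trans_def)
  \<comment> \<open>\<open>lifting_tower\<close> speaks about polynomials, so \<open>g\<close> is
    composed with the encoding; the resulting lift is composed with the decoding below.\<close>
  define g' where "g' n = hom_comp (FB n) (g (\<nu> n)) (Z.incl n)" for n
  have g': "g' n \<in> cdga_hom (FB n) (dobj F (\<nu> n))" for n
    unfolding g'_def by (rule cdga_hom_comp[OF is_cdga_FB Z.incl_hom gh])
  have g'_eq: "g' n l x = g (\<nu> n) l (\<iota> x)" if "x \<in> elts (FB n) l" for n l x
    using that by (simp add: g'_def)
  have Sg: "darr F (arrow i j) l (g' i l x) = g' j l x" if ij: "i \<le> j" "x \<in> elts (FB i) l" for i j l x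
  proof -
    have "\<forall>a\<in>Arr I. \<forall>k. \<forall>x\<in>elts (dobj Z (Dom I a)) k. g (Cod I a) k (darr Z a k x) = darr F a k (g (Dom I a) k x)"
      using a unfolding nat_trans_def mem_Collect_eq by (elim conjE) assumption
    from this[rule_format, OF arr[OF ij(1)], of "\<iota> x" l] show ?thesis
      using ij elts_FB_mono[OF ij] by (auto simp: g'_eq)
  qed
  obtain h where h: "\<And>n. h n \<in> cdga_hom (FB n) (dobj E (\<nu> n))"
    and Th: "\<And>i j l x. i \<le> j \<Longrightarrow> x \<in> elts (FB i) l \<Longrightarrow> darr E (arrow i j) l (h i l x) = h j l x"
    and ph: "\<And>n l x. x \<in> elts (FB n) l \<Longrightarrow> p (\<nu> n) l (h n l x) = g' n l x"
    by (rule lifting_tower[where E="\<lambda>n. dobj E (\<nu> n)" and F="\<lambda>n. dobj F (\<nu> n)" and p="\<lambda>n. p (\<nu> n)"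
          and T="\<lambda>i j. darr E (arrow i j)" and S="\<lambda>i j. darr F (arrow i j)" and g=g' and m=m,
          OF E F T TT p pT g' Sg]) (assumption | (rule that; assumption))+
  show "\<exists>h\<in>nat_trans I Z E. \<forall>i\<in>Obj I. \<forall>k. \<forall>x\<in>elts (dobj Z i) k. p i k (h i k x) = g i k x"
  proof (intro bexI[of _ "\<lambda>x. hom_comp (ZZ (idx x)) (h (idx x)) (Z.retr (idx x))"] ballI allI)
    show "(\<lambda>x. hom_comp (ZZ (idx x)) (h (idx x)) (Z.retr (idx x))) \<in> nat_trans I Z E"
      unfolding nat_trans_def
    proof (intro CollectI conjI ballI allI)
      fix i assume "i \<in> Obj I"
      then show "hom_comp (ZZ (idx i)) (h (idx i)) (Z.retr (idx i)) \<in> cdga_hom (dobj Z i) (dobj E i)"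
        using cdga_hom_comp[OF Z.is_cdga_transport Z.retr_hom h] by auto
    next
      fix b k x assume "b \<in> Arr I" and x: "x \<in> elts (dobj Z (Dom I b)) k"
      then obtain i j where ij: "b = arrow i j" "i \<le> j" by auto
      then obtain f where f: "f \<in> elts (FB i) k" "x = \<iota> f" using x by auto
      then show "hom_comp (ZZ (idx (Cod I b))) (h (idx (Cod I b))) (Z.retr (idx (Cod I b))) k (darr Z b k x) =
        darr E b k (hom_comp (ZZ (idx (Dom I b))) (h (idx (Dom I b))) (Z.retr (idx (Dom I b))) k x)"
        using ij elts_FB_mono[OF ij(2) f(1)] Th by simp
    qed
    fix i k x assume "i \<in> Obj I" and x: "x \<in> elts (dobj Z i) k"
    then obtain n where n: "i = \<nu> n" by auto
    then obtain f where f: "f \<in> elts (FB n) k" "x = \<iota> f" using x by auto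
    then show "p i k (hom_comp (ZZ (idx i)) (h (idx i)) (Z.retr (idx i)) k x) = g i k x"
      using n ph g'_eq by simp
  qed
qed (rule is_diagram_Z)

text \<open>Being projectively cofibrant, the tower is its own replacement; the homotopy colimit in
  the definition becomes its plain colimit.\<close>

lemma proj_cofibrant_replacement_Z:
  "proj_cofibrant_replacement I Z Z (\<lambda>x k. restrict (\<lambda>x. x) (elts (dobj Z x) k))"
proof -
  have id: "(\<lambda>k. restrict (\<lambda>x. x) (elts (ZZ n) k)) \<in> cdga_hom (ZZ n) (ZZ n)" for n
  proof -
    have "darr Z (arrow n n) = (\<lambda>k. restrict (\<lambda>x. x) (elts (ZZ n) k))"
      by (simp add: fun_eq_iff)
    then show ?thesis using darr_hom[of n n] by simp
  qed
  have "bij_betw (restrict (\<lambda>x. x) (elts (ZZ n) k)) (elts (ZZ n) k) (elts (ZZ n) k)" for n k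
    by (subst bij_betw_restrict_eq) (simp add: bij_betw_def)
  then have q: "quasi_iso (ZZ n) (ZZ n) (\<lambda>k. restrict (\<lambda>x. x) (elts (ZZ n) k))" for n
    by (rule iso_quasi_iso[OF Z.is_cdga_transport Z.is_cdga_transport id])
  have "(\<lambda>x k. restrict (\<lambda>x. x) (elts (dobj Z x) k)) \<in> nat_trans I Z Z"
    unfolding nat_trans_def using id ZZ_mono by (auto simp del: transport_simps)
  then show ?thesis
    unfolding proj_cofibrant_replacement_def using proj_cofibrant_Z q by simp
qed

subsection \<open>The colimit\<close>

text \<open>The germ of \<open>x\<close>: as transition maps are inclusions, two representatives
  agree only if they are the same element, so a class consists of one \<open>x\<close> paired with
  every stage that contains it (\<open>germ_Z\<close>).\<close>

definition \<gamma> :: "int \<Rightarrow> 'u \<Rightarrow> ('u \<times> 'u) set" where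
  "\<gamma> k x = {(\<nu> j, x) | j. x \<in> elts (ZZ j) k}"

abbreviation "C \<equiv> colimit I Z"

lemma germ_Z: assumes "z \<in> elts (ZZ n) k" shows "germ I Z (\<nu> n) k z = \<gamma> k z"
proof -
  have "((\<nu> n, z), (i, w)) \<in> germ_eq I Z k \<longleftrightarrow> (i, w) \<in> \<gamma> k z" for i w
  proof
    assume "((\<nu> n, z), (i, w)) \<in> germ_eq I Z k"
    then obtain a b where i: "i \<in> Obj I" "w \<in> elts (dobj Z i) k"
      and ab: "a \<in> Arr I" "b \<in> Arr I" "Dom I a = \<nu> n" "Dom I b = i" "darr Z a k z = darr Z b k w"
      unfolding germ_eq_def by blast
    then obtain j where j: "i = \<nu> j" by auto
    have "src a = n" "src b = j" using ab j by auto
    then have "z = w" using ab(5) assms i j by (simp del: transport_simps)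
    then show "(i, w) \<in> \<gamma> k z" using i j by (auto simp: \<gamma>_def simp del: transport_simps)
  next
    assume "(i, w) \<in> \<gamma> k z"
    then obtain j where j: "i = \<nu> j" "w = z" "z \<in> elts (ZZ j) k" by (auto simp: \<gamma>_def simp del: transport_simps)
    have "arrow n (max n j) \<in> Arr I" "arrow j (max n j) \<in> Arr I" by (rule arrow_Arr, simp)+
    then show "((\<nu> n, z), (i, w)) \<in> germ_eq I Z k"
    proof -
      have "\<exists>a\<in>Arr I. \<exists>b\<in>Arr I. Dom I a = \<nu> n \<and> Dom I b = \<nu> j \<and> Cod I a = Cod I b \<and> darr Z a k z = darr Z b k z"
        by (rule bexI[of _ "arrow n (max n j)"], rule bexI[of _ "arrow j (max n j)"])
          (use j(3) assms in \<open>simp_all del: I_simps(2) transport_simps add: arrow_Arr\<close>)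
      then show ?thesis unfolding germ_eq_def using j assms by (simp del: I_simps(2-4) transport_simps)
    qed
  qed
  then show ?thesis unfolding germ_def by auto
qed

lemma mem_\<gamma>: "(i, y) \<in> \<gamma> k x \<longleftrightarrow> y = x \<and> (\<exists>n. i = \<nu> n \<and> x \<in> elts (ZZ n) k)"
  by (auto simp: \<gamma>_def simp del: transport_simps)

lemma Q_union: "x \<in> elts Q.\<T> k \<Longrightarrow> \<exists>n. x \<in> elts (ZZ n) k"
  using B_union by fastforce

lemma ZZ_Q: "x \<in> elts (ZZ n) k \<Longrightarrow> x \<in> elts Q.\<T> k"
  using elts_FB_B by auto

lemma ZZ_common:
  assumes "x \<in> elts Q.\<T> k" "y \<in> elts Q.\<T> l" shows "\<exists>n. x \<in> elts (ZZ n) k \<and> y \<in> elts (ZZ n) l"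
proof -
  obtain i j where "x \<in> elts (ZZ i) k" "y \<in> elts (ZZ j) l" using Q_union assms by blast
  then have "x \<in> elts (ZZ (max i j)) k" "y \<in> elts (ZZ (max i j)) l"
    using ZZ_mono[of i "max i j"] ZZ_mono[of j "max i j"] by (auto simp del: transport_simps)
  then show ?thesis by blast
qed

lemma ZZ_ops:
  assumes x: "x \<in> elts (ZZ n) k"
  shows "y \<in> elts (ZZ n) k \<Longrightarrow> x \<oplus>\<^bsub>grade (ZZ n) k\<^esub> y = x \<oplus>\<^bsub>grade Q.\<T> k\<^esub> y"
    and "c \<odot>\<^bsub>grade (ZZ n) k\<^esub> x = c \<odot>\<^bsub>grade Q.\<T> k\<^esub> x"
    and "y \<in> elts (ZZ n) l \<Longrightarrow> cmult (ZZ n) k l x y = cmult Q.\<T> k l x y"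
    and "cdiff (ZZ n) k x = cdiff Q.\<T> k x"
  using x FB_ops by (auto simp: Z.retract cdga_B_eq)

text \<open>The operations of \<open>colimit\<close> are unions over all representatives.
  Representatives at different stages yield the same germ, so each union is over a single set, and
  \<open>\<gamma>\<close> carries the operations of the encoded \<open>cdga_B m\<close> to those of
  the colimit.\<close>

lemma C_simps:
  shows elts_C: "elts C k = \<gamma> k ` elts Q.\<T> k"
    and zero_C: "\<zero>\<^bsub>grade C k\<^esub> = \<gamma> k \<zero>\<^bsub>grade Q.\<T> k\<^esub>"
    and add_C: "x \<in> elts Q.\<T> k \<Longrightarrow> y \<in> elts Q.\<T> k \<Longrightarrow> \<gamma> k x \<oplus>\<^bsub>grade C k\<^esub> \<gamma> k y = \<gamma> k (x \<oplus>\<^bsub>grade Q.\<T> k\<^esub> y)"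
    and smult_C: "x \<in> elts Q.\<T> k \<Longrightarrow> c \<odot>\<^bsub>grade C k\<^esub> \<gamma> k x = \<gamma> k (c \<odot>\<^bsub>grade Q.\<T> k\<^esub> x)"
    and unit_C: "cunit C = \<gamma> 0 (cunit Q.\<T>)"
    and mult_C: "x \<in> elts Q.\<T> k \<Longrightarrow> w \<in> elts Q.\<T> l \<Longrightarrow> cmult C k l (\<gamma> k x) (\<gamma> l w) = \<gamma> (k + l) (cmult Q.\<T> k l x w)"
    and diff_C: "x \<in> elts Q.\<T> k \<Longrightarrow> cdiff C k (\<gamma> k x) = \<gamma> (k - 1) (cdiff Q.\<T> k x)"
proof -
  note [simp del] = transport_simps
  interpret ZT: cdga "ZZ n" for n by unfold_locales (rule Z.is_cdga_transport)
  show "elts C k = \<gamma> k ` elts Q.\<T> k"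
    unfolding colimit_def using germ_Z ZZ_Q Q_union by (auto simp: image_iff) (metis idx_simps(1))+
  have z: "\<zero>\<^bsub>grade (ZZ n) k\<^esub> = \<zero>\<^bsub>grade Q.\<T> k\<^esub>" for n
    by (simp add: transport_simps cdga_B_eq)
  then show "\<zero>\<^bsub>grade C k\<^esub> = \<gamma> k \<zero>\<^bsub>grade Q.\<T> k\<^esub>"
    unfolding colimit_def using germ_Z[OF ZT.M.zero_closed] by auto
  have u: "cunit (ZZ n) = cunit Q.\<T>" for n
    by (simp add: transport_simps cdga_B_eq)
  then show "cunit C = \<gamma> 0 (cunit Q.\<T>)"
    unfolding colimit_def using germ_Z[OF ZT.unit_closed] by auto
  show "\<gamma> k x \<oplus>\<^bsub>grade C k\<^esub> \<gamma> k y = \<gamma> k (x \<oplus>\<^bsub>grade Q.\<T> k\<^esub> y)"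
    if xy: "x \<in> elts Q.\<T> k" "y \<in> elts Q.\<T> k" for x y
  proof -
    have "germ I Z (\<nu> n) k (x \<oplus>\<^bsub>grade (ZZ n) k\<^esub> y) = \<gamma> k (x \<oplus>\<^bsub>grade Q.\<T> k\<^esub> y)"
      if "x \<in> elts (ZZ n) k" "y \<in> elts (ZZ n) k" for n
      using germ_Z[OF ZT.M.a_closed[OF that]] ZZ_ops(1)[OF that] by simp
    then have "{germ I Z i k (z \<oplus>\<^bsub>grade (dobj Z i) k\<^esub> w) | i z w. (i, z) \<in> \<gamma> k x \<and> (i, w) \<in> \<gamma> k y} =
      {\<gamma> k (x \<oplus>\<^bsub>grade Q.\<T> k\<^esub> y)}"
      using ZZ_common[OF xy] unfolding mem_\<gamma> by auto (metis idx_simps(1))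
    then show ?thesis unfolding colimit_def by simp
  qed
  show "c \<odot>\<^bsub>grade C k\<^esub> \<gamma> k x = \<gamma> k (c \<odot>\<^bsub>grade Q.\<T> k\<^esub> x)" if x: "x \<in> elts Q.\<T> k" for x
  proof -
    have "germ I Z (\<nu> n) k (c \<odot>\<^bsub>grade (ZZ n) k\<^esub> x) = \<gamma> k (c \<odot>\<^bsub>grade Q.\<T> k\<^esub> x)"
      if "x \<in> elts (ZZ n) k" for n
      using germ_Z[OF ZT.smult_closed[OF that]] ZZ_ops(2)[OF that] by simp
    then have "{germ I Z i k (c \<odot>\<^bsub>grade (dobj Z i) k\<^esub> z) | i z. (i, z) \<in> \<gamma> k x} =
      {\<gamma> k (c \<odot>\<^bsub>grade Q.\<T> k\<^esub> x)}"
      using Q_union[OF x] unfolding mem_\<gamma> by auto (metis idx_simps(1))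
    then show ?thesis unfolding colimit_def by simp
  qed
  show "cmult C k l (\<gamma> k x) (\<gamma> l w) = \<gamma> (k + l) (cmult Q.\<T> k l x w)"
    if xy: "x \<in> elts Q.\<T> k" "w \<in> elts Q.\<T> l" for x w
  proof -
    have "germ I Z (\<nu> n) (k + l) (cmult (ZZ n) k l x w) = \<gamma> (k + l) (cmult Q.\<T> k l x w)"
      if "x \<in> elts (ZZ n) k" "w \<in> elts (ZZ n) l" for n
      using germ_Z[OF ZT.mult_closed[OF that]] ZZ_ops(3)[OF that] by simp
    then have "{germ I Z i (k + l) (cmult (dobj Z i) k l z v) | i z v. (i, z) \<in> \<gamma> k x \<and> (i, v) \<in> \<gamma> l w} =
      {\<gamma> (k + l) (cmult Q.\<T> k l x w)}"
      using ZZ_common[OF xy] unfolding mem_\<gamma> by auto (metis idx_simps(1))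
    then show ?thesis unfolding colimit_def by simp
  qed
  show "cdiff C k (\<gamma> k x) = \<gamma> (k - 1) (cdiff Q.\<T> k x)" if x: "x \<in> elts Q.\<T> k" for x
  proof -
    have "germ I Z (\<nu> n) (k - 1) (cdiff (ZZ n) k x) = \<gamma> (k - 1) (cdiff Q.\<T> k x)"
      if "x \<in> elts (ZZ n) k" for n
      using germ_Z[OF ZT.diff_closed[OF that]] ZZ_ops(4)[OF that] by simp
    then have "{germ I Z i (k - 1) (cdiff (dobj Z i) k z) | i z. (i, z) \<in> \<gamma> k x} =
      {\<gamma> (k - 1) (cdiff Q.\<T> k x)}"
      using Q_union[OF x] unfolding mem_\<gamma> by auto (metis idx_simps(1))
    then show ?thesis unfolding colimit_def by simp
  qed
qed

lemma is_cdga_C: "is_cdga C"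
  by (rule is_cdga_surj[OF Q.is_cdga_transport, of _ \<gamma>])
    (simp_all only: elts_C zero_C add_C smult_C unit_C mult_C diff_C)

end

subsection \<open>Polynomial forms\<close>

interpretation \<Omega>: free_derivation form_deg "form_gens n" form_d for n
proof
  fix g assume g: "g \<in> form_gens n"
  show "form_d g \<in> graded_gens.homog form_deg (form_gens n) (form_deg g - 1)"
  proof (cases "g > 0")
    case True
    have "- g \<in> form_gens n" using g by (auto simp: form_gens_def)
    from graded_gens.homog_pvar[OF this, of form_deg] show ?thesis
      using True by (simp add: form_d_def form_deg_def)
  next
    case False
    then have "form_d g = 0" by (auto simp: form_d_def)
    then show ?thesis by (simp add: graded_gens.homog_zero)
  qed
qed

lemma fdeg_le_0: "fdeg K \<le> 0"
  by (induction K) (auto simp: form_deg_def)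

text \<open>No generator of the forms has positive degree, so degrees cannot cancel: every factor
  must be some \<open>t_i\<close>, and these are encoded by positive integers.\<close>

lemma fdeg_0_positive: "fdeg K = 0 \<Longrightarrow> g \<in># K \<Longrightarrow> 0 < g"
proof (induction K)
  case (add h K)
  have "form_deg h \<le> 0" by (simp add: form_deg_def)
  then have "form_deg h = 0" "fdeg K = 0" using fdeg_le_0[of K] add.prems(1) by auto
  then show ?case using add by (auto simp: form_deg_def split: if_splits)
qed simp

lemma fdeg_subset: "M \<subseteq># L \<Longrightarrow> fdeg L \<le> fdeg M"
  using fdeg_le_0[of "L - M"] by (simp add: mdeg_diff)

lemma form_dmono_degree: "K \<in> form_monos n \<Longrightarrow> form_dmono n K L \<noteq> 0 \<Longrightarrow> fdeg L = fdeg K - 1"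
  using \<Omega>.homogD(3)[OF \<Omega>.dm_homog] by blast

text \<open>\<open>-j\<close> encodes \<open>dt_j\<close> and the remaining generators are even, so
  no sign occurs: this is the partial derivative of a monomial by \<open>t_j\<close>. The factor is
  an exponent, nonzero in \<open>rat\<close> whenever \<open>t_j\<close> occurs, and therefore a
  closed polynomial function is constant.\<close>

lemma form_dmono_function:
  assumes "K \<in> form_monos n" "\<forall>g\<in>#K. 0 < g" "\<forall>g\<in>#N. 0 < g" "0 < j" "add_mset (- j) N \<in> form_monos n"
  shows "form_dmono n K (add_mset (- j) N) = (if K = add_mset j N then of_nat (count K j) else 0)"
  using assms(1,2,3,5)
proof (induction K arbitrary: N rule: multiset_induct_min)
  case (add h K)
  let ?L = "add_mset (- j) N"
  have K: "K \<in> form_monos n" "h \<in> form_gens n" using add.prems(1) by (auto simp: \<Omega>.mons_add_mset)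
  have pos: "0 < h" "\<forall>g\<in>#K. 0 < g" using add.prems by auto
  have min: "\<forall>x\<in>#K. h \<le> x" using add.hyps by auto
  have hL: "h \<in># ?L \<longleftrightarrow> h \<in># N" "- h \<in># ?L \<longleftrightarrow> h = j" using pos add.prems(3) assms(4) by fastforce+
  have s1: "mon_sign form_deg {#- h#} N = 1"
    using add.prems(3)
    by (induction N) (auto simp: mon_sign_add_mset(2)[of form_deg "{#- h#}"] mon_sign_single form_deg_def)
  have s2: "mon_sign form_deg {#h#} M = 1" for M
    by (rule mon_sign_even_gen) (use pos in \<open>simp add: form_deg_def\<close>)
  have 1: "pmul form_deg (form_gens n) (form_d h) (pmono K) ?L = (if h = j \<and> K = N then 1 else 0)"
  proof (cases "h = j")
    case True
    have "pmono K N = (if K = N then 1 else 0)" by (auto simp: pmono_def)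
    then show ?thesis using True pos s1 add.prems(4) by (simp add: form_d_def \<Omega>.mul_pmono_left)
  next
    case False
    then show ?thesis using pos hL by (simp add: form_d_def \<Omega>.mul_pmono_left)
  qed
  have 2: "pmul form_deg (form_gens n) (pvar h) (form_dmono n K) ?L =
    (if h \<in># N \<and> K = add_mset j (N - {#h#}) then of_nat (count K j) else 0)"
  proof (cases "h \<in># N")
    case True
    then have e: "?L - {#h#} = add_mset (- j) (N - {#h#})"
      using pos assms(4) by (simp add: add_mset_remove_trivial_If)
    have "add_mset (- j) (N - {#h#}) \<in> form_monos n" using \<Omega>.mons_diff[OF add.prems(4)] e by metis
    then have "form_dmono n K (add_mset (- j) (N - {#h#})) =
        (if K = add_mset j (N - {#h#}) then of_nat (count K j) else 0)"
      using add.prems(3) K pos by (intro add.IH) (auto dest: in_diffD)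
    then show ?thesis using True hL add.prems(4) s2 e by (simp add: \<Omega>.mul_pmono_left)
  next
    case False
    then show ?thesis using hL by (simp add: \<Omega>.mul_pmono_left)
  qed
  have "form_dmono n (add_mset h K) ?L = (if h = j \<and> K = N then 1 else 0) +
      (if h \<in># N \<and> K = add_mset j (N - {#h#}) then of_nat (count K j) else 0)"
    unfolding \<Omega>.prepend_minimal(2)[OF min add.prems(1)] plus_fun_apply scal_apply 1 2
    using pos by (simp add: form_deg_def)
  also have "\<dots> = (if add_mset h K = add_mset j N then of_nat (count (add_mset h K) j) else 0)"
  proof (cases "h = j")
    case True
    then show ?thesis by (cases "j \<in># N") (auto simp: not_in_iff)
  next
    case False
    then have "add_mset h K = add_mset j N \<longleftrightarrow> h \<in># N \<and> K = add_mset j (N - {#h#})"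
      by (metis add_eq_conv_diff add_mset_remove_trivial_eq insert_noteq_member union_single_eq_member insert_DiffM add_mset_commute)
    then show ?thesis using False by simp
  qed
  finally show ?case .
qed simp

lemma form_pull_gen_homog:
  assumes "g \<noteq> 0" shows "form_pull_gen k \<theta> g \<in> \<Omega>.homog k (form_deg g)"
proof -
  have "bary k j \<in> \<Omega>.homog k 0" if "j \<le> k" for j
  proof (cases "j = 0")
    case True
    have "bary k j = pmono {#} + (\<Sum>r = 1..k. (-1) \<cdot> pvar (int r))"
      using True by (auto simp: fun_eq_iff bary_def sum_apply sum_negf)
    moreover have "pvar (int r) \<in> \<Omega>.homog k 0" if "r \<in> {1..k}" for r
      using \<Omega>.homog_pvar[of "int r" k] that by (auto simp: form_gens_def form_deg_def)
    then have "(\<Sum>r = 1..k. (-1) \<cdot> pvar (int r)) \<in> \<Omega>.homog k 0"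
      by (intro \<Omega>.homog_sum \<Omega>.homog_scal)
    moreover have "pmono {#} \<in> \<Omega>.homog k 0" by (rule \<Omega>.homog_pmono) auto
    ultimately show ?thesis by (simp only: \<Omega>.homog_add)
  next
    case False
    then show ?thesis
      using \<Omega>.homog_pvar[of "int j" k] that by (auto simp: form_gens_def form_deg_def bary_def)
  qed
  moreover have "dbary k j \<in> \<Omega>.homog k (-1)" if "j \<le> k" for j
  proof (cases "j = 0")
    case True
    have "dbary k j = (\<Sum>r = 1..k. (-1) \<cdot> pvar (- int r))"
      using True by (auto simp: fun_eq_iff dbary_def sum_apply sum_negf)
    moreover have "pvar (- int r) \<in> \<Omega>.homog k (-1)" if "r \<in> {1..k}" for r
      using \<Omega>.homog_pvar[of "- int r" k] that by (auto simp: form_gens_def form_deg_def)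
    ultimately show ?thesis by (auto intro!: \<Omega>.homog_sum \<Omega>.homog_scal)
  next
    case False
    then show ?thesis
      using \<Omega>.homog_pvar[of "- int j" k] that by (auto simp: form_gens_def form_deg_def dbary_def)
  qed
  moreover have "form_pull_gen k \<theta> g = (\<Sum>j | j \<le> k \<and> \<theta> j = nat \<bar>g\<bar>. if g > 0 then bary k j else dbary k j)"
    by (auto simp: fun_eq_iff form_pull_gen_def sum_apply intro!: sum.cong)
  ultimately show ?thesis
    by (auto intro!: \<Omega>.homog_sum simp: form_deg_def)
qed

lemma form_pull_degree:
  assumes "K \<in> form_monos n" "form_pull k \<theta> K L \<noteq> 0" shows "fdeg L = fdeg K"
proof -
  have "foldr (\<lambda>g. pmul form_deg (form_gens k) (form_pull_gen k \<theta> g)) w (pmono {#}) \<in> \<Omega>.homog k (fdeg (mset w))"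
    if "0 \<notin> set w" for w
    using that
  proof (induction w)
    case Nil
    then show ?case by (simp add: \<Omega>.homog_pmono)
  next
    case (Cons g w)
    then show ?case using \<Omega>.homog_mul[OF form_pull_gen_homog] by simp
  qed
  moreover have "0 \<notin> set (sorted_list_of_multiset K)"
    using assms(1) by (auto simp: monomials_def form_gens_def)
  ultimately have "form_pull k \<theta> K \<in> \<Omega>.homog k (fdeg K)"
    unfolding form_pull_def by fastforce
  then show ?thesis using \<Omega>.homogD(3) assms(2) by blast
qed

lemma form_pull_unit: "form_pull k \<theta> {#} = pmono {#}"
  by (simp add: form_pull_def)

lemma form_monos_0: "form_monos 0 = {{#}}"
  by (auto simp: monomials_def form_gens_def)

lemma empty_form_monos [simp]: "{#} \<in> form_monos n"
  by (simp add: monomials_def)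

lemma tensor_value:
  assumes "u \<in> elts (tensor_forms A n) k" "K \<in> form_monos n"
  shows "u K \<in> elts A (k - fdeg K)"
  using assms by (auto simp: tensor_forms_def)

subsection \<open>Coefficients in the colimit\<close>

text \<open>\<open>degB m q = (q - 1) * (m + 1) - 1\<close>, with a positive first and a negative
  second factor. This is where the bound on \<open>m\<close> enters.\<close>

lemma degB_le: assumes "m \<le> -2" "2 \<le> q" shows "degB m q \<le> -2"
proof -
  have "1 * 1 \<le> (int q - 1) * (- (m + 1))"
    by (rule mult_mono) (use assms in auto)
  then show ?thesis by (simp add: degB_def algebra_simps)
qed

text \<open>Minimality: generators have quadratic differential, and the Leibniz rule only multiplies
  by further generators, so no linear term can arise.\<close>

lemma dmB_size:
  assumes "K \<in> B.mons m" "B.dm m K L \<noteq> 0" shows "2 \<le> size L"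
  using assms
proof (induction K arbitrary: L rule: multiset_induct_min)
  case (add h K)
  have K: "K \<in> monomials (degB m) {2..}" and h: "h \<in> {2..}" using add.prems(1) by (auto simp: B.mons_add_mset)
  have min: "\<forall>x\<in>#K. h \<le> x" using add.hyps by auto
  have "pmul (degB m) {2..} (dB m h) (pmono K) L \<noteq> 0 \<or> pmul (degB m) {2..} (pvar h) (B.dm m K) L \<noteq> 0"
    using add.prems(2) unfolding B.prepend_minimal(2)[OF min add.prems(1)] by auto
  then show ?case
  proof
    assume "pmul (degB m) {2..} (dB m h) (pmono K) L \<noteq> 0"
    then obtain M where M: "M \<subseteq># L" "dB m h M \<noteq> 0"
      by (auto simp: pmul_def split: if_splits elim: sum.not_neutral_contains_not_neutral)
    then have "size M = 2" using dB_supp by fastforce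
    then show ?thesis using size_mset_mono[OF M(1)] by simp
  next
    assume "pmul (degB m) {2..} (pvar h) (B.dm m K) L \<noteq> 0"
    then have "B.dm m K (L - {#h#}) \<noteq> 0" by (auto simp: B.mul_pmono_left split: if_splits)
    from add.IH[OF K this] show ?thesis using size_mset_mono[of "L - {#h#}" L] by simp
  qed
qed simp

context B_tower
begin

sublocale CC: cdga C
  by unfold_locales (rule is_cdga_C)

text \<open>All pairs in a germ share their second component, so \<open>the_elem\<close> recovers
  the encoded polynomial, which \<open>\<kappa>\<close> decodes.\<close>

definition coefC :: "nat multiset \<Rightarrow> ('u \<times> 'u) set \<Rightarrow> rat" where
  "coefC K c = \<kappa> (the_elem (snd ` c)) K"

lemma coefC_\<gamma>: assumes "x \<in> elts Q.\<T> k" shows "coefC K (\<gamma> k x) = \<kappa> x K"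
proof -
  obtain n where "(\<nu> n, x) \<in> \<gamma> k x" using Q_union[OF assms] unfolding mem_\<gamma> by blast
  then have "x \<in> snd ` \<gamma> k x" by force
  then have "snd ` \<gamma> k x = {x}" by (auto simp: mem_\<gamma>)
  then show ?thesis by (simp add: coefC_def)
qed

lemma C_elt:
  assumes "c \<in> elts C k"
  obtains f where "f \<in> B.homog m k" "c = \<gamma> k (\<iota> f)" "\<And>K. coefC K c = f K"
proof -
  obtain f where f: "f \<in> elts (cdga_B m) k" "c = \<gamma> k (\<iota> f)"
    using assms unfolding elts_C by auto
  have "coefC K c = f K" for K using f coefC_\<gamma>[of "\<iota> f" k] Q.retract[OF f(1)] by simp
  then show ?thesis using that f unfolding elts_B by blast
qed

lemma \<gamma>_closed: "f \<in> B.homog m k \<Longrightarrow> \<gamma> k (\<iota> f) \<in> elts C k" "f \<in> B.homog m k \<Longrightarrow> \<iota> f \<in> elts Q.\<T> k"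
  "f \<in> B.homog m k \<Longrightarrow> \<kappa> (\<iota> f) = f"
  using Q.retract unfolding elts_C by (auto simp: elts_B)

lemma coefC_\<iota>: "f \<in> B.homog m k \<Longrightarrow> coefC K (\<gamma> k (\<iota> f)) = f K"
  using coefC_\<gamma>[OF \<gamma>_closed(2)] \<gamma>_closed(3) by simp

lemma C_add: "f \<in> B.homog m k \<Longrightarrow> g \<in> B.homog m k \<Longrightarrow>
    \<gamma> k (\<iota> f) \<oplus>\<^bsub>grade C k\<^esub> \<gamma> k (\<iota> g) = \<gamma> k (\<iota> (f + g))"
  using add_C[OF \<gamma>_closed(2) \<gamma>_closed(2)] \<gamma>_closed(3) by (simp add: cdga_B_eq)

lemma C_smult: "f \<in> B.homog m k \<Longrightarrow> c \<odot>\<^bsub>grade C k\<^esub> \<gamma> k (\<iota> f) = \<gamma> k (\<iota> (c \<cdot> f))"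
  using smult_C[OF \<gamma>_closed(2)] \<gamma>_closed(3) by (simp add: cdga_B_eq)

lemma C_mult: "f \<in> B.homog m k \<Longrightarrow> g \<in> B.homog m l \<Longrightarrow>
    cmult C k l (\<gamma> k (\<iota> f)) (\<gamma> l (\<iota> g)) = \<gamma> (k + l) (\<iota> (pmul (degB m) {2..} f g))"
  using mult_C[OF \<gamma>_closed(2) \<gamma>_closed(2)] \<gamma>_closed(3) by (simp add: cdga_B_eq)

lemma C_diff: "f \<in> B.homog m k \<Longrightarrow> cdiff C k (\<gamma> k (\<iota> f)) = \<gamma> (k - 1) (\<iota> (B.D m f))"
  using diff_C[OF \<gamma>_closed(2)] \<gamma>_closed(3) by (simp add: cdga_B_eq)

lemma coefC_add: "a \<in> elts C k \<Longrightarrow> b \<in> elts C k \<Longrightarrow> coefC K (a \<oplus>\<^bsub>grade C k\<^esub> b) = coefC K a + coefC K b"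
  by (elim C_elt) (simp add: C_add coefC_\<iota> B.homog_add)

lemma coefC_smult: "a \<in> elts C k \<Longrightarrow> coefC K (c \<odot>\<^bsub>grade C k\<^esub> a) = c * coefC K a"
  by (elim C_elt) (simp add: C_smult coefC_\<iota> B.homog_scal)

lemma coefC_zero [simp]: "coefC K \<zero>\<^bsub>grade C k\<^esub> = 0"
  using coefC_smult[OF CC.M.zero_closed[of k], of K 0] by simp

lemma coefC_finsum:
  assumes "finite S" "\<And>x. x \<in> S \<Longrightarrow> u x \<in> elts C k"
  shows "coefC K (\<Oplus>\<^bsub>grade C k\<^esub>x\<in>S. u x) = (\<Sum>x\<in>S. coefC K (u x))"
  using assms
proof (induction S rule: finite_induct)
  case (insert x S)
  then have "coefC K (u x \<oplus>\<^bsub>grade C k\<^esub> (\<Oplus>\<^bsub>grade C k\<^esub>x\<in>S. u x)) = coefC K (u x) + (\<Sum>x\<in>S. coefC K (u x))"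
    by (subst coefC_add) (auto intro!: CC.M.finsum_closed)
  then show ?case using insert by (subst CC.M.finsum_insert) auto
qed simp

lemma coefC_degree: "a \<in> elts C k \<Longrightarrow> coefC K a \<noteq> 0 \<Longrightarrow> mdeg (degB m) K = k"
  by (elim C_elt) (metis B.homogD(3))

lemma coefC_diff:
  assumes "a \<in> elts C k" shows "coefC {#r#} (cdiff C k a) = 0"
proof -
  obtain f where f: "f \<in> B.homog m k" "a = \<gamma> k (\<iota> f)" using assms by (rule C_elt)
  have "B.dm m K {#r#} = 0" if "f K \<noteq> 0" for K
    using dmB_size[OF B.homogD(2)[OF f(1) that], of "{#r#}"] by fastforce
  then have "B.D m f {#r#} = 0" unfolding B.D_def by (intro sum.neutral) auto
  then show ?thesis using f coefC_\<iota>[OF B.D_homog] by (simp add: C_diff)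
qed

text \<open>The monomial \<open>x_r\<close> splits only as \<open>1\<close> times \<open>x_r\<close>
  or \<open>x_r\<close> times \<open>1\<close>; a linear term in a product thus needs a constant
  term in a factor.\<close>

lemma coefC_mult:
  assumes "a \<in> elts C k" "b \<in> elts C l" "coefC {#r#} (cmult C k l a b) \<noteq> 0"
  shows "coefC {#} a \<noteq> 0 \<or> coefC {#} b \<noteq> 0"
proof -
  obtain f where f: "f \<in> B.homog m k" "a = \<gamma> k (\<iota> f)" "\<And>K. coefC K a = f K" using assms(1) by (rule C_elt) blast
  obtain g where g: "g \<in> B.homog m l" "b = \<gamma> l (\<iota> g)" "\<And>K. coefC K b = g K" using assms(2) by (rule C_elt) blast
  have "pmul (degB m) {2..} f g {#r#} \<noteq> 0"
    using assms(3) coefC_\<iota>[OF B.homog_mul[OF f(1) g(1)]] f g by (simp add: C_mult)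
  then obtain M where M: "M \<subseteq># {#r#}" "f M \<noteq> 0" "g ({#r#} - M) \<noteq> 0"
    by (auto simp: pmul_def split: if_splits elim: sum.not_neutral_contains_not_neutral)
  have "M = {#} \<or> M = {#r#}"
  proof (cases M)
    case (add x N)
    have "x = r" using mset_subset_eqD[OF M(1), of x] add by simp
    then show ?thesis using M(1) add by simp
  qed simp
  then show ?thesis using M f(3) g(3) by auto
qed

subsection \<open>The invariant\<close>

lemma tensor_finite:
  "u \<in> elts (tensor_forms C n) k \<Longrightarrow> finite {K \<in> form_monos n. u K \<noteq> \<zero>\<^bsub>grade C (k - fdeg K)\<^esub>}"
  by (simp add: tensor_forms_def)

text \<open>A component \<open>x_r \<otimes> \<omega>\<close> of a product
  \<open>f(x_q) f(x_p)\<close> needs a factor with a component \<open>1 \<otimes> \<omega>'\<close>,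
  where \<open>\<omega>'\<close> divides \<open>\<omega>\<close> and so has degree at least -1. But
  \<open>\<omega>'\<close> would have the degree of \<open>x_q\<close> or of \<open>x_p\<close>, at
  most -2.\<close>

lemma coef_dx:
  assumes m: "m \<le> -2" and f: "f \<in> cdga_hom Q.\<T> (tensor_forms C n)"
    and r: "2 \<le> r" and L: "L \<in> form_monos n" "fdeg L = -1"
  shows "coefC {#r#} (f (degB m r - 1) (\<iota> (dB m r)) L) = 0"
proof -
  define h where "h = hom_comp (cdga_B m) f Q.incl"
  have h: "h \<in> cdga_hom (cdga_B m) (tensor_forms C n)"
    unfolding h_def by (rule cdga_hom_comp[OF is_cdga_B Q.incl_hom f])
  have hf: "h k y = f k (\<iota> y)" if "y \<in> B.homog m k" for k y
    using that by (simp add: h_def elts_B)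
  have hcl: "h k y \<in> elts (tensor_forms C n) k" if "y \<in> B.homog m k" for k y
    using cdga_homD(3)[OF h] that by (simp add: elts_B)
  let ?j = "degB m r - 1"
  \<comment> \<open>A linear functional on the degree that contains \<open>dB m r\<close>, so that
    the claim can be checked on each product \<open>x_q x_p\<close>.\<close>
  define T where "T y = coefC {#r#} (h ?j y L)" for y
  have T_add: "T (y + z) = T y + T z" if yz: "y \<in> B.homog m ?j" "z \<in> B.homog m ?j" for y z
  proof -
    have "h ?j (y + z) = h ?j y \<oplus>\<^bsub>grade (tensor_forms C n) ?j\<^esub> h ?j z"
      using cdga_homD(4)[OF h, of y ?j z] yz by (simp add: cdga_B_eq)
    then have "h ?j (y + z) L = h ?j y L \<oplus>\<^bsub>grade C (?j - fdeg L)\<^esub> h ?j z L"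
      using L by (simp add: tensor_forms_def)
    then show ?thesis unfolding T_def
      using tensor_value[OF hcl[OF yz(1)] L(1)] tensor_value[OF hcl[OF yz(2)] L(1)] by (simp add: coefC_add)
  qed
  have T_smult: "T (c \<cdot> y) = c * T y" if y: "y \<in> B.homog m ?j" for c y
  proof -
    have "h ?j (c \<cdot> y) = c \<odot>\<^bsub>grade (tensor_forms C n) ?j\<^esub> h ?j y"
      using cdga_homD(5)[OF h, of y ?j c] y by (simp add: cdga_B_eq)
    then have "h ?j (c \<cdot> y) L = c \<odot>\<^bsub>grade C (?j - fdeg L)\<^esub> h ?j y L"
      using L by (simp add: tensor_forms_def)
    then show ?thesis unfolding T_def
      using tensor_value[OF hcl[OF y] L(1)] by (simp add: coefC_smult)
  qed
  have T0: "T 0 = 0" using T_smult[of 0 0] by simp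
  have T_sum: "T (\<Sum>q\<in>S. F q) = (\<Sum>q\<in>S. T (F q))" if "finite S" "\<And>q. q \<in> S \<Longrightarrow> F q \<in> B.homog m ?j" for S :: "nat set" and F
    using that
  proof (induction S rule: finite_induct)
    case (insert q S)
    then have "T (F q + sum F S) = T (F q) + (\<Sum>q\<in>S. T (F q))"
      by (subst T_add) (auto intro: B.homog_sum)
    then show ?case unfolding sum.insert[OF insert(1,2)] .
  qed (simp_all only: sum.empty T0)
  have prod: "T (pmul (degB m) {2..} (pvar q) (pvar p)) = 0"
    if qp: "2 \<le> q" "2 \<le> p" "degB m q + degB m p = ?j" for q p
  proof -
    have v: "pvar q \<in> B.homog m (degB m q)" "pvar p \<in> B.homog m (degB m p)"
      using B.homog_pvar[of q m] B.homog_pvar[of p m] qp by auto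
    define a b where "a = h (degB m q) (pvar q)" and "b = h (degB m p) (pvar p)"
    have a: "a \<in> elts (tensor_forms C n) (degB m q)" and b: "b \<in> elts (tensor_forms C n) (degB m p)"
      unfolding a_def b_def using hcl v by auto
    have LM: "M \<in> form_monos n" "L - M \<in> form_monos n" if "M \<subseteq># L" for M
      using \<Omega>.mons_mono[OF L(1) that] \<Omega>.mons_diff[OF L(1)] by auto
    have "h ?j (pmul (degB m) {2..} (pvar q) (pvar p)) = cmult (tensor_forms C n) (degB m q) (degB m p) a b"
      unfolding a_def b_def qp(3)[symmetric] using cdga_homD(7)[OF h, of "pvar q" "degB m q" "pvar p" "degB m p"] v
      by (simp add: cdga_B_eq)
    then have e: "h ?j (pmul (degB m) {2..} (pvar q) (pvar p)) L =
      (\<Oplus>\<^bsub>grade C (degB m q + degB m p - fdeg L)\<^esub>M\<in>{M. M \<subseteq># L}.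
         ((-1) powi (fdeg M * (degB m p - fdeg (L - M))) * mon_sign form_deg M (L - M))
           \<odot>\<^bsub>grade C (degB m q + degB m p - fdeg L)\<^esub>
         cmult C (degB m q - fdeg M) (degB m p - fdeg (L - M)) (a M) (b (L - M)))"
      using L by (simp add: tensor_forms_def)
    have cl: "cmult C (degB m q - fdeg M) (degB m p - fdeg (L - M)) (a M) (b (L - M)) \<in> elts C (degB m q + degB m p - fdeg L)"
      if "M \<subseteq># L" for M
      using CC.mult_closed[OF tensor_value[OF a LM(1)[OF that]] tensor_value[OF b LM(2)[OF that]]]
      by (simp add: mdeg_diff[OF that] algebra_simps)
    have z: "coefC {#r#} (cmult C (degB m q - fdeg M) (degB m p - fdeg (L - M)) (a M) (b (L - M))) = 0"
      if M: "M \<subseteq># L" for M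
    proof (rule ccontr)
      assume "\<not> ?thesis"
      from coefC_mult[OF tensor_value[OF a LM(1)[OF M]] tensor_value[OF b LM(2)[OF M]] this]
      have "degB m q = fdeg M \<or> degB m p = fdeg (L - M)"
        using coefC_degree[OF tensor_value[OF a LM(1)[OF M]], of "{#}"]
          coefC_degree[OF tensor_value[OF b LM(2)[OF M]], of "{#}"] by auto
      moreover have "-1 \<le> fdeg M" "-1 \<le> fdeg (L - M)"
        using fdeg_subset[OF M] fdeg_subset[of "L - M" L] L by auto
      ultimately show False using degB_le[OF m qp(1)] degB_le[OF m qp(2)] by linarith
    qed
    show ?thesis unfolding T_def e using cl z
      by (subst coefC_finsum) (auto simp: coefC_smult intro!: CC.smult_closed)
  qed
  have "T (dB m r) = 0" unfolding dB_eq
  proof (subst T_sum)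
    have mem: "pmul (degB m) {2..} (pvar q) (pvar (r + 1 - q)) \<in> B.homog m ?j" if "q \<in> {2..<r}" for q
      using that degB_add[OF r that, of m] by (intro B.homog_mul'[OF B.homog_pvar B.homog_pvar]) auto
    then show "\<And>q. q \<in> {2..<r} \<Longrightarrow> coeffB m (r + 1 - q) q \<cdot> pmul (degB m) {2..} (pvar q) (pvar (r + 1 - q)) \<in> B.homog m ?j"
      by (rule B.homog_scal)
    show "(\<Sum>q = 2..<r. T (coeffB m (r + 1 - q) q \<cdot> pmul (degB m) {2..} (pvar q) (pvar (r + 1 - q)))) = 0"
      using mem degB_add[OF r, of _ m] by (intro sum.neutral ballI) (auto simp: T_smult prod)
  qed simp
  then show ?thesis using hf[OF dB_homog[of r m]] r by (simp add: T_def)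
qed

text \<open>
  The \<open>x\<^sub>r\<close>-component of \<open>f(x\<^sub>r)\<close> is a function on the simplex whose differential is the
  \<open>x\<^sub>r\<close>-component of \<open>f(dx\<^sub>r)\<close>; the latter vanishes, so the function is constant.
\<close>

lemma linear_part_constant:
  assumes m: "m \<le> -2" and f: "f \<in> cdga_hom Q.\<T> (tensor_forms C n)"
    and r: "2 \<le> r" and K0: "K0 \<in> form_monos n" "K0 \<noteq> {#}"
  shows "coefC {#r#} (f (degB m r) (\<iota> (pvar r)) K0) = 0"
proof (rule ccontr)
  assume nz: "coefC {#r#} (f (degB m r) (\<iota> (pvar r)) K0) \<noteq> 0"
  let ?k = "degB m r"
  have v: "pvar r \<in> B.homog m ?k" using B.homog_pvar[of r m] r by auto
  define u where "u = f ?k (\<iota> (pvar r))"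
  have u: "u \<in> elts (tensor_forms C n) ?k"
    unfolding u_def using cdga_homD(3)[OF f] \<gamma>_closed(2)[OF v] by blast
  \<comment> \<open>\<open>u\<close> has the same total degree as \<open>x_r\<close>, so the form
    standing next to \<open>x_r\<close> has degree 0: it is a polynomial in the
    \<open>t_i\<close>.\<close>
  have deg0: "fdeg K = 0" if "K \<in> form_monos n" "coefC {#r#} (u K) \<noteq> 0" for K
    using coefC_degree[OF tensor_value[OF u that(1)] that(2)] by simp
  have pos: "0 < g" if "K \<in> form_monos n" "coefC {#r#} (u K) \<noteq> 0" "g \<in># K" for K g
    using fdeg_0_positive[OF deg0] that by blast
  obtain j N where K0': "K0 = add_mset j N" using K0(2) by (meson multiset_cases)
  have N: "N \<in> form_monos n" "j \<in> form_gens n" using K0(1) unfolding K0' by (auto simp: \<Omega>.mons_add_mset)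
  have jpos: "0 < j" and Npos: "\<forall>g\<in>#N. 0 < g"
    using pos[OF K0(1)] nz unfolding K0' u_def by auto
  \<comment> \<open>The 1-form \<open>dt_j N\<close>. Among the polynomial monomials only
    \<open>t_j N\<close>, which is \<open>K0\<close>, has it in its differential, so the coefficient
    at \<open>L\<close> isolates that of \<open>K0\<close>.\<close>
  define L where "L = add_mset (- j) N"
  have "- j \<in> form_gens n" "- j \<notin># N" using N(2) jpos Npos by (auto simp: form_gens_def)
  then have L: "L \<in> form_monos n" unfolding L_def \<Omega>.mons_add_mset using N by blast
  have "fdeg N = 0" using deg0[OF K0(1)] nz jpos unfolding K0' u_def by (simp add: form_deg_def)
  then have L1: "fdeg L = -1" using jpos by (simp add: L_def form_deg_def)
  define S where "S = {K \<in> form_monos n. u K \<noteq> \<zero>\<^bsub>grade C (?k - fdeg K)\<^esub> \<and> form_dmono n K L \<noteq> 0}"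
  have finS: "finite S" unfolding S_def by (rule finite_subset[OF _ tensor_finite[OF u]]) auto
  have uK: "u K \<in> elts C (?k - 1 - fdeg L)" if "K \<in> S" for K
    using tensor_value[OF u, of K] form_dmono_degree[of K n L] that L1 by (auto simp: S_def)
  have dL: "cdiff C (?k - fdeg L) (u L) \<in> elts C (?k - 1 - fdeg L)"
    using CC.diff_closed[OF tensor_value[OF u L]] by (simp add: algebra_simps)
  have "f (?k - 1) (\<iota> (dB m r)) = cdiff (tensor_forms C n) ?k u"
  proof -
    have "cdiff Q.\<T> ?k (\<iota> (pvar r)) = \<iota> (dB m r)"
      using D_pvar_B[of "{2..}" r m] r \<gamma>_closed(3)[OF v] by (simp add: cdga_B_eq)
    then show ?thesis using cdga_homD(8)[OF f \<gamma>_closed(2)[OF v]] by (simp add: u_def)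
  qed
  then have "0 = coefC {#r#} (cdiff (tensor_forms C n) ?k u L)"
    using coef_dx[OF m f r L L1] by simp
  also have "cdiff (tensor_forms C n) ?k u L = cdiff C (?k - fdeg L) (u L) \<oplus>\<^bsub>grade C (?k - 1 - fdeg L)\<^esub>
       (\<Oplus>\<^bsub>grade C (?k - 1 - fdeg L)\<^esub>K\<in>S.
         ((-1) powi (?k - fdeg K) * form_dmono n K L) \<odot>\<^bsub>grade C (?k - 1 - fdeg L)\<^esub> u K)"
    using L by (simp add: tensor_forms_def S_def)
  also have "coefC {#r#} \<dots> = coefC {#r#} (cdiff C (?k - fdeg L) (u L)) +
      (\<Sum>K\<in>S. (-1) powi (?k - fdeg K) * form_dmono n K L * coefC {#r#} (u K))"
    using uK dL finS
    by (subst coefC_add coefC_finsum | auto intro!: CC.M.finsum_closed simp: coefC_smult)+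
  \<comment> \<open>By minimality the differential of the colimit produces nothing linear; only the
    differential of the forms remains.\<close>
  also have "coefC {#r#} (cdiff C (?k - fdeg L) (u L)) = 0"
    by (rule coefC_diff[OF tensor_value[OF u L]])
  also have "(\<Sum>K\<in>S. (-1) powi (?k - fdeg K) * form_dmono n K L * coefC {#r#} (u K)) =
    (\<Sum>K\<in>{K0}. (-1) powi (?k - fdeg K) * form_dmono n K L * coefC {#r#} (u K))"
  proof (rule sum.mono_neutral_right[OF finS])
    have d: "form_dmono n K0 L = of_nat (count K0 j)"
      unfolding L_def using form_dmono_function[OF K0(1) _ Npos jpos] L pos[OF K0(1)] nz
      by (auto simp: L_def u_def K0')
    then have "form_dmono n K0 L \<noteq> 0" unfolding K0' by simp
    moreover have "u K0 \<noteq> \<zero>\<^bsub>grade C (?k - fdeg K0)\<^esub>" using nz coefC_zero unfolding u_def by metis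
    ultimately show "{K0} \<subseteq> S" using K0(1) by (simp add: S_def)
    show "\<forall>K\<in>S - {K0}. (-1) powi (?k - fdeg K) * form_dmono n K L * coefC {#r#} (u K) = 0"
    proof
      fix K assume K: "K \<in> S - {K0}"
      have "form_dmono n K L = 0" if "coefC {#r#} (u K) \<noteq> 0"
        unfolding L_def using form_dmono_function[of K n N j] K pos[OF _ that] Npos jpos L
        by (auto simp: S_def L_def K0')
      then show "(-1) powi (?k - fdeg K) * form_dmono n K L * coefC {#r#} (u K) = 0" by fastforce
    qed
  qed
  finally have "form_dmono n K0 L = 0" using nz by (simp add: u_def)
  moreover have "form_dmono n K0 L = of_nat (count K0 j)"
    unfolding L_def using form_dmono_function[OF K0(1) _ Npos jpos] L pos[OF K0(1)] nz
    by (auto simp: L_def u_def K0')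
  ultimately show False unfolding K0' by simp
qed

text \<open>The coefficient at the form monomial \<open>{#}\<close> is the value at vertex 0, where
  \<open>t_1, ..., t_n\<close> vanish. By \<open>linear_part_constant\<close> it is the value on the
  whole simplex when \<open>m \<le> -2\<close> and \<open>2 \<le> r\<close>, so the point
  \<open>t\<close> may be ignored.\<close>

definition linear_coef :: "nat \<Rightarrow> nat \<times> (int \<Rightarrow> 'u \<Rightarrow> int multiset \<Rightarrow> ('u \<times> 'u) set) \<times> (nat \<Rightarrow> real) \<Rightarrow> rat" where
  "linear_coef r = (\<lambda>(n, f, t). coefC {#r#} (f (degB m r) (\<iota> (pvar r)) {#}))"

text \<open>Simplicial operators pull back the coefficient function. Being constant it is unchanged,
  as \<open>form_pull\<close> fixes the unit monomial.\<close>

lemma linear_coef_glue: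
  assumes m: "m \<le> -2" and r: "2 \<le> r" and "(a, b) \<in> glue (mapping_space Q.\<T> C)"
  shows "linear_coef r a = linear_coef r b"
proof -
  obtain k n \<theta> f t where a: "a = (k, act (mapping_space Q.\<T> C) k n \<theta> f, t)"
    and b: "b = (n, f, simplex_push k \<theta> t)" and f: "f \<in> cdga_hom Q.\<T> (tensor_forms C n)"
    using assms(3) by (auto simp: glue_def mapping_space_def)
  let ?k = "degB m r"
  have v: "pvar r \<in> B.homog m ?k" using B.homog_pvar[of r m] r by auto
  define u where "u = f ?k (\<iota> (pvar r))"
  have u: "u \<in> elts (tensor_forms C n) ?k"
    unfolding u_def using cdga_homD(3)[OF f] \<gamma>_closed(2)[OF v] by blast
  define S where "S = {K \<in> form_monos n. u K \<noteq> \<zero>\<^bsub>grade C (?k - fdeg K)\<^esub> \<and> form_pull k \<theta> K {#} \<noteq> 0}"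
  have finS: "finite S" unfolding S_def by (rule finite_subset[OF _ tensor_finite[OF u]]) auto
  have uK: "u K \<in> elts C ?k" if "K \<in> S" for K
    using tensor_value[OF u, of K] form_pull_degree[of K n k \<theta> "{#}"] that by (auto simp: S_def)
  have "linear_coef r a = coefC {#r#} (\<Oplus>\<^bsub>grade C ?k\<^esub>K\<in>S. form_pull k \<theta> K {#} \<odot>\<^bsub>grade C ?k\<^esub> u K)"
    using \<gamma>_closed(2)[OF v]
    by (simp add: a linear_coef_def mapping_space_def tensor_pull_def u_def S_def del: transport_simps)
  also have "\<dots> = (\<Sum>K\<in>S. form_pull k \<theta> K {#} * coefC {#r#} (u K))"
    using uK finS by (subst coefC_finsum) (auto simp: coefC_smult)
  also have "\<dots> = (\<Sum>K\<in>{{#}}. form_pull k \<theta> K {#} * coefC {#r#} (u K))"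
  \<comment> \<open>\<open>{#}\<close> is missing from \<open>S\<close> when \<open>u {#}\<close> is
    zero, so in general neither index set contains the other.\<close>
  proof (rule sum.mono_neutral_cong[OF _ finS])
    fix K :: "int multiset" assume "K \<in> {{#}} - S"
    then have K: "K = {#}" "{#} \<notin> S" by blast+
    then have "u {#} = \<zero>\<^bsub>grade C ?k\<^esub>" by (simp add: S_def form_pull_unit)
    then show "form_pull k \<theta> K {#} * coefC {#r#} (u K) = 0" unfolding K(1) by simp
  next
    fix K assume K: "K \<in> S - {{#}}"
    then have "coefC {#r#} (u K) = 0"
      unfolding u_def S_def by (intro linear_part_constant[OF m f r]) blast+
    then show "form_pull k \<theta> K {#} * coefC {#r#} (u K) = 0" by simp
  qed simp_all
  also have "\<dots> = linear_coef r b" by (simp add: form_pull_unit b linear_coef_def u_def)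
  finally show ?thesis .
qed

text \<open>The forms on the 0-simplex are just \<open>rat\<close>, with \<open>{#}\<close> as the
  only monomial, so the comparison \<open>\<gamma>\<close> from \<open>cdga_B m\<close> to the
  colimit is itself a vertex.\<close>

definition identity_vertex :: "int \<Rightarrow> 'u \<Rightarrow> int multiset \<Rightarrow> ('u \<times> 'u) set" where
  "identity_vertex = (\<lambda>k. \<lambda>x\<in>elts Q.\<T> k. \<lambda>K\<in>form_monos 0. \<gamma> k x)"

lemma identity_vertex_hom: "identity_vertex \<in> cdga_hom Q.\<T> (tensor_forms C 0)"
proof -
  note [simp del] = transport_simps
  interpret QT: cdga Q.\<T> by unfold_locales (rule Q.is_cdga_transport)
  have cl: "\<gamma> k x \<in> elts C k" if "x \<in> elts Q.\<T> k" for k x using that by (simp add: elts_C)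
  have iv: "identity_vertex k x = (\<lambda>K\<in>{{#}}. \<gamma> k x)" if "x \<in> elts Q.\<T> k" for k x
    using that by (simp add: identity_vertex_def form_monos_0)
  have "cmult (tensor_forms C 0) k l (\<lambda>K\<in>{{#}}. \<gamma> k x) (\<lambda>K\<in>{{#}}. \<gamma> l y) = (\<lambda>K\<in>{{#}}. \<gamma> (k + l) (cmult Q.\<T> k l x y))"
    if "x \<in> elts Q.\<T> k" "y \<in> elts Q.\<T> l" for k l x y
    using CC.mult_closed[OF cl[OF that(1)] cl[OF that(2)]] mult_C[OF that]
    by (auto simp: tensor_forms_def form_monos_0 CC.M.finsum_insert restrict_def fun_eq_iff)
  moreover have "cdiff (tensor_forms C 0) k (\<lambda>K\<in>{{#}}. \<gamma> k x) = (\<lambda>K\<in>{{#}}. \<gamma> (k - 1) (cdiff Q.\<T> k x))"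
    if "x \<in> elts Q.\<T> k" for k x
  proof -
    have "{K. K = {#} \<and> (K = {#} \<longrightarrow> \<gamma> k x \<noteq> \<zero>\<^bsub>grade C (k - fdeg K)\<^esub>) \<and> form_dmono 0 K {#} \<noteq> 0} = {}"
      by auto
    then show ?thesis
      using CC.diff_closed[OF cl[OF that]] diff_C[OF that]
      by (auto simp: tensor_forms_def form_monos_0 restrict_def fun_eq_iff)
  qed
  moreover have "identity_vertex k x \<in> elts (tensor_forms C 0) k" if "x \<in> elts Q.\<T> k" for k x
    unfolding iv[OF that] by (simp add: tensor_forms_def form_monos_0 cl[OF that])
  moreover have "identity_vertex k (x \<oplus>\<^bsub>grade Q.\<T> k\<^esub> y) =
      identity_vertex k x \<oplus>\<^bsub>grade (tensor_forms C 0) k\<^esub> identity_vertex k y"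
    if "x \<in> elts Q.\<T> k" "y \<in> elts Q.\<T> k" for k x y
    unfolding iv[OF that(1)] iv[OF that(2)] iv[OF QT.M.a_closed[OF that]]
    by (auto simp: tensor_forms_def form_monos_0 restrict_def fun_eq_iff add_C[OF that])
  moreover have "identity_vertex k (c \<odot>\<^bsub>grade Q.\<T> k\<^esub> x) =
      c \<odot>\<^bsub>grade (tensor_forms C 0) k\<^esub> identity_vertex k x"
    if "x \<in> elts Q.\<T> k" for c k x
    unfolding iv[OF that] iv[OF QT.smult_closed[OF that]]
    by (auto simp: tensor_forms_def form_monos_0 restrict_def fun_eq_iff smult_C[OF that])
  moreover have "identity_vertex 0 (cunit Q.\<T>) = cunit (tensor_forms C 0)"
    unfolding iv[OF QT.unit_closed]
    by (auto simp: tensor_forms_def form_monos_0 restrict_def fun_eq_iff unit_C)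
  moreover have "identity_vertex k \<in> extensional (elts Q.\<T> k)" for k
    by (simp add: identity_vertex_def)
  ultimately show ?thesis
    unfolding cdga_hom_def linear_between_def mem_Collect_eq
    using iv QT.mult_closed QT.diff_closed by (intro conjI allI ballI Pi_I) simp_all
qed

end

subsection \<open>Path components of a realization\<close>

definition vertex_point :: "nat \<Rightarrow> real" where
  "vertex_point i = (if i = 0 then 1 else 0)"

lemma vertex_point: "vertex_point \<in> standard_simplex 0"
  by (auto simp: standard_simplex_def vertex_point_def)

lemma point_eq_refl: "z \<in> points X \<Longrightarrow> (z, z) \<in> point_eq X"
  by (simp add: point_eq_def)

lemma topspace_realization: "topspace (realization X) = points X // point_eq X"
proof
  show "topspace (realization X) \<subseteq> points X // point_eq X"
    using openin_topspace[of "realization X"] unfolding openin_realization by blast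
  have "{t \<in> standard_simplex n. point_eq X `` {(n, x, t)} \<in> points X // point_eq X} = standard_simplex n"
    if "x \<in> simp X n" for n x
    using that by (auto simp: points_def intro: quotientI)
  moreover have "openin (subtopology (powertop_real UNIV) (standard_simplex n)) (standard_simplex n)" for n
    using openin_topspace[of "subtopology (powertop_real UNIV) (standard_simplex n)"] by simp
  ultimately have "openin (realization X) (points X // point_eq X)"
    unfolding openin_realization by simp
  then show "points X // point_eq X \<subseteq> topspace (realization X)" by (rule openin_subset)
qed

text \<open>Openness in the realization is tested on single simplices. A function that is constant
  on simplices and compatible with gluing therefore has open level sets, so it is constant on
  connected components, and these contain the path components.\<close>

lemma path_component_invariant:
  assumes glue: "\<And>a b. (a, b) \<in> glue X \<Longrightarrow> c a = c b"
    and simplex: "\<And>n x t t'. c (n, x, t) = c (n, x, t')"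
    and pc: "path_component_of (realization X) A B" and ab: "a \<in> A" "b \<in> B"
  shows "c a = c b"
proof (rule ccontr)
  assume ne: "c a \<noteq> c b"
  have rel: "c y = c z" if "(y, z) \<in> point_eq X" for y z
  proof -
    have "(y, z) \<in> (glue X \<union> (glue X)\<inverse>)\<^sup>*" using that by (simp add: point_eq_def)
    then show ?thesis by (induction rule: rtrancl_induct) (use glue in fastforce)+
  qed
  have const: "c y = c z" if P: "P \<in> points X // point_eq X" and yz: "y \<in> P" "z \<in> P" for P y z
  proof -
    obtain w where "P = point_eq X `` {w}" using P by (rule quotientE)
    then have "(w, y) \<in> point_eq X" "(w, z) \<in> point_eq X" using yz by auto
    from rel[OF this(1)] rel[OF this(2)] show ?thesis by simp
  qed
  \<comment> \<open>The preimage of \<open>V\<close> under the function induced by \<open>c\<close>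
    on the quotient. Its trace on each simplex is everything or nothing, so it is open for every
    \<open>V\<close>; taking \<open>{c a}\<close> and its complement gives the separation
    below.\<close>
  define U where "U V = {P \<in> points X // point_eq X. \<exists>y\<in>P. c y \<in> V}" for V
  have op: "openin (realization X) (U V)" for V
    unfolding openin_realization
  proof (intro conjI allI ballI)
    fix n x assume x: "x \<in> simp X n"
    \<comment> \<open>\<open>c\<close> does not depend on the third component, so
      \<open>undefined\<close> stands for an arbitrary point of the simplex.\<close>
    have "point_eq X `` {(n, x, t)} \<in> U V \<longleftrightarrow> c (n, x, undefined) \<in> V" if t: "t \<in> standard_simplex n" for t
    proof -
      let ?P = "point_eq X `` {(n, x, t)}"
      have p: "(n, x, t) \<in> points X" using x t by (simp add: points_def)
      have q: "?P \<in> points X // point_eq X" by (rule quotientI[OF p])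
      have mem: "(n, x, t) \<in> ?P" using point_eq_refl[OF p] by blast
      have ceq: "c (n, x, undefined) = c (n, x, t)" by (rule simplex)
      show ?thesis unfolding ceq
      proof
        assume "?P \<in> U V"
        then obtain y where y: "y \<in> ?P" "c y \<in> V" unfolding U_def by blast
        then show "c (n, x, t) \<in> V" using const[OF q mem y(1)] by simp
      next
        assume "c (n, x, t) \<in> V"
        then show "?P \<in> U V" using q mem unfolding U_def by blast
      qed
    qed
    then have "{t \<in> standard_simplex n. point_eq X `` {(n, x, t)} \<in> U V} =
      (if c (n, x, undefined) \<in> V then standard_simplex n else {})"
      by auto
    then show "openin (subtopology (powertop_real UNIV) (standard_simplex n))
        {t \<in> standard_simplex n. point_eq X `` {(n, x, t)} \<in> U V}"
      using openin_topspace[of "subtopology (powertop_real UNIV) (standard_simplex n)"] by simp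
  qed (auto simp: U_def)
  have "connected_component_of (realization X) A B"
    using path_component_subset_connected_component_of[of "realization X" A] pc by blast
  then obtain S where S: "connectedin (realization X) S" "A \<in> S" "B \<in> S"
    unfolding connected_component_of_def by blast
  have Ssub: "S \<subseteq> points X // point_eq X"
    using connectedin_subset_topspace[OF S(1)] unfolding topspace_realization .
  have nonempty: "P \<noteq> {}" if "P \<in> S" for P
  proof -
    have "P \<in> points X // point_eq X" using Ssub that by blast
    then obtain z where "z \<in> points X" "P = point_eq X `` {z}" by (rule quotientE)
    then show ?thesis using point_eq_refl[of z X] by blast
  qed
  have "S \<subseteq> U {c a} \<union> U (- {c a})"
    using Ssub nonempty unfolding U_def by fastforce
  moreover have "U {c a} \<inter> U (- {c a}) \<inter> S = {}"
  proof (rule equals0I)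
    fix P assume "P \<in> U {c a} \<inter> U (- {c a}) \<inter> S"
    then obtain y z where "P \<in> points X // point_eq X" "y \<in> P" "c y = c a" "z \<in> P" "c z \<noteq> c a"
      unfolding U_def by blast
    then show False using const[of P y z] by simp
  qed
  moreover have "c b \<in> - {c a}" using ne by simp
  then have "A \<in> U {c a}" "B \<in> U (- {c a})" using S Ssub ab unfolding U_def by blast+
  ultimately show False
    using S(1) op[of "{c a}"] op[of "- {c a}"] S(2,3) unfolding connectedin by blast
qed

section \<open>The contradiction on path components\<close>

lemma (in B_tower) not_hfp:
  assumes m: "m \<le> -2"
  shows "\<not> homotopically_finitely_presented TYPE('u) (cdga_B m)"
proof
  assume "homotopically_finitely_presented TYPE('u) (cdga_B m)"
  then have "weak_equivalence
      (hocolim_sset I (\<lambda>i. mapping_space Q.\<T> (dobj Z i)) (\<lambda>a. mapping_push Q.\<T> (darr Z a)))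
      (mapping_space Q.\<T> C) (canonical_map Q.\<T> I Z)"
    using cofibrant_transport_B[OF Q.transported_axioms] Q.quasi_iso_retr filtered is_diagram_Z
      proj_cofibrant_replacement_Z
    unfolding homotopically_finitely_presented_def by blast
  then have surj: "\<exists>x\<in>topspace (realization (hocolim_sset I (\<lambda>i. mapping_space Q.\<T> (dobj Z i)) (\<lambda>a. mapping_push Q.\<T> (darr Z a)))).
      path_component_of (realization (mapping_space Q.\<T> C))
        (realize_map (mapping_space Q.\<T> C) (canonical_map Q.\<T> I Z) x) y"
    if "y \<in> topspace (realization (mapping_space Q.\<T> C))" for y
    using that unfolding weak_equivalence_def weak_homotopy_equivalence_def by blast
  let ?X = "hocolim_sset I (\<lambda>i. mapping_space Q.\<T> (dobj Z i)) (\<lambda>a. mapping_push Q.\<T> (darr Z a))"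
  let ?Y = "mapping_space Q.\<T> C"
  define y0 where "y0 = (0::nat, identity_vertex, vertex_point)"
  have y0: "y0 \<in> points ?Y"
    using identity_vertex_hom vertex_point by (simp add: points_def y0_def mapping_space_def)
  then have "point_eq ?Y `` {y0} \<in> topspace (realization ?Y)"
    unfolding topspace_realization by (rule quotientI)
  from surj[OF this] obtain P where P: "P \<in> points ?X // point_eq ?X"
    and pc: "path_component_of (realization ?Y) (realize_map ?Y (canonical_map Q.\<T> I Z) P) (point_eq ?Y `` {y0})"
    unfolding topspace_realization by blast
  define D where "D = realize_map ?Y (canonical_map Q.\<T> I Z) P"
  \<comment> \<open>\<open>D\<close> is an end of a path, hence a point of the realization. So it
    contains a representative \<open>w\<close>, and \<open>w\<close> is equivalent to the image of
    some member of \<open>P\<close>.\<close>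
  have "D \<in> points ?Y // point_eq ?Y"
    using path_component_in_topspace[OF pc] unfolding topspace_realization D_def by blast
  then obtain w where w: "w \<in> points ?Y" "D = point_eq ?Y `` {w}" by (rule quotientE)
  then have "w \<in> D" using point_eq_refl by blast
  then obtain n s t where nst: "(n, s, t) \<in> P" and bw: "((n, canonical_map Q.\<T> I Z n s, t), w) \<in> point_eq ?Y"
    unfolding D_def realize_map_def by auto
  define b where "b = (n, canonical_map Q.\<T> I Z n s, t)"
  have b: "b \<in> points ?Y" using bw by (simp add: b_def point_eq_def)
  have "b \<in> D" unfolding D_def realize_map_def using nst point_eq_refl[OF b] by (force simp: b_def)
  have "(n, s, t) \<in> points ?X" using P nst by (auto simp: point_eq_def elim!: quotientE)
  then obtain \<sigma> f where s: "s = (\<sigma>, f)" and f: "f \<in> cdga_hom Q.\<T> (tensor_forms (dobj Z (source I \<sigma>)) n)"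
    by (auto simp: points_def hocolim_sset_def mapping_space_def)
  \<comment> \<open>The stage at which the chain of the simplex starts: the coefficients of
    \<open>f\<close> are polynomials in generators of index at most \<open>i\<close>.\<close>
  define i where "i = src (\<sigma> (0, 0))"
  have src: "source I \<sigma> = \<nu> i" by (simp add: source_def i_def)
  \<comment> \<open>Any index above \<open>i\<close> would do, but it must be at least 2 to name a
    generator, and \<open>i\<close> may be 0.\<close>
  define r where "r = i + 2"
  have r: "2 \<le> r" "i < r" by (auto simp: r_def)
  have v: "pvar r \<in> B.homog m (degB m r)" using B.homog_pvar[of r m] r by auto
  have "f (degB m r) (\<iota> (pvar r)) \<in> elts (tensor_forms (ZZ i) n) (degB m r)"
    using cdga_homD(3)[OF f \<gamma>_closed(2)[OF v]] src by simp
  from tensor_value[OF this empty_form_monos] have fe: "f (degB m r) (\<iota> (pvar r)) {#} \<in> elts (ZZ i) (degB m r)" by simp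
  then obtain g where g: "g \<in> elts (FB i) (degB m r)" "f (degB m r) (\<iota> (pvar r)) {#} = \<iota> g" by auto
  have "linear_coef r b = coefC {#r#} (germ I Z (\<nu> i) (degB m r) (f (degB m r) (\<iota> (pvar r)) {#}))"
    using \<gamma>_closed(2)[OF v] src
    by (simp add: b_def s linear_coef_def canonical_map_def mapping_push_def tensor_push_def del: transport_simps)
  also have "\<dots> = g {#r#}"
    unfolding germ_Z[OF fe] using coefC_\<gamma>[OF ZZ_Q[OF fe]] g Z.retract[OF g(1)] by simp
  also have "\<dots> = 0" using g(1) r by (auto simp: elts_FB)
  finally have "linear_coef r b = 0" .
  moreover have "linear_coef r y0 = 1"
    using \<gamma>_closed(2)[OF v] coefC_\<iota>[OF v]
    by (simp add: y0_def linear_coef_def identity_vertex_def del: transport_simps)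
  moreover have "linear_coef r b = linear_coef r y0"
  proof (rule path_component_invariant[OF linear_coef_glue[OF m r(1)] _ pc])
    show "b \<in> realize_map ?Y (canonical_map Q.\<T> I Z) P" using \<open>b \<in> D\<close> by (simp add: D_def)
    show "y0 \<in> point_eq ?Y `` {y0}" using point_eq_refl[OF y0] by blast
  qed (auto simp: linear_coef_def)
  ultimately show False by simp
qed

subsection \<open>Conclusion\<close>

text \<open>A finite list of arguments and values determines such a function. This is what allows
  polynomials to be encoded in an arbitrary infinite type.\<close>

lemma countable_finite_support:
  assumes "countable (UNIV :: 'a set)"
  shows "countable {f :: 'a \<Rightarrow> rat. finite {K. f K \<noteq> 0}}"
proof (rule countable_subset)
  let ?F = "\<lambda>xs :: ('a \<times> rat) list. \<lambda>K. \<Sum>(L, c)\<leftarrow>xs. if L = K then c else 0"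
  have "countable (UNIV \<times> UNIV :: ('a \<times> rat) set)" using assms by (intro countable_SIGMA) auto
  then show "countable (?F ` lists (UNIV \<times> UNIV))" by (intro countable_image countable_lists)
  show "{f :: 'a \<Rightarrow> rat. finite {K. f K \<noteq> 0}} \<subseteq> ?F ` lists (UNIV \<times> UNIV)"
  proof
    fix f :: "'a \<Rightarrow> rat" assume "f \<in> {f. finite {K. f K \<noteq> 0}}"
    then have fin: "finite {K. f K \<noteq> 0}" by simp
    then obtain Ks where Ks: "set Ks = {K. f K \<noteq> 0}" "distinct Ks"
      using finite_distinct_list by blast
    have "?F (map (\<lambda>K. (K, f K)) Ks) = f"
    proof
      fix K
      have "?F (map (\<lambda>K. (K, f K)) Ks) K = (\<Sum>L\<in>set Ks. if L = K then f L else 0)"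
        using Ks(2) by (simp add: sum_list_distinct_conv_sum_set comp_def)
      also have "\<dots> = f K" unfolding Ks(1) sum.delta[OF fin] by simp
      finally show "?F (map (\<lambda>K. (K, f K)) Ks) K = f K" .
    qed
    then show "f \<in> ?F ` lists (UNIV \<times> UNIV)"
      by (intro image_eqI[of _ _ "map (\<lambda>K. (K, f K)) Ks"]) auto
  qed
qed

theorem proposition6p25:
  fixes m :: int
  assumes "m \<le> -2"
  shows "\<not> homotopically_finitely_presented TYPE('u::infinite) (cdga_B m)"
proof -
  obtain \<nu> :: "nat \<Rightarrow> 'u" where \<nu>: "inj \<nu>"
    using infinite_UNIV infinite_countable_subset by blast
  let ?S = "{f :: nat multiset \<Rightarrow> rat. finite {K. f K \<noteq> 0}}"
  have "UNIV = range (mset :: nat list \<Rightarrow> nat multiset)" using ex_mset by (metis surjI surj_def)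
  then have "countable (UNIV :: nat multiset set)" by (metis countable_image countableI_type)
  then have S: "countable ?S" by (rule countable_finite_support)
  \<comment> \<open>A polynomial is sent to its number in an enumeration of all finitely supported
    functions, and that number to \<open>'u\<close> by \<open>\<nu>\<close>; decoding reverses both
    steps.\<close>
  interpret B_tower m "\<lambda>f. \<nu> (to_nat_on ?S f)" "\<lambda>x. from_nat_into ?S (inv_into UNIV \<nu> x)" \<nu>
  proof
    fix f :: "nat multiset \<Rightarrow> rat" assume "finite {K. f K \<noteq> 0}"
    then show "from_nat_into ?S (inv_into UNIV \<nu> (\<nu> (to_nat_on ?S f))) = f"
      using S \<nu> by (simp add: from_nat_into_to_nat_on)
  qed (rule \<nu>)
  show ?thesis by (rule not_hfp[OF assms])
qed

end
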